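(* Let $\mathcal{M}$ denote either the class of all matroids, or, for a fixed prime power $q$, the class of all $q$-matroids over $\mathbb{F}_q$ such that every interval of length at least one of the support lattice has a proper interval decomposition. Then the Tutte polynomial $M\mapsto\tau(M;x,y)$ is a $q$-Tutte–Grothendieck invariant on $\mathcal{M}$.
   Context: A matroid or $q$-matroid is a pair $M=(\mathcal{L},r)$, where $\mathcal{L}$ is either the Boolean lattice of all subsets of a finite set (matroid case) or the lattice of all subspaces of a finite-dimensional vector space over $\mathbb{F}_q$ ($q$-matroid case), ordered by inclusion with meet $\wedge$ and join $\vee$. In the matroid case, formulas involving $q$ are read with $q=1$. $\mathrm{h}(x)$ is the cardinality, respectively dimension, of $x$; $\mathbf{0},\mathbf{1}$ are the least and greatest elements; $n=\mathrm{h}(\mathbf{1})$. The function $r:\mathcal{L}\to\mathbb{Z}_{\ge 0}$ satisfies: $0\le r(x)\le \mathrm{h}(x)$; $x\le y\Rightarrow r(x)\le r(y)$; $r(x\vee y)+r(x\wedge y)\le r(x)+r(y)$. The nullity is $\nu(x)=\mathrm{h}(x)-r(x)$. An interval $[a,b]$ has length $\mathrm{h}(b)-\mathrm{h}(a)$. The minor $M([a,b])$ is $([a,b],r_{[a,b]})$ with $r_{[a,b]}(x)=r(x)-r(a)$ (it is regarded as a member of the same class via the isomorphism of $[a,b]$ with a Boolean, resp. subspace, lattice); $M(a):=M([\mathbf{0},a])$ and $M/a:=M([a,\mathbf{1}])$. $M_1=(\mathcal{L}_1,r_1)\cong M_2=(\mathcal{L}_2,r_2)$ means there is a lattice isomorphism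 $\varphi:\mathcal{L}_1\to\mathcal{L}_2$ with $r_1(x)=r_2(\varphi(x))$ for all $x$. Atoms are elements of height $1$; coatoms are elements of height $n-1$. An element $x$ is independent if $r(x)=\mathrm{h}(x)$. A coloop is a coatom $x$ with $r(x)=r(\mathbf{1})-1$. A diamond is an interval $[a,b]$ of length 2; it is prime if $r(x)-r(a)=1$ and $r(b)-r(x)=0$ for every $a<x<b$. An interval is prime-free if it contains no prime diamond; $M$ is prime-free if $\mathcal{L}$ is. A proper interval decomposition $\mathcal{P}(e)$ of a lattice $\mathcal{L}$ of height $n$ is a partition of $\mathcal{L}$ into disjoint intervals of the form $[e,\mathbf{1}]\,\dot\cup\,[\mathbf{0},e^c]\,\dot\cup\,[e_1,\bar e_1]\,\dot\cup\cdots\dot\cup\,[e_{q^{n-1}-1},\bar e_{q^{n-1}-1}]$, where $e$ is an atom, $e^c$ is a complement of $e$ (i.e. $e\wedge e^c=\mathbf{0}$, $e\vee e^c=\mathbf{1}$), and each $e_k$ is an atom, $\bar e_k$ a coatom, $e_k\le \bar e_k$. (For Boolean lattices, $q=1$, it is $[e,\mathbf{1}]\,\dot\cup\,[\mathbf{0},e^c]$.) A Tutte partition of $M$ is a partition $\mathcal{P}$ of $\mathcal{L}$ into intervals such that every $[a,b]\in\mathcal{P}$ satisfies $r(a)=\mathrm{h}(a)$, $r(b)=r(\mathbf{1})$ and is prime-free. The Tutte polynomial is $\tau(M;x,y)=\sum_{[a,b]\in\mathcal{P}}x^{r(b)-r(a)}y^{\nu(b)-\nu(a)}\in\mathbb{Z}[x,y]$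 for any Tutte partition $\mathcal{P}$ of $M$; for $M\in\mathcal{M}$ a Tutte partition exists and the polynomial does not depend on its choice. A function $f$ on $\mathcal{M}$ is a $q$-Tutte–Grothendieck invariant if: ($q$-P1) $M_1\cong M_2$ implies $f(M_1)=f(M_2)$; ($q$-P2) if $M$ is prime-free, then $f(M)=f(M(e))f(M/e)$ for any atom $e\in\mathcal{L}$; ($q$-P3) if $M$ is not prime-free, and $e$ is an atom that is independent and contained in every coloop of $M$, then there exists a proper interval decomposition $\mathcal{P}(e)$ such that $f(M)=\sum_{I\in\mathcal{P}(e)}f(M(I))=f(M(e^c))+f(M/e)+\sum_{k=1}^{q^{n-1}-1}f(M([e_k,\bar e_k]))$. *)

theory Defs
  imports
    "HOL-Algebra.Lattice"
    "HOL-Library.Cardinality"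
    "HOL-Library.Disjoint_Sets"
    "HOL-Library.Function_Algebras"
    "HOL-Computational_Algebra.Polynomial"
begin

section \<open>Support lattices\<close>

definition subset_lattice :: "'e set \<Rightarrow> 'e set gorder" where
  "subset_lattice E = \<lparr>carrier = Pow E, eq = (=), le = (\<subseteq>)\<rparr>"

definition subspace_lattice :: "('k::field \<Rightarrow> 'v::ab_group_add \<Rightarrow> 'v) \<Rightarrow> 'v set \<Rightarrow> 'v set gorder" where
  "subspace_lattice scale V = \<lparr>carrier = {W. module.subspace scale W \<and> W \<subseteq> V}, eq = (=), le = (\<subseteq>)\<rparr>"

text \<open>\<^const>\<open>join_pres\<close> and \<^const>\<open>meet_pres\<close> include that both structures are lattices.\<close>

definition lattice_iso :: "('a, 'c) gorder_scheme \<Rightarrow> ('b, 'd) gorder_scheme \<Rightarrow> ('a \<Rightarrow> 'b) \<Rightarrow> bool" where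
  "lattice_iso L1 L2 \<phi> \<longleftrightarrow>
     bij_betw \<phi> (carrier L1) (carrier L2) \<and> join_pres L1 L2 \<phi> \<and> meet_pres L1 L2 \<phi>"

text \<open>
  Intervals of Boolean (subspace) lattices are again regarded as Boolean (subspace) lattices, so
  the support lattices are taken up to isomorphism. Up to isomorphism every finite set is a finite
  set of natural numbers, and every vector space of dimension \<open>n\<close> over \<open>'k\<close> is the coordinate
  space of functions \<open>nat \<Rightarrow> 'k\<close> vanishing from \<open>n\<close> on; lemmas \<open>Boolean_lattice_subset_lattice\<close>
  and \<open>linear_lattice_subspace_lattice\<close> below confirm that no support lattice is lost.
\<close>

definition coord_scale :: "'k::field \<Rightarrow> (nat \<Rightarrow> 'k) \<Rightarrow> nat \<Rightarrow> 'k" where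
  "coord_scale c v = (\<lambda>i. c * v i)"

definition coord_space :: "nat \<Rightarrow> (nat \<Rightarrow> 'k::field) set" where
  "coord_space n = {v. \<forall>i\<ge>n. v i = 0}"

definition Boolean_lattice :: "('a, 'c) gorder_scheme \<Rightarrow> bool" where
  "Boolean_lattice L \<longleftrightarrow> (\<exists>(E::nat set) \<phi>. finite E \<and> lattice_iso L (subset_lattice E) \<phi>)"

definition linear_lattice :: "'k::field itself \<Rightarrow> ('a, 'c) gorder_scheme \<Rightarrow> bool" where
  "linear_lattice K L \<longleftrightarrow>
     (\<exists>n \<phi>. lattice_iso L
        (subspace_lattice (coord_scale :: 'k \<Rightarrow> (nat \<Rightarrow> 'k) \<Rightarrow> nat \<Rightarrow> 'k) (coord_space n)) \<phi>)"

text \<open>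
  The height is the length of a longest chain from the bottom. It is the cardinality in a subset
  lattice and the dimension in a subspace lattice: see \<open>height_subset_lattice\<close> and
  \<open>height_subspace_lattice\<close> below.
\<close>

definition height :: "('a, 'c) gorder_scheme \<Rightarrow> 'a \<Rightarrow> nat" where
  "height L x = (GREATEST k. \<exists>c. c 0 = \<bottom>\<^bsub>L\<^esub> \<and> c k = x \<and>
     (\<forall>i\<le>k. c i \<in> carrier L) \<and> (\<forall>i<k. c i \<sqsubset>\<^bsub>L\<^esub> c (Suc i)))"

definition atom :: "('a, 'c) gorder_scheme \<Rightarrow> 'a \<Rightarrow> bool" where
  "atom L x \<longleftrightarrow> x \<in> carrier L \<and> height L x = 1"

definition coatom :: "('a, 'c) gorder_scheme \<Rightarrow> 'a \<Rightarrow> bool" where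
  "coatom L x \<longleftrightarrow> x \<in> carrier L \<and> height L x + 1 = height L \<top>\<^bsub>L\<^esub>"

definition is_complement :: "('a, 'c) gorder_scheme \<Rightarrow> 'a \<Rightarrow> 'a \<Rightarrow> bool" where
  "is_complement L x y \<longleftrightarrow> y \<in> carrier L \<and> x \<sqinter>\<^bsub>L\<^esub> y = \<bottom>\<^bsub>L\<^esub> \<and> x \<squnion>\<^bsub>L\<^esub> y = \<top>\<^bsub>L\<^esub>"

definition interval_lattice :: "('a, 'c) gorder_scheme \<Rightarrow> 'a \<Rightarrow> 'a \<Rightarrow> ('a, 'c) gorder_scheme" where
  "interval_lattice L a b = L\<lparr>carrier := \<lbrace>a..b\<rbrace>\<^bsub>L\<^esub>\<rparr>"

section \<open>Interval partitions\<close>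

text \<open>
  A partition into intervals is given by the set of the pairs of endpoints of its blocks. As blocks
  are nonempty, distinct pairs have distinct blocks.
\<close>

definition interval_partition :: "('a, 'c) gorder_scheme \<Rightarrow> ('a \<times> 'a) set \<Rightarrow> bool" where
  "interval_partition L P \<longleftrightarrow>
     P \<subseteq> carrier L \<times> carrier L \<and> partition_on (carrier L) ((\<lambda>(a, b). \<lbrace>a..b\<rbrace>\<^bsub>L\<^esub>) ` P)"

definition proper_interval_decomposition ::
    "nat \<Rightarrow> ('a, 'c) gorder_scheme \<Rightarrow> 'a \<Rightarrow> ('a \<times> 'a) set \<Rightarrow> bool" where
  "proper_interval_decomposition q L e P \<longleftrightarrow>
     atom L e \<and> interval_partition L P \<and>
     (\<exists>e' F. is_complement L e e' \<and> P = {(e, \<top>\<^bsub>L\<^esub>), (\<bottom>\<^bsub>L\<^esub>, e')} \<union> F \<and>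
        finite F \<and> card F = q ^ (height L \<top>\<^bsub>L\<^esub> - 1) - 1 \<and>
        (\<forall>(a, b)\<in>F. atom L a \<and> coatom L b \<and> a \<sqsubseteq>\<^bsub>L\<^esub> b))"

section \<open>Matroids and \<open>q\<close>-matroids\<close>

record 'a ranked_lattice = "'a gorder" +
  rk :: "'a \<Rightarrow> nat"

definition rank_function :: "'a ranked_lattice \<Rightarrow> bool" where
  "rank_function M \<longleftrightarrow>
     (\<forall>x\<in>carrier M. rk M x \<le> height M x) \<and>
     (\<forall>x\<in>carrier M. \<forall>y\<in>carrier M. x \<sqsubseteq>\<^bsub>M\<^esub> y \<longrightarrow> rk M x \<le> rk M y) \<and>
     (\<forall>x\<in>carrier M. \<forall>y\<in>carrier M. rk M (x \<squnion>\<^bsub>M\<^esub> y) + rk M (x \<sqinter>\<^bsub>M\<^esub> y) \<le> rk M x + rk M y)"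

definition matroids :: "'a ranked_lattice set" where
  "matroids = {M. Boolean_lattice M \<and> rank_function M}"

definition q_matroids :: "'k::{field,finite} itself \<Rightarrow> 'a ranked_lattice set" where
  "q_matroids K = {M. linear_lattice K M \<and> rank_function M}"

definition decomposable_q_matroids :: "'k::{field,finite} itself \<Rightarrow> 'a ranked_lattice set" where
  "decomposable_q_matroids K =
     {M \<in> q_matroids K. \<forall>a\<in>carrier M. \<forall>b\<in>carrier M.
        a \<sqsubseteq>\<^bsub>M\<^esub> b \<and> height M b - height M a \<ge> 1 \<longrightarrow>
        (\<exists>e P. proper_interval_decomposition CARD('k) (interval_lattice M a b) e P)}"

definition nullity :: "'a ranked_lattice \<Rightarrow> 'a \<Rightarrow> nat" where
  "nullity M x = height M x - rk M x"

definition minor :: "'a ranked_lattice \<Rightarrow> 'a \<Rightarrow> 'a \<Rightarrow> 'a ranked_lattice" where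
  "minor M a b = (interval_lattice M a b)\<lparr>rk := \<lambda>x. rk M x - rk M a\<rparr>"

definition restriction :: "'a ranked_lattice \<Rightarrow> 'a \<Rightarrow> 'a ranked_lattice" where
  "restriction M a = minor M \<bottom>\<^bsub>M\<^esub> a"

definition contraction :: "'a ranked_lattice \<Rightarrow> 'a \<Rightarrow> 'a ranked_lattice" where
  "contraction M a = minor M a \<top>\<^bsub>M\<^esub>"

definition ranked_iso :: "'a ranked_lattice \<Rightarrow> 'b ranked_lattice \<Rightarrow> bool" where
  "ranked_iso M1 M2 \<longleftrightarrow> (\<exists>\<phi>. lattice_iso M1 M2 \<phi> \<and> (\<forall>x\<in>carrier M1. rk M1 x = rk M2 (\<phi> x)))"

definition independent_element :: "'a ranked_lattice \<Rightarrow> 'a \<Rightarrow> bool" where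
  "independent_element M x \<longleftrightarrow> x \<in> carrier M \<and> rk M x = height M x"

definition coloop :: "'a ranked_lattice \<Rightarrow> 'a \<Rightarrow> bool" where
  "coloop M x \<longleftrightarrow> coatom M x \<and> rk M x + 1 = rk M \<top>\<^bsub>M\<^esub>"

definition diamond :: "('a, 'c) gorder_scheme \<Rightarrow> 'a \<Rightarrow> 'a \<Rightarrow> bool" where
  "diamond L a b \<longleftrightarrow> a \<in> carrier L \<and> b \<in> carrier L \<and> a \<sqsubseteq>\<^bsub>L\<^esub> b \<and> height L b = height L a + 2"

definition prime_diamond :: "'a ranked_lattice \<Rightarrow> 'a \<Rightarrow> 'a \<Rightarrow> bool" where
  "prime_diamond M a b \<longleftrightarrow> diamond M a b \<and>
     (\<forall>x\<in>carrier M. a \<sqsubset>\<^bsub>M\<^esub> x \<and> x \<sqsubset>\<^bsub>M\<^esub> b \<longrightarrow> rk M x = rk M a + 1 \<and> rk M b = rk M x)"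

definition prime_free_interval :: "'a ranked_lattice \<Rightarrow> 'a \<Rightarrow> 'a \<Rightarrow> bool" where
  "prime_free_interval M a b \<longleftrightarrow> \<not> (\<exists>c d. prime_diamond M c d \<and> a \<sqsubseteq>\<^bsub>M\<^esub> c \<and> d \<sqsubseteq>\<^bsub>M\<^esub> b)"

definition prime_free :: "'a ranked_lattice \<Rightarrow> bool" where
  "prime_free M \<longleftrightarrow> prime_free_interval M \<bottom>\<^bsub>M\<^esub> \<top>\<^bsub>M\<^esub>"

section \<open>The Tutte polynomial\<close>

definition Tutte_partition :: "'a ranked_lattice \<Rightarrow> ('a \<times> 'a) set \<Rightarrow> bool" where
  "Tutte_partition M P \<longleftrightarrow> interval_partition M P \<and>
     (\<forall>(a, b)\<in>P. rk M a = height M a \<and> rk M b = rk M \<top>\<^bsub>M\<^esub> \<and> prime_free_interval M a b)"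

text \<open>
  The ring of polynomials in \<open>x\<close>, \<open>y\<close> over the integers is \<^typ>\<open>int poly poly\<close>, with \<open>x\<close> the inner
  and \<open>y\<close> the outer variable: \<open>monom (monom 1 i) j\<close> is the monomial with exponents \<open>i\<close> of \<open>x\<close>
  and \<open>j\<close> of \<open>y\<close>.
\<close>

definition Tutte_sum :: "'a ranked_lattice \<Rightarrow> ('a \<times> 'a) set \<Rightarrow> int poly poly" where
  "Tutte_sum M P = (\<Sum>(a, b)\<in>P. monom (monom 1 (rk M b - rk M a)) (nullity M b - nullity M a))"

text \<open>The common value of the sums over all Tutte partitions.\<close>

definition Tutte_polynomial :: "'a ranked_lattice \<Rightarrow> int poly poly" where
  "Tutte_polynomial M =
     (THE t. (\<exists>P. Tutte_partition M P) \<and> (\<forall>P. Tutte_partition M P \<longrightarrow> Tutte_sum M P = t))"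

section \<open>Tutte--Grothendieck invariants\<close>

definition q_Tutte_Grothendieck_invariant ::
    "nat \<Rightarrow> 'a ranked_lattice set \<Rightarrow> ('a ranked_lattice \<Rightarrow> 'c::comm_semiring_1) \<Rightarrow> bool" where
  "q_Tutte_Grothendieck_invariant q \<M> f \<longleftrightarrow>
     (\<forall>M1\<in>\<M>. \<forall>M2\<in>\<M>. ranked_iso M1 M2 \<longrightarrow> f M1 = f M2) \<and>
     (\<forall>M\<in>\<M>. prime_free M \<longrightarrow>
        (\<forall>e. atom M e \<longrightarrow> f M = f (restriction M e) * f (contraction M e))) \<and>
     (\<forall>M\<in>\<M>. \<not> prime_free M \<longrightarrow>
        (\<forall>e. atom M e \<and> independent_element M e \<and> (\<forall>x. coloop M x \<longrightarrow> e \<sqsubseteq>\<^bsub>M\<^esub> x) \<longrightarrow>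
           (\<exists>P. proper_interval_decomposition q M e P \<and>
                f M = (\<Sum>(a, b)\<in>P. f (minor M a b)))))"

section \<open>Agreement with the concrete lattices\<close>

lemma partial_order_subset_order:
  "partial_order \<lparr>carrier = A, eq = (=), le = (\<subseteq>)\<rparr>"
  by unfold_locales auto

lemma lattice_subset_lattice: "lattice (subset_lattice E)"
proof -
  interpret partial_order "subset_lattice E"
    unfolding subset_lattice_def by (rule partial_order_subset_order)
  show ?thesis
  proof
    fix x y assume *: "x \<in> carrier (subset_lattice E)" "y \<in> carrier (subset_lattice E)"
    have "least (subset_lattice E) (x \<union> y) (Upper (subset_lattice E) {x, y})"
      using * by (auto simp: least_def Upper_def subset_lattice_def)
    then show "\<exists>s. least (subset_lattice E) s (Upper (subset_lattice E) {x, y})" ..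
    have "greatest (subset_lattice E) (x \<inter> y) (Lower (subset_lattice E) {x, y})"
      using * by (auto simp: greatest_def Lower_def subset_lattice_def)
    then show "\<exists>s. greatest (subset_lattice E) s (Lower (subset_lattice E) {x, y})" ..
  qed
qed

lemma (in vector_space) lattice_subspace_lattice:
  assumes V: "subspace V"
  shows "lattice (subspace_lattice scale V)"
proof -
  let ?L = "subspace_lattice scale V"
  interpret L: partial_order ?L
    unfolding subspace_lattice_def by (rule partial_order_subset_order)
  show ?thesis
  proof
    fix x y assume *: "x \<in> carrier ?L" "y \<in> carrier ?L"
    have "least ?L (span (x \<union> y)) (Upper ?L {x, y})"
      unfolding least_def
    proof (intro conjI ballI)
      show "span (x \<union> y) \<in> Upper ?L {x, y}"
        using * V span_superset[of "x \<union> y"] span_minimal[of "x \<union> y" V]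
        by (simp add: Upper_def subspace_lattice_def)
      show "span (x \<union> y) \<sqsubseteq>\<^bsub>?L\<^esub> z" if "z \<in> Upper ?L {x, y}" for z
        using that * span_minimal[of "x \<union> y" z] by (auto simp: Upper_def subspace_lattice_def)
    qed simp
    then show "\<exists>s. least ?L s (Upper ?L {x, y})" ..
    have "greatest ?L (x \<inter> y) (Lower ?L {x, y})"
      using * by (auto simp: greatest_def Lower_def subspace_lattice_def subspace_inter)
    then show "\<exists>s. greatest ?L s (Lower ?L {x, y})" ..
  qed
qed

lemma lattice_isoI:
  assumes L1: "lattice L1" and L2: "lattice L2" and bij: "bij_betw \<phi> (carrier L1) (carrier L2)"
    and ord: "\<And>x y. x \<in> carrier L1 \<Longrightarrow> y \<in> carrier L1 \<Longrightarrow> \<phi> x \<sqsubseteq>\<^bsub>L2\<^esub> \<phi> y \<longleftrightarrow> x \<sqsubseteq>\<^bsub>L1\<^esub> y"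
  shows "lattice_iso L1 L2 \<phi>"
proof -
  interpret L1: lattice L1 by fact
  interpret L2: lattice L2 by fact
  have cl: "\<phi> x \<in> carrier L2" if "x \<in> carrier L1" for x
    using bij that by (auto simp: bij_betw_def)
  have ex: "\<exists>x\<in>carrier L1. y = \<phi> x" if "y \<in> carrier L2" for y
    using bij that by (auto simp: bij_betw_def)
  have j: "\<phi> (x \<squnion>\<^bsub>L1\<^esub> y) = \<phi> x \<squnion>\<^bsub>L2\<^esub> \<phi> y" if xy: "x \<in> carrier L1" "y \<in> carrier L1" for x y
  proof -
    obtain z where z: "z \<in> carrier L1" "\<phi> x \<squnion>\<^bsub>L2\<^esub> \<phi> y = \<phi> z"
      using ex xy cl by (metis L2.join_closed)
    have "x \<sqsubseteq>\<^bsub>L1\<^esub> z" "y \<sqsubseteq>\<^bsub>L1\<^esub> z"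
      using z xy ord cl L2.join_left L2.join_right by metis+
    then have "x \<squnion>\<^bsub>L1\<^esub> y \<sqsubseteq>\<^bsub>L1\<^esub> z" using xy z L1.join_le by metis
    then have 1: "\<phi> (x \<squnion>\<^bsub>L1\<^esub> y) \<sqsubseteq>\<^bsub>L2\<^esub> \<phi> z" using ord xy z by simp
    have "\<phi> x \<squnion>\<^bsub>L2\<^esub> \<phi> y \<sqsubseteq>\<^bsub>L2\<^esub> \<phi> (x \<squnion>\<^bsub>L1\<^esub> y)"
      using xy cl ord by (intro L2.join_le) (auto simp: L1.join_left L1.join_right)
    then show ?thesis using 1 z cl xy L2.le_antisym by simp
  qed
  have m: "\<phi> (x \<sqinter>\<^bsub>L1\<^esub> y) = \<phi> x \<sqinter>\<^bsub>L2\<^esub> \<phi> y" if xy: "x \<in> carrier L1" "y \<in> carrier L1" for x y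
  proof -
    obtain z where z: "z \<in> carrier L1" "\<phi> x \<sqinter>\<^bsub>L2\<^esub> \<phi> y = \<phi> z"
      using ex xy cl by (metis L2.meet_closed)
    have "z \<sqsubseteq>\<^bsub>L1\<^esub> x" "z \<sqsubseteq>\<^bsub>L1\<^esub> y"
      using z xy ord cl L2.meet_left L2.meet_right by metis+
    then have "z \<sqsubseteq>\<^bsub>L1\<^esub> x \<sqinter>\<^bsub>L1\<^esub> y" using xy z L1.meet_le by metis
    then have 1: "\<phi> z \<sqsubseteq>\<^bsub>L2\<^esub> \<phi> (x \<sqinter>\<^bsub>L1\<^esub> y)" using ord xy z by simp
    have "\<phi> (x \<sqinter>\<^bsub>L1\<^esub> y) \<sqsubseteq>\<^bsub>L2\<^esub> \<phi> x \<sqinter>\<^bsub>L2\<^esub> \<phi> y"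
      using xy cl ord by (intro L2.meet_le) (auto simp: L1.meet_left L1.meet_right)
    then show ?thesis using 1 z cl xy L2.le_antisym by simp
  qed
  show ?thesis
    using bij j m L1 L2 by (auto simp: lattice_iso_def join_pres_def meet_pres_def)
qed

lemma inj_on_image_subset_iff:
  assumes "inj_on f A" "X \<subseteq> A" "Y \<subseteq> A"
  shows "f ` X \<subseteq> f ` Y \<longleftrightarrow> X \<subseteq> Y"
  using inj_on_image_mem_iff[OF assms(1) _ assms(3)] assms(2) by blast

lemma height_eqI:
  assumes bot: "\<bottom>\<^bsub>L\<^esub> \<in> carrier L"
    and mono: "\<And>x y. x \<in> carrier L \<Longrightarrow> y \<in> carrier L \<Longrightarrow> x \<sqsubset>\<^bsub>L\<^esub> y \<Longrightarrow> (h x :: nat) < h y"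
    and h0: "\<And>x. x \<in> carrier L \<Longrightarrow> h x = 0 \<Longrightarrow> x = \<bottom>\<^bsub>L\<^esub>"
    and pred: "\<And>x n. x \<in> carrier L \<Longrightarrow> h x = Suc n \<Longrightarrow> \<exists>y\<in>carrier L. y \<sqsubset>\<^bsub>L\<^esub> x \<and> h y = n"
    and x: "x \<in> carrier L"
  shows "height L x = h x"
  unfolding height_def
proof (rule Greatest_equality)
  have "x \<in> carrier L \<Longrightarrow> h x = n \<Longrightarrow> \<exists>c. c 0 = \<bottom>\<^bsub>L\<^esub> \<and> c n = x \<and>
     (\<forall>i\<le>n. c i \<in> carrier L) \<and> (\<forall>i<n. c i \<sqsubset>\<^bsub>L\<^esub> c (Suc i))" for n
  proof (induction n arbitrary: x)
    case 0
    then show ?case using h0 bot by (intro exI[of _ "\<lambda>_. \<bottom>\<^bsub>L\<^esub>"]) auto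
  next
    case (Suc n)
    then obtain y where y: "y \<in> carrier L" "y \<sqsubset>\<^bsub>L\<^esub> x" "h y = n" using pred by blast
    then obtain c where c: "c 0 = \<bottom>\<^bsub>L\<^esub>" "c n = y" "\<forall>i\<le>n. c i \<in> carrier L"
        "\<forall>i<n. c i \<sqsubset>\<^bsub>L\<^esub> c (Suc i)"
      using Suc.IH by blast
    show ?case
      using c y Suc.prems by (intro exI[of _ "c(Suc n := x)"]) (auto simp: le_Suc_eq less_Suc_eq)
  qed
  then show "\<exists>c. c 0 = \<bottom>\<^bsub>L\<^esub> \<and> c (h x) = x \<and>
     (\<forall>i\<le>h x. c i \<in> carrier L) \<and> (\<forall>i<h x. c i \<sqsubset>\<^bsub>L\<^esub> c (Suc i))"
    using x by blast
next
  fix k assume "\<exists>c. c 0 = \<bottom>\<^bsub>L\<^esub> \<and> c k = x \<and>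
     (\<forall>i\<le>k. c i \<in> carrier L) \<and> (\<forall>i<k. c i \<sqsubset>\<^bsub>L\<^esub> c (Suc i))"
  then obtain c where c: "c k = x" "\<forall>i\<le>k. c i \<in> carrier L" "\<forall>i<k. c i \<sqsubset>\<^bsub>L\<^esub> c (Suc i)"
    by blast
  have "i \<le> k \<Longrightarrow> i \<le> h (c i)" for i
  proof (induction i)
    case (Suc i)
    then have "h (c i) < h (c (Suc i))" using c mono by simp
    then show ?case using Suc by simp
  qed simp
  then show "k \<le> h x" using c by blast
qed

lemma (in partial_order) bottom_eqI:
  assumes "least L b (carrier L)"
  shows "\<bottom> = b"
  unfolding bottom_def using assms by (metis (mono_tags, lifting) least_unique someI)

lemma height_subset_lattice:
  assumes E: "finite E" and X: "X \<subseteq> E"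
  shows "height (subset_lattice E) X = card X"
proof -
  let ?L = "subset_lattice E"
  interpret L: lattice ?L by (rule lattice_subset_lattice)
  have b: "\<bottom>\<^bsub>?L\<^esub> = {}"
    by (rule L.bottom_eqI) (auto simp: least_def subset_lattice_def)
  show ?thesis
  proof (rule height_eqI)
    show "card x < card y" if "x \<in> carrier ?L" "y \<in> carrier ?L" "x \<sqsubset>\<^bsub>?L\<^esub> y" for x y
      using that E by (auto simp: subset_lattice_def lless_def finite_subset
          intro!: psubset_card_mono)
    show "\<exists>y\<in>carrier ?L. y \<sqsubset>\<^bsub>?L\<^esub> x \<and> card y = n" if x: "x \<in> carrier ?L" "card x = Suc n" for x n
    proof -
      obtain a where "a \<in> x" using x by fastforce
      then show ?thesis using x
        by (intro bexI[of _ "x - {a}"]) (auto simp: subset_lattice_def lless_def)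
    qed
    show "x = \<bottom>\<^bsub>?L\<^esub>" if "x \<in> carrier ?L" "card x = 0" for x
      using that E b by (auto simp: subset_lattice_def finite_subset)
  qed (use X b in \<open>auto simp: subset_lattice_def\<close>)
qed

lemma Boolean_lattice_subset_lattice:
  assumes "finite E"
  shows "Boolean_lattice (subset_lattice E)"
proof -
  obtain f where f: "bij_betw f E {0..<card E}"
    using ex_bij_betw_finite_nat[OF assms] by blast
  have "lattice_iso (subset_lattice E) (subset_lattice {0..<card E}) (image f)"
  proof (rule lattice_isoI)
    show "bij_betw (image f) (carrier (subset_lattice E)) (carrier (subset_lattice {0..<card E}))"
      using f by (simp add: subset_lattice_def bij_betw_Pow)
  next
    fix x y assume "x \<in> carrier (subset_lattice E)" "y \<in> carrier (subset_lattice E)"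
    then show "f ` x \<sqsubseteq>\<^bsub>subset_lattice {0..<card E}\<^esub> f ` y \<longleftrightarrow> x \<sqsubseteq>\<^bsub>subset_lattice E\<^esub> y"
      using f inj_on_image_subset_iff[of f E x y] by (simp add: subset_lattice_def bij_betw_def)
  qed (rule lattice_subset_lattice)+
  then show ?thesis unfolding Boolean_lattice_def by blast
qed

lemma (in vector_space) height_subspace_lattice:
  assumes fd: "finite B" "V \<subseteq> span B" and V: "subspace V" and W: "subspace W" "W \<subseteq> V"
  shows "height (subspace_lattice scale V) W = dim W"
proof -
  let ?L = "subspace_lattice scale V"
  interpret L: lattice ?L by (rule lattice_subspace_lattice[OF V])
  have b: "\<bottom>\<^bsub>?L\<^esub> = {0}"
    by (rule L.bottom_eqI)
      (use V in \<open>auto simp: least_def subspace_lattice_def subspace_0\<close>)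
  have basis: "\<exists>C. finite C \<and> C \<subseteq> x \<and> independent C \<and> span C = x \<and> card C = dim x"
    if "x \<in> carrier ?L" for x
  proof -
    from that have x: "subspace x" "x \<subseteq> V" by (auto simp: subspace_lattice_def)
    obtain C where C: "C \<subseteq> x" "independent C" "x \<subseteq> span C" "card C = dim x"
      using basis_exists by blast
    have "finite C"
      using independent_span_bound[OF fd(1) C(2)] C(1) x fd(2) by blast
    moreover have "span C = x" using C x span_minimal by blast
    ultimately show ?thesis using C by blast
  qed
  show ?thesis
  proof (rule height_eqI)
    show "dim x < dim y" if xy: "x \<in> carrier ?L" "y \<in> carrier ?L" "x \<sqsubset>\<^bsub>?L\<^esub> y" for x y
    proof -
      obtain C where C: "finite C" "C \<subseteq> x" "independent C" "span C = x" "card C = dim x"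
        using basis xy by blast
      obtain D where D: "finite D" "D \<subseteq> y" "independent D" "span D = y" "card D = dim y"
        using basis xy by blast
      have sub: "x \<subset> y" using xy by (auto simp: subspace_lattice_def lless_def)
      then obtain v where v: "v \<in> y" "v \<notin> span C" using C by blast
      then have "independent (insert v C)" using C(3) by (simp add: independent_insert)
      moreover have "insert v C \<subseteq> span D" using v C(2) sub D by blast
      ultimately have "card (insert v C) \<le> card D"
        using independent_span_bound[OF D(1)] by blast
      moreover have "v \<notin> C" using v span_base by blast
      ultimately show ?thesis using C D by simp
    qed
    show "\<exists>y\<in>carrier ?L. y \<sqsubset>\<^bsub>?L\<^esub> x \<and> dim y = n" if x: "x \<in> carrier ?L" "dim x = Suc n" for x n
    proof -
      obtain C where C: "finite C" "C \<subseteq> x" "independent C" "span C = x" "card C = dim x"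
        using basis x by blast
      then obtain a where a: "a \<in> C" using x by fastforce
      have ind: "independent (C - {a})" using C independent_mono by blast
      have "a \<notin> span (C - {a})" using C a by (auto simp: dependent_def)
      moreover have "a \<in> x" using a C by blast
      moreover have "span (C - {a}) \<subseteq> x" using C span_mono[of "C - {a}" C] by blast
      moreover have "dim (span (C - {a})) = n"
        using dim_span_eq_card_independent[OF ind] C a x by simp
      ultimately show ?thesis using x
        by (intro bexI[of _ "span (C - {a})"]) (auto simp: subspace_lattice_def lless_def)
    qed
    show "x = \<bottom>\<^bsub>?L\<^esub>" if "x \<in> carrier ?L" "dim x = 0" for x
    proof -
      obtain C where "finite C" "span C = x" "card C = dim x"
        using basis \<open>x \<in> carrier ?L\<close> by blast
      then show ?thesis using that b by auto
    qed
  qed (use W V b in \<open>auto simp: subspace_lattice_def subspace_0\<close>)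
qed

lemma vector_space_coord_scale: "vector_space coord_scale"
  by unfold_locales (auto simp: coord_scale_def fun_eq_iff algebra_simps)

lemma subspace_coord_space: "module.subspace coord_scale (coord_space n)"
proof -
  interpret vector_space coord_scale by (rule vector_space_coord_scale)
  show ?thesis by (auto simp: subspace_def coord_space_def coord_scale_def)
qed

lemma linear_lattice_subspace_lattice:
  fixes scale :: "'k::field \<Rightarrow> 'v::ab_group_add \<Rightarrow> 'v"
  assumes "vector_space scale" and B: "finite B" "V \<subseteq> module.span scale B"
    and V: "module.subspace scale V"
  shows "linear_lattice TYPE('k) (subspace_lattice scale V)"
proof -
  interpret vs: vector_space scale by fact
  interpret cs: vector_space "coord_scale :: 'k \<Rightarrow> _" by (rule vector_space_coord_scale)
  interpret pr: vector_space_pair scale "coord_scale :: 'k \<Rightarrow> _" ..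
  obtain C where C: "C \<subseteq> V" "vs.independent C" "V \<subseteq> vs.span C" "card C = vs.dim V"
    using vs.basis_exists by blast
  have fC: "finite C"
    using vs.independent_span_bound[OF B(1) C(2)] C(1) B(2) by blast
  have sC: "vs.span C = V" using C V vs.span_minimal by blast
  define n where "n = card C"
  obtain g where g: "bij_betw g {0..<n} C"
    using ex_bij_betw_nat_finite[OF fC] unfolding n_def by blast
  define T where "T v i = (if i < n then vs.representation C v (g i) else 0)" for v i
  have repr: "(\<Sum>i<n. scale (T v i) (g i)) = v" if "v \<in> V" for v
  proof -
    have "(\<Sum>i<n. scale (T v i) (g i)) = (\<Sum>i\<in>{0..<n}. scale (vs.representation C v (g i)) (g i))"
      by (rule sum.cong) (auto simp: T_def)
    also have "\<dots> = (\<Sum>b\<in>C. scale (vs.representation C v b) b)"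
      using sum.reindex_bij_betw[OF g] .
    also have "\<dots> = v"
      using vs.sum_representation_eq[OF C(2) _ fC order_refl] that sC by blast
    finally show ?thesis .
  qed
  have inj: "inj_on T V"
    by (rule inj_on_inverseI[where g = "\<lambda>u. \<Sum>i<n. scale (u i) (g i)"]) (rule repr)
  have add: "T (v + w) = T v + T w" if "v \<in> V" "w \<in> V" for v w
    using that C(2) sC by (auto simp: T_def fun_eq_iff vs.representation_add)
  have scl: "T (scale a v) = coord_scale a (T v)" if "v \<in> V" for a v
    using that C(2) sC by (auto simp: T_def fun_eq_iff vs.representation_scale coord_scale_def)
  have T0: "T 0 = 0" using add[of 0 0] V vs.subspace_0 by fastforce
  have TV: "T v \<in> coord_space n" for v by (simp add: T_def coord_space_def)
  define S where "S u = (\<Sum>i<n. scale (u i) (g i))" for u :: "nat \<Rightarrow> 'k"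
  have gC: "g i \<in> C" if "i < n" for i using g that by (auto simp: bij_betw_def)
  have SV: "S u \<in> V" for u
    unfolding S_def using V gC C(1) by (intro vs.subspace_sum vs.subspace_scale) auto
  have TS: "T (S u) = u" if u: "u \<in> coord_space n" for u
  proof -
    have "S (T (S u)) = S u" using repr SV by (simp add: S_def)
    then have zero: "(\<Sum>i<n. scale (T (S u) i - u i) (g i)) = 0"
      by (simp add: S_def vs.scale_left_diff_distrib sum_subtractf)
    define w where
      "w b = T (S u) (inv_into {0..<n} g b) - u (inv_into {0..<n} g b)" for b
    have w: "w (g i) = T (S u) i - u i" if "i < n" for i
      using g that by (simp add: w_def bij_betw_def inv_into_f_f)
    have "(\<Sum>b\<in>C. scale (w b) b) = (\<Sum>i\<in>{0..<n}. scale (w (g i)) (g i))"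
      using sum.reindex_bij_betw[OF g, of "\<lambda>b. scale (w b) b"] by (rule sym)
    also have "\<dots> = (\<Sum>i<n. scale (T (S u) i - u i) (g i))"
      by (rule sum.cong) (auto simp: w)
    finally have "(\<Sum>b\<in>C. scale (w b) b) = 0" using zero by simp
    then have "w b = 0" if "b \<in> C" for b
      using vs.independentD[OF C(2) fC order_refl _ that] by blast
    then have "T (S u) i = u i" if "i < n" for i
      using gC[OF that] w[OF that] by simp
    moreover have "T (S u) i = u i" if "\<not> i < n" for i
      using that u by (simp add: T_def coord_space_def)
    ultimately show ?thesis by blast
  qed
  have bijT: "bij_betw T V (coord_space n)"
    unfolding bij_betw_def
  proof
    have "u \<in> T ` V" if "u \<in> coord_space n" for u
      using TS[OF that] SV[of u] by (metis imageI)
    then show "T ` V = coord_space n" using TV by blast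
  qed (rule inj)
  let ?L1 = "subspace_lattice scale V"
  let ?L2 = "subspace_lattice (coord_scale :: 'k \<Rightarrow> _) (coord_space n)"
  have img: "T ` W \<in> carrier ?L2" if "W \<in> carrier ?L1" for W
  proof -
    from that have W: "vs.subspace W" "W \<subseteq> V" by (auto simp: subspace_lattice_def)
    have "cs.subspace (T ` W)"
    proof (rule cs.subspaceI)
      show "0 \<in> T ` W" using T0 W vs.subspace_0 by (metis imageI)
      show "x + y \<in> T ` W" if xy: "x \<in> T ` W" "y \<in> T ` W" for x y
      proof -
        from xy obtain v w where "v \<in> W" "w \<in> W" "x = T v" "y = T w" by blast
        then show ?thesis using add[of v w] W vs.subspace_add[OF W(1)] by (metis imageI subsetD)
      qed
      show "coord_scale c x \<in> T ` W" if x: "x \<in> T ` W" for c x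
      proof -
        from x obtain v where "v \<in> W" "x = T v" by blast
        then show ?thesis using scl[of v c] W vs.subspace_scale[OF W(1)] by (metis imageI subsetD)
      qed
    qed
    then show ?thesis using TV by (auto simp: subspace_lattice_def)
  qed
  have pre: "\<exists>W\<in>carrier ?L1. U = T ` W" if "U \<in> carrier ?L2" for U
  proof
    from that have U: "cs.subspace U" "U \<subseteq> coord_space n" by (auto simp: subspace_lattice_def)
    let ?W = "{v \<in> V. T v \<in> U}"
    show "U = T ` ?W" using U bijT by (auto simp: bij_betw_def)
    have "vs.subspace ?W"
      using U V add scl T0
      by (auto simp: vs.subspace_def cs.subspace_def)
    then show "?W \<in> carrier ?L1" by (auto simp: subspace_lattice_def)
  qed
  have sub: "T ` W \<subseteq> T ` W' \<longleftrightarrow> W \<subseteq> W'" if "W \<in> carrier ?L1" "W' \<in> carrier ?L1" for W W'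
    using that inj inj_on_image_subset_iff[of T V W W'] by (simp add: subspace_lattice_def)
  have "lattice_iso ?L1 ?L2 (image T)"
  proof (rule lattice_isoI)
    show "lattice ?L1" by (rule vs.lattice_subspace_lattice[OF V])
    show "lattice ?L2" by (rule cs.lattice_subspace_lattice[OF subspace_coord_space])
    show "bij_betw (image T) (carrier ?L1) (carrier ?L2)"
      unfolding bij_betw_def
    proof
      show "inj_on (image T) (carrier ?L1)"
        using sub by (metis inj_onI order_antisym order_refl)
      show "image T ` carrier ?L1 = carrier ?L2" using img pre by blast
    qed
  qed (use sub in \<open>simp add: subspace_lattice_def\<close>)
  then show ?thesis unfolding linear_lattice_def by blast
qed

end

theory Submission
  imports Defs "HOL-Library.Multiset"
begin

text \<open>
  Matroids and \<open>q\<close>-matroids are treated at once, as rank functions on a finite modular lattice in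
  which every interval of length two has exactly \<open>q + 1\<close> elements strictly between its ends
  (locale \<open>q_lattice\<close>; \<open>q = 1\<close> is the Boolean case). Write \<open>h\<close> for the height, \<open>r\<close> for the rank
  and \<open>\<nu> = h - r\<close> for the nullity. The polynomial is defined by a choice of Tutte partition, so
  besides the three identities the proof has to show, for all minors, that Tutte partitions exist
  and that all of them give the same sum.

  Independence of the partition. On a prime-free interval \<open>[c, d]\<close> the rank has the form
  \<open>r x - r c = h x - h (x \<sqinter> l)\<close>, where \<open>l\<close> is the greatest element of rank \<open>r c\<close> (\<open>prime_free_rank\<close>):
  a minimal exception would be the top of a prime diamond. How many \<open>x\<close> in \<open>[c, d]\<close> have a given
  height and a given height of \<open>x \<sqinter> l\<close> depends on the heights of \<open>c\<close>, \<open>l\<close>, \<open>d\<close> alone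
  (\<open>card_position_class_cong\<close>). So the number of elements of the block with given corank and
  nullity is determined by its type \<open>(i, j) = (r d - r c, \<nu> d - \<nu> c)\<close> (\<open>rank_count_cong\<close>). In
  a Tutte partition the corank and nullity of an element within its block are those in the whole
  lattice. Hence the sum of these numbers over the blocks is an invariant of the lattice and its rank
  function. Within a block of type \<open>(i, j)\<close> the corank is at most \<open>i\<close>, the nullity at most \<open>j\<close>, and
  only \<open>l\<close> attains both; so these invariants determine the multiset of types by a triangular system
  (\<open>multiset_eq_of_triangular_sums\<close>), and the sum of the monomials depends on nothing else.

  Decomposition. Let \<open>e\<close> be an independent atom below every coloop and let \<open>H\<close> be a coatom
  above all loops with \<open>\<not> e \<sqsubseteq> H\<close>. In a proper interval decomposition that contains \<open>[e, \<top>]\<close> and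
  \<open>[\<bottom>, H]\<close>, the lower end of any other block is an atom not below \<open>H\<close>, so not a loop, and the upper
  end is a coatom not above \<open>e\<close>, so not a coloop (\<open>admissible_decomposition\<close>). Therefore Tutte
  partitions of the blocks join to a Tutte partition of the whole (\<open>Tutte_tiling_glue\<close>). This is
  the third identity. It also gives existence by induction on the height, because such an atom is
  available whenever there is a prime diamond (\<open>admissible_atom_exists\<close>).

  This needs a decomposition for a prescribed pair \<open>(e, H)\<close>, whereas the hypothesis on the class
  supplies one for some pair. For subspaces the pairs form one orbit of the linear automorphisms,
  as two transvections show (\<open>antiflag_transitive\<close>). In the Boolean case the two blocks
  \<open>[e, \<top>]\<close> and \<open>[\<bottom>, H]\<close> already cover the lattice (\<open>antiflag_decomposition_Boolean\<close>).

  The remaining two identities are short: a prime-free lattice is a single block, and the exponents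
  of its monomial are additive along \<open>\<bottom> \<sqsubseteq> e \<sqsubseteq> \<top>\<close>; an isomorphism maps Tutte partitions to Tutte
  partitions with the same types.
\<close>

section \<open>Modular lattices whose diamonds have \<open>q + 1\<close> middle elements\<close>

text \<open>
  The \<open>q\<close>-number \<open>1 + q + \<dots> + q\<^sup>d\<^sup>-\<^sup>1\<close>: the number of atoms of a subspace lattice of
  dimension \<open>d\<close>, and \<open>d\<close> itself for \<open>q = 1\<close>.
\<close>

definition gauss_number :: "nat \<Rightarrow> nat \<Rightarrow> nat" where
  "gauss_number q d = (\<Sum>i<d. q ^ i)"

lemma gauss_number_Suc: "gauss_number q (Suc d) = 1 + q * gauss_number q d"
  unfolding gauss_number_def by (simp add: sum.lessThan_Suc_shift sum_distrib_left del: sum.lessThan_Suc)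

lemma gauss_number_0 [simp]: "gauss_number q 0 = 0"
  by (simp add: gauss_number_def)

lemma gauss_number_less:
  assumes "0 < q" "d < d'"
  shows "gauss_number q d < gauss_number q d'"
  unfolding gauss_number_def using assms
  by (intro sum_strict_mono2[of "{..<d'}" "{..<d}" d]) auto

text \<open>
  All that the counting arguments use about subset and subspace lattices. The conditions are
  invariant under reversing the order (\<open>cocover_exists\<close> below is the dual of \<open>cover_exists\<close>), so
  that every count of atoms has a dual for coatoms.
\<close>

locale q_lattice = lattice L for L :: "('a, 'c) gorder_scheme" (structure) + 
  fixes q :: nat
  assumes q_pos: "0 < q"
    and finite_carrier: "finite (carrier L)"
    and carrier_nonempty: "carrier L \<noteq> {}"
    and height_less: "\<lbrakk>x \<in> carrier L; y \<in> carrier L; x \<sqsubseteq> y; x \<noteq> y\<rbrakk> \<Longrightarrow> height L x < height L y"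
    and height_modular: "\<lbrakk>x \<in> carrier L; y \<in> carrier L\<rbrakk> \<Longrightarrow>
      height L (x \<squnion> y) + height L (x \<sqinter> y) = height L x + height L y"
    and cover_exists: "\<lbrakk>x \<in> carrier L; y \<in> carrier L; x \<sqsubseteq> y; x \<noteq> y\<rbrakk> \<Longrightarrow>
      \<exists>z\<in>carrier L. x \<sqsubseteq> z \<and> z \<sqsubseteq> y \<and> height L z = height L x + 1"
    and diamond_card: "\<lbrakk>a \<in> carrier L; b \<in> carrier L; a \<sqsubseteq> b; height L b = height L a + 2\<rbrakk> \<Longrightarrow>
      card {x \<in> carrier L. a \<sqsubseteq> x \<and> x \<sqsubseteq> b \<and> height L x = height L a + 1} = q + 1"

sublocale q_lattice \<subseteq> bounded_lattice
proof
  have "least L (Lattice.sup L (carrier L)) (Upper L (carrier L))"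
    using finite_carrier carrier_nonempty by (intro finite_sup_least) auto
  then show "\<exists>x. greatest L x (carrier L)"
    by (auto simp: least_def greatest_def Upper_def)
  have "greatest L (Lattice.inf L (carrier L)) (Lower L (carrier L))"
    using finite_carrier carrier_nonempty by (intro finite_inf_greatest) auto
  then show "\<exists>x. least L x (carrier L)"
    by (auto simp: least_def greatest_def Lower_def)
qed

context q_lattice
begin

abbreviation h :: "'a \<Rightarrow> nat" where "h \<equiv> height L"

definition atoms_of :: "'a \<Rightarrow> 'a \<Rightarrow> 'a set" where
  "atoms_of a b = {x \<in> carrier L. a \<sqsubseteq> x \<and> x \<sqsubseteq> b \<and> h x = h a + 1}"

definition coatoms_of :: "'a \<Rightarrow> 'a \<Rightarrow> 'a set" where
  "coatoms_of a b = {x \<in> carrier L. a \<sqsubseteq> x \<and> x \<sqsubseteq> b \<and> h x + 1 = h b}"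

lemma height_mono: "\<lbrakk>x \<in> carrier L; y \<in> carrier L; x \<sqsubseteq> y\<rbrakk> \<Longrightarrow> h x \<le> h y"
  using height_less[of x y] by (cases "x = y") auto

lemma height_eqD: "\<lbrakk>x \<in> carrier L; y \<in> carrier L; x \<sqsubseteq> y; h y \<le> h x\<rbrakk> \<Longrightarrow> x = y"
  using height_less[of x y] by fastforce

lemma finite_atoms_of [simp]: "finite (atoms_of a b)"
  using finite_carrier by (simp add: atoms_of_def)

lemma finite_coatoms_of [simp]: "finite (coatoms_of a b)"
  using finite_carrier by (simp add: coatoms_of_def)

lemma join_distinct_atoms:
  assumes "a \<in> carrier L" "x \<in> carrier L" "y \<in> carrier L" "a \<sqsubseteq> x" "a \<sqsubseteq> y"
    and "h x = h a + 1" "h y = h a + 1" "x \<noteq> y"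
  shows "h (x \<squnion> y) = h a + 2"
proof -
  have "a \<sqsubseteq> x \<sqinter> y" using assms by (intro meet_le)
  then have 1: "h a \<le> h (x \<sqinter> y)" using assms by (intro height_mono) auto
  have "h (x \<sqinter> y) \<noteq> h a + 1"
  proof
    assume "h (x \<sqinter> y) = h a + 1"
    then have "x \<sqinter> y = x" "x \<sqinter> y = y"
      using assms by (auto intro!: height_eqD meet_left meet_right)
    then show False using assms by simp
  qed
  moreover have "h (x \<sqinter> y) \<le> h x" using assms by (intro height_mono meet_left) auto
  ultimately show ?thesis using 1 height_modular[of x y] assms by simp
qed

lemma meet_distinct_coatoms:
  assumes "b \<in> carrier L" "x \<in> carrier L" "y \<in> carrier L" "x \<sqsubseteq> b" "y \<sqsubseteq> b"
    and "h x + 1 = h b" "h y + 1 = h b" "x \<noteq> y"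
  shows "h (x \<sqinter> y) + 2 = h b"
proof -
  have "x \<squnion> y \<sqsubseteq> b" using assms by (intro join_le)
  then have 1: "h (x \<squnion> y) \<le> h b" using assms by (intro height_mono) auto
  have "h (x \<squnion> y) \<noteq> h x"
  proof
    assume "h (x \<squnion> y) = h x"
    then have "x = x \<squnion> y" "y = x \<squnion> y"
      using assms by (auto intro!: height_eqD join_left join_right)
    then show False using assms by simp
  qed
  moreover have "h x \<le> h (x \<squnion> y)" using assms by (intro height_mono join_left) auto
  ultimately show ?thesis using 1 height_modular[of x y] assms by simp
qed

text \<open>
  Fix an atom \<open>e\<close> of \<open>[a, b]\<close>. Each other atom \<open>x\<close> lies below exactly one atom of \<open>[e, b]\<close>, namely
  \<open>x \<squnion> e\<close>, and each atom of \<open>[e, b]\<close> has \<open>q\<close> atoms of \<open>[a, b]\<close> besides \<open>e\<close> below it. This is the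
  recursion \<open>[d + 1] = 1 + q [d]\<close> of the \<open>q\<close>-numbers.
\<close>

lemma card_atoms_of:
  assumes "a \<in> carrier L" "b \<in> carrier L" "a \<sqsubseteq> b"
  shows "card (atoms_of a b) = gauss_number q (h b - h a)"
  using assms
proof (induction "h b - h a" arbitrary: a)
  case 0
  then have "a = b" using height_eqD by simp
  have "x \<notin> atoms_of a b" for x
    using 0 height_mono[of x b] \<open>a = b\<close> by (auto simp: atoms_of_def)
  then have "atoms_of a b = {}" by blast
  then show ?case using \<open>a = b\<close> by simp
next
  case (Suc d)
  then have "a \<noteq> b" by auto
  then obtain e where e: "e \<in> carrier L" "a \<sqsubseteq> e" "e \<sqsubseteq> b" "h e = h a + 1"
    using cover_exists Suc.prems by blast
  have IH: "card (atoms_of e b) = gauss_number q d"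
  proof -
    have "d = h b - h e" using Suc.hyps(2) e by linarith
    then show ?thesis using Suc.hyps(1)[of e] e Suc.prems by metis
  qed
  have dc: "card (atoms_of a g - {e}) = q" if "g \<in> atoms_of e b" for g
  proof -
    have g: "g \<in> carrier L" "e \<sqsubseteq> g" "h g = h a + 2" using that e by (auto simp: atoms_of_def)
    then have "a \<sqsubseteq> g" using e Suc.prems le_trans by blast
    then have "card (atoms_of a g) = q + 1"
      using diamond_card[of a g] g Suc.prems by (simp add: atoms_of_def)
    moreover have "e \<in> atoms_of a g" using e g by (simp add: atoms_of_def)
    ultimately show ?thesis by simp
  qed
  have join_in: "g = x \<squnion> e" if "g \<in> atoms_of e b" "x \<in> atoms_of a g" "x \<noteq> e" for g x
  proof -
    have "h (x \<squnion> e) = h a + 2"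
      using that e Suc.prems by (intro join_distinct_atoms) (auto simp: atoms_of_def)
    moreover have "x \<squnion> e \<sqsubseteq> g" using that e by (intro join_le) (auto simp: atoms_of_def)
    ultimately show ?thesis
      using that e height_eqD[of "x \<squnion> e" g] by (simp add: atoms_of_def)
  qed
  have "atoms_of a b = insert e (\<Union>g\<in>atoms_of e b. atoms_of a g - {e})" (is "_ = ?R")
  proof
    show "atoms_of a b \<subseteq> ?R"
    proof
      fix x assume x: "x \<in> atoms_of a b"
      show "x \<in> ?R"
      proof (cases "x = e")
        case False
        have "h (x \<squnion> e) = h a + 2"
          using x False e Suc.prems by (intro join_distinct_atoms) (auto simp: atoms_of_def)
        then have "x \<squnion> e \<in> atoms_of e b" "x \<in> atoms_of a (x \<squnion> e)"
          using x e Suc.prems join_le join_left join_right by (auto simp: atoms_of_def)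
        then show ?thesis using False by blast
      qed simp
    qed
    show "?R \<subseteq> atoms_of a b"
      using e Suc.prems le_trans unfolding atoms_of_def by blast
  qed
  moreover have "card (\<Union>g\<in>atoms_of e b. atoms_of a g - {e})
      = (\<Sum>g\<in>atoms_of e b. card (atoms_of a g - {e}))"
  proof (rule card_UN_disjoint)
    show "\<forall>i\<in>atoms_of e b. \<forall>j\<in>atoms_of e b. i \<noteq> j \<longrightarrow>
        (atoms_of a i - {e}) \<inter> (atoms_of a j - {e}) = {}"
      using join_in by (metis DiffE Int_emptyI insertCI)
  qed auto
  then have "card (\<Union>g\<in>atoms_of e b. atoms_of a g - {e}) = q * gauss_number q d"
    using dc IH by simp
  moreover have "finite (\<Union>g\<in>atoms_of e b. atoms_of a g - {e})"
    "e \<notin> (\<Union>g\<in>atoms_of e b. atoms_of a g - {e})" by auto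
  ultimately have "card (atoms_of a b) = 1 + q * gauss_number q d"
    by (metis card_insert_disjoint plus_1_eq_Suc)
  then show ?case using Suc.hyps(2) gauss_number_Suc by metis
qed

lemma cocover_exists:
  assumes "x \<in> carrier L" "y \<in> carrier L" "x \<sqsubseteq> y" "x \<noteq> y"
  shows "\<exists>z\<in>carrier L. x \<sqsubseteq> z \<and> z \<sqsubseteq> y \<and> h z + 1 = h y"
  using assms
proof (induction "h y - h x" arbitrary: x rule: less_induct)
  case less
  obtain z where z: "z \<in> carrier L" "x \<sqsubseteq> z" "z \<sqsubseteq> y" "h z = h x + 1"
    using cover_exists less.prems by blast
  show ?case
  proof (cases "z = y")
    case True
    then show ?thesis using less.prems z by (intro bexI[of _ x]) auto
  next
    case False
    then have "h y - h z < h y - h x" using z less.prems height_less[of x y] by auto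
    then obtain w where "w \<in> carrier L" "z \<sqsubseteq> w" "w \<sqsubseteq> y" "h w + 1 = h y"
      using less.hyps[of z] z False less.prems by blast
    then show ?thesis using le_trans z less.prems by blast
  qed
qed

text \<open>
  The dual count, with meets of coatoms in place of joins of atoms.
\<close>

lemma card_coatoms_of:
  assumes "a \<in> carrier L" "b \<in> carrier L" "a \<sqsubseteq> b"
  shows "card (coatoms_of a b) = gauss_number q (h b - h a)"
  using assms
proof (induction "h b - h a" arbitrary: b)
  case 0
  then have "a = b" using height_eqD by simp
  have "x \<notin> coatoms_of a b" for x
    using 0 height_mono[of a x] \<open>a = b\<close> by (auto simp: coatoms_of_def)
  then have "coatoms_of a b = {}" by blast
  then show ?case using \<open>a = b\<close> by simp
next
  case (Suc d)
  then have "a \<noteq> b" by auto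
  then obtain e where e: "e \<in> carrier L" "a \<sqsubseteq> e" "e \<sqsubseteq> b" "h e + 1 = h b"
    using cocover_exists Suc.prems by blast
  have IH: "card (coatoms_of a e) = gauss_number q d"
  proof -
    have "d = h e - h a" using Suc.hyps(2) e by linarith
    then show ?thesis using Suc.hyps(1)[of e] e Suc.prems by metis
  qed
  have dc: "card (coatoms_of g b - {e}) = q" if "g \<in> coatoms_of a e" for g
  proof -
    have g: "g \<in> carrier L" "g \<sqsubseteq> e" "h b = h g + 2" using that e by (auto simp: coatoms_of_def)
    then have "g \<sqsubseteq> b" using e Suc.prems le_trans by blast
    then have "card (coatoms_of g b) = q + 1"
      using diamond_card[of g b] g Suc.prems by (simp add: coatoms_of_def)
    moreover have "e \<in> coatoms_of g b" using e g by (simp add: coatoms_of_def)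
    ultimately show ?thesis by simp
  qed
  have meet_in: "g = x \<sqinter> e" if "g \<in> coatoms_of a e" "x \<in> coatoms_of g b" "x \<noteq> e" for g x
  proof -
    have "h (x \<sqinter> e) + 2 = h b"
      using that e Suc.prems by (intro meet_distinct_coatoms) (auto simp: coatoms_of_def)
    moreover have "g \<sqsubseteq> x \<sqinter> e" using that e by (intro meet_le) (auto simp: coatoms_of_def)
    ultimately show ?thesis
      using that e height_eqD[of g "x \<sqinter> e"] by (simp add: coatoms_of_def)
  qed
  have "coatoms_of a b = insert e (\<Union>g\<in>coatoms_of a e. coatoms_of g b - {e})" (is "_ = ?R")
  proof
    show "coatoms_of a b \<subseteq> ?R"
    proof
      fix x assume x: "x \<in> coatoms_of a b"
      show "x \<in> ?R"
      proof (cases "x = e")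
        case False
        have "h (x \<sqinter> e) + 2 = h b"
          using x False e Suc.prems by (intro meet_distinct_coatoms) (auto simp: coatoms_of_def)
        then have "x \<sqinter> e \<in> coatoms_of a e" "x \<in> coatoms_of (x \<sqinter> e) b"
          using x e Suc.prems meet_le meet_left meet_right by (auto simp: coatoms_of_def)
        then show ?thesis using False by blast
      qed simp
    qed
    show "?R \<subseteq> coatoms_of a b"
      using e Suc.prems le_trans unfolding coatoms_of_def by blast
  qed
  moreover have "card (\<Union>g\<in>coatoms_of a e. coatoms_of g b - {e})
      = (\<Sum>g\<in>coatoms_of a e. card (coatoms_of g b - {e}))"
  proof (rule card_UN_disjoint)
    show "\<forall>i\<in>coatoms_of a e. \<forall>j\<in>coatoms_of a e. i \<noteq> j \<longrightarrow>
        (coatoms_of i b - {e}) \<inter> (coatoms_of j b - {e}) = {}"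
      using meet_in by (metis DiffE Int_emptyI insertCI)
  qed auto
  then have "card (\<Union>g\<in>coatoms_of a e. coatoms_of g b - {e}) = q * gauss_number q d"
    using dc IH by simp
  moreover have "finite (\<Union>g\<in>coatoms_of a e. coatoms_of g b - {e})"
    "e \<notin> (\<Union>g\<in>coatoms_of a e. coatoms_of g b - {e})" by auto
  ultimately have "card (coatoms_of a b) = 1 + q * gauss_number q d"
    by (metis card_insert_disjoint plus_1_eq_Suc)
  then show ?case using Suc.hyps(2) gauss_number_Suc by metis
qed

text \<open>
  This and its dual stand in for the existence of relative complements: \<open>[a, x]\<close> is longer than
  \<open>[a, x \<sqinter> y]\<close>, hence has more atoms.
\<close>

lemma atom_avoiding:
  assumes "a \<in> carrier L" "x \<in> carrier L" "y \<in> carrier L" "a \<sqsubseteq> x" "a \<sqsubseteq> y" "\<not> x \<sqsubseteq> y"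
  obtains f where "f \<in> atoms_of a x" "\<not> f \<sqsubseteq> y"
proof -
  have xy: "x \<sqinter> y \<in> carrier L" "x \<sqinter> y \<sqsubseteq> x" "x \<sqinter> y \<sqsubseteq> y" "a \<sqsubseteq> x \<sqinter> y"
    using assms meet_left meet_right meet_le by auto
  then have "x \<sqinter> y \<noteq> x" using assms by auto
  then have "h (x \<sqinter> y) - h a < h x - h a"
    using height_less[of "x \<sqinter> y" x] height_mono[of a "x \<sqinter> y"] xy assms by linarith
  then have "card (atoms_of a (x \<sqinter> y)) < card (atoms_of a x)"
    using card_atoms_of xy assms q_pos gauss_number_less by simp
  then obtain f where f: "f \<in> atoms_of a x" "f \<notin> atoms_of a (x \<sqinter> y)"
    by (metis card_mono finite_atoms_of leD subsetI)
  then have "\<not> f \<sqsubseteq> y" using meet_le assms by (auto simp: atoms_of_def)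
  then show thesis using f that by blast
qed

lemma coatom_avoiding:
  assumes "b \<in> carrier L" "x \<in> carrier L" "y \<in> carrier L" "x \<sqsubseteq> b" "y \<sqsubseteq> b" "\<not> y \<sqsubseteq> x"
  obtains f where "f \<in> coatoms_of x b" "\<not> y \<sqsubseteq> f"
proof -
  have xy: "x \<squnion> y \<in> carrier L" "x \<sqsubseteq> x \<squnion> y" "y \<sqsubseteq> x \<squnion> y" "x \<squnion> y \<sqsubseteq> b"
    using assms join_left join_right join_le by auto
  then have "x \<squnion> y \<noteq> x" using assms by auto
  then have "h b - h (x \<squnion> y) < h b - h x"
    using height_less[of x "x \<squnion> y"] height_mono[of "x \<squnion> y" b] xy assms by fastforce
  then have "card (coatoms_of (x \<squnion> y) b) < card (coatoms_of x b)"
    using card_coatoms_of xy assms q_pos gauss_number_less by simp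
  then obtain f where f: "f \<in> coatoms_of x b" "f \<notin> coatoms_of (x \<squnion> y) b"
    by (metis card_mono finite_coatoms_of leD subsetI)
  then have "\<not> y \<sqsubseteq> f" using join_le assms by (auto simp: coatoms_of_def)
  then show thesis using f that by blast
qed

section \<open>Elements in given position to a fixed element\<close>

text \<open>
  Both heights are measured from \<open>c\<close>, so that classes in different intervals can be compared.
\<close>

definition position_class :: "'a \<Rightarrow> 'a \<Rightarrow> 'a \<Rightarrow> nat \<Rightarrow> nat \<Rightarrow> 'a set" where
  "position_class c d l m k =
     {x \<in> carrier L. c \<sqsubseteq> x \<and> x \<sqsubseteq> d \<and> h x = h c + m \<and> h (x \<sqinter> l) = h c + k}"

lemma finite_position_class [simp]: "finite (position_class c d l m k)"
  using finite_carrier by (simp add: position_class_def)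

text \<open>
  Double counting of the covers \<open>x \<sqsubseteq> y\<close> for which \<open>x \<sqinter> l\<close> and \<open>y \<sqinter> l\<close> have the same height. A cover
  \<open>y\<close> of \<open>x\<close> is of this kind unless \<open>y \<sqsubseteq> x \<squnion> l\<close>, and the coatoms \<open>x\<close> of \<open>[c, y]\<close> of this kind are
  those above \<open>y \<sqinter> l\<close>.
\<close>

lemma position_class_recursion:
  assumes "c \<in> carrier L" "l \<in> carrier L" "d \<in> carrier L" "c \<sqsubseteq> l" "l \<sqsubseteq> d" "k \<le> m"
  shows "card (position_class c d l (Suc m) k) * gauss_number q (Suc m - k) =
    card (position_class c d l m k) *
      (gauss_number q (h d - h c - m) - gauss_number q (h l - h c - k))"
proof -
  let ?A = "position_class c d l m k" and ?B = "position_class c d l (Suc m) k"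
  have up: "card {y \<in> ?B. x \<sqsubseteq> y} =
      gauss_number q (h d - h c - m) - gauss_number q (h l - h c - k)" if "x \<in> ?A" for x
  proof -
    have x: "x \<in> carrier L" "c \<sqsubseteq> x" "x \<sqsubseteq> d" "h x = h c + m" "h (x \<sqinter> l) = h c + k"
      using that by (auto simp: position_class_def)
    have xl: "x \<squnion> l \<in> carrier L" "x \<sqsubseteq> x \<squnion> l" "x \<squnion> l \<sqsubseteq> d" "l \<sqsubseteq> x \<squnion> l"
      using x assms join_left join_right join_le by auto
    have hxl: "h (x \<squnion> l) + h c + k = h x + h l"
      using height_modular[of x l] x assms by simp
    have iff: "h (y \<sqinter> l) = h c + k \<longleftrightarrow> \<not> y \<sqsubseteq> x \<squnion> l" if y: "y \<in> atoms_of x d" for y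
    proof -
      have y: "y \<in> carrier L" "x \<sqsubseteq> y" "y \<sqsubseteq> d" "h y = h x + 1" using y by (auto simp: atoms_of_def)
      have le: "x \<squnion> l \<sqsubseteq> y \<squnion> l"
        using x y assms join_left[of y l] join_right[of y l] le_trans[of x y "y \<squnion> l"]
        by (intro join_le) auto
      have m: "h (y \<squnion> l) + h (y \<sqinter> l) = h x + 1 + h l" using height_modular[of y l] y assms by simp
      show ?thesis
      proof
        assume "h (y \<sqinter> l) = h c + k"
        then have "h (y \<squnion> l) = h (x \<squnion> l) + 1" using m hxl by simp
        then have "\<not> y \<squnion> l \<sqsubseteq> x \<squnion> l"
          using height_mono[of "y \<squnion> l" "x \<squnion> l"] y x assms by auto
        then show "\<not> y \<sqsubseteq> x \<squnion> l" using join_le[of y "x \<squnion> l" l] xl y x assms by auto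
      next
        assume "\<not> y \<sqsubseteq> x \<squnion> l"
        then have "x \<squnion> l \<noteq> y \<squnion> l" using join_left y assms by metis
        then have "h (x \<squnion> l) < h (y \<squnion> l)" using height_less le x y assms by simp
        moreover have "h (x \<sqinter> l) \<le> h (y \<sqinter> l)"
        proof (rule height_mono)
          show "x \<sqinter> l \<sqsubseteq> y \<sqinter> l"
            using x y assms meet_left[of x l] meet_right[of x l] le_trans[of "x \<sqinter> l" x y]
            by (intro meet_le) auto
        qed (use x y assms in auto)
        ultimately show "h (y \<sqinter> l) = h c + k" using m hxl x by simp
      qed
    qed
    have cy: "c \<sqsubseteq> y" if "y \<in> carrier L" "x \<sqsubseteq> y" for y
      using le_trans[of c x y] that x assms by simp
    have B: "y \<in> ?B \<and> x \<sqsubseteq> y \<longleftrightarrow> y \<in> atoms_of x d \<and> h (y \<sqinter> l) = h c + k" for y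
      using cy[of y] x by (auto simp: position_class_def atoms_of_def)
    have A: "y \<in> atoms_of x (x \<squnion> l) \<longleftrightarrow> y \<in> atoms_of x d \<and> y \<sqsubseteq> x \<squnion> l" for y
      using xl x assms le_trans[of y "x \<squnion> l" d] by (auto simp: atoms_of_def)
    have "{y \<in> ?B. x \<sqsubseteq> y} = atoms_of x d - atoms_of x (x \<squnion> l)"
    proof (rule Set.set_eqI)
      show "y \<in> {y \<in> ?B. x \<sqsubseteq> y} \<longleftrightarrow> y \<in> atoms_of x d - atoms_of x (x \<squnion> l)" for y
        using A[of y] B[of y] iff[of y] by auto
    qed
    moreover have "atoms_of x (x \<squnion> l) \<subseteq> atoms_of x d" using A by (intro subsetI) simp
    ultimately have "card {y \<in> ?B. x \<sqsubseteq> y} = card (atoms_of x d) - card (atoms_of x (x \<squnion> l))"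
      by (simp add: card_Diff_subset)
    also have "\<dots> = gauss_number q (h d - h x) - gauss_number q (h (x \<squnion> l) - h x)"
      using card_atoms_of x xl assms by simp
    also have "h (x \<squnion> l) - h x = h l - h c - k" using hxl x by simp
    finally show ?thesis using x by simp
  qed
  have down: "card {x \<in> ?A. x \<sqsubseteq> y} = gauss_number q (Suc m - k)" if "y \<in> ?B" for y
  proof -
    have y: "y \<in> carrier L" "c \<sqsubseteq> y" "y \<sqsubseteq> d" "h y = h c + Suc m" "h (y \<sqinter> l) = h c + k"
      using that by (auto simp: position_class_def)
    have yl: "y \<sqinter> l \<in> carrier L" "y \<sqinter> l \<sqsubseteq> y" "y \<sqinter> l \<sqsubseteq> l" "c \<sqsubseteq> y \<sqinter> l"
      using y assms meet_left meet_right meet_le by auto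
    have iff: "h (x \<sqinter> l) = h c + k \<longleftrightarrow> y \<sqinter> l \<sqsubseteq> x" if x: "x \<in> carrier L" "x \<sqsubseteq> y" for x
    proof -
      have xl: "x \<sqinter> l \<sqsubseteq> y \<sqinter> l"
        using x y assms meet_left[of x l] meet_right[of x l] le_trans[of "x \<sqinter> l" x y]
        by (intro meet_le) auto
      show ?thesis
      proof
        assume "h (x \<sqinter> l) = h c + k"
        then have "x \<sqinter> l = y \<sqinter> l" using height_eqD xl x y assms by simp
        then show "y \<sqinter> l \<sqsubseteq> x" using meet_left x assms by metis
      next
        assume "y \<sqinter> l \<sqsubseteq> x"
        then have "y \<sqinter> l \<sqsubseteq> x \<sqinter> l" using yl x assms by (intro meet_le) auto
        then show "h (x \<sqinter> l) = h c + k" using xl x y assms le_antisym[of "y \<sqinter> l" "x \<sqinter> l"] by simp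
      qed
    qed
    have "c \<sqsubseteq> x" if "x \<in> carrier L" "y \<sqinter> l \<sqsubseteq> x" for x
      using that y yl assms le_trans[of c "y \<sqinter> l" x] by simp
    moreover have "x \<sqsubseteq> d" if "x \<in> carrier L" "x \<sqsubseteq> y" for x
      using that y assms le_trans[of x y d] by simp
    ultimately have "x \<in> ?A \<and> x \<sqsubseteq> y \<longleftrightarrow> x \<in> coatoms_of (y \<sqinter> l) y" for x
      using y iff[of x] unfolding position_class_def coatoms_of_def by auto
    then have "{x \<in> ?A. x \<sqsubseteq> y} = coatoms_of (y \<sqinter> l) y" by blast
    then have "card {x \<in> ?A. x \<sqsubseteq> y} = gauss_number q (h y - h (y \<sqinter> l))"
      using card_coatoms_of y yl by simp
    then show ?thesis using y by simp
  qed
  have "(\<Sum>x\<in>?A. card {y \<in> ?B. x \<sqsubseteq> y}) = gauss_number q (Suc m - k) * card ?B"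
    using down by (intro sum_multicount) auto
  then show ?thesis using up by (simp add: mult.commute)
qed

text \<open>
  For \<open>m = k\<close> the class consists of the elements of height \<open>m\<close> in \<open>[c, l]\<close>, and all covers within
  \<open>[c, l]\<close> are counted.
\<close>

lemma position_class_diagonal_recursion:
  assumes "c \<in> carrier L" "l \<in> carrier L" "d \<in> carrier L" "c \<sqsubseteq> l" "l \<sqsubseteq> d"
  shows "card (position_class c d l (Suc m) (Suc m)) * gauss_number q (Suc m) =
    card (position_class c d l m m) * gauss_number q (h l - h c - m)"
proof -
  have diag: "position_class c d l i i = {x \<in> carrier L. c \<sqsubseteq> x \<and> x \<sqsubseteq> l \<and> h x = h c + i}" for i
  proof -
    have "h (x \<sqinter> l) = h x \<longleftrightarrow> x \<sqsubseteq> l" if "x \<in> carrier L" for x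
      using that assms height_eqD[of "x \<sqinter> l" x] meet_left[of x l] meet_right[of x l]
        le_iff_join[of x l] by auto
    moreover have "x \<sqsubseteq> d" if "x \<in> carrier L" "x \<sqsubseteq> l" for x
      using that assms le_trans[of x l d] by simp
    ultimately show ?thesis
      unfolding position_class_def by (intro Collect_cong) metis
  qed
  let ?A = "position_class c d l m m" and ?B = "position_class c d l (Suc m) (Suc m)"
  have up: "card {y \<in> ?B. x \<sqsubseteq> y} = gauss_number q (h l - h c - m)" if "x \<in> ?A" for x
  proof -
    have "c \<sqsubseteq> y" if "y \<in> carrier L" "x \<sqsubseteq> y" for y
      using le_trans[of c x y] that \<open>x \<in> ?A\<close> assms by (simp add: diag)
    then have "y \<in> ?B \<and> x \<sqsubseteq> y \<longleftrightarrow> y \<in> atoms_of x l" for y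
      using that by (auto simp: diag atoms_of_def)
    then have "{y \<in> ?B. x \<sqsubseteq> y} = atoms_of x l" by blast
    then show ?thesis using that card_atoms_of[of x l] assms by (simp add: diag)
  qed
  have down: "card {x \<in> ?A. x \<sqsubseteq> y} = gauss_number q (Suc m)" if "y \<in> ?B" for y
  proof -
    have "x \<sqsubseteq> l" if "x \<in> carrier L" "x \<sqsubseteq> y" for x
      using le_trans[of x y l] that \<open>y \<in> ?B\<close> assms by (simp add: diag)
    then have "x \<in> ?A \<and> x \<sqsubseteq> y \<longleftrightarrow> x \<in> coatoms_of c y" for x
      using that by (auto simp: diag coatoms_of_def)
    then have "{x \<in> ?A. x \<sqsubseteq> y} = coatoms_of c y" by blast
    then show ?thesis using that card_coatoms_of[of c y] assms by (simp add: diag)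
  qed
  have "(\<Sum>x\<in>?A. card {y \<in> ?B. x \<sqsubseteq> y}) = gauss_number q (Suc m) * card ?B"
    using down by (intro sum_multicount) auto
  then show ?thesis using up by (simp add: mult.commute)
qed

text \<open>
  The two recursions determine all the numbers from the single element of height zero: their
  factors depend on lengths only, and the factor \<open>[i + 1]\<close> to be cancelled is positive.
\<close>

theorem card_position_class_cong:
  assumes "c \<in> carrier L" "l \<in> carrier L" "d \<in> carrier L" "c \<sqsubseteq> l" "l \<sqsubseteq> d"
    and "c' \<in> carrier L" "l' \<in> carrier L" "d' \<in> carrier L" "c' \<sqsubseteq> l'" "l' \<sqsubseteq> d'"
    and "h l - h c = h l' - h c'" "h d - h c = h d' - h c'"
  shows "card (position_class c d l m k) = card (position_class c' d' l' m k)"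
proof (induction m arbitrary: k)
  case 0
  have *: "card (position_class u v w 0 k) = (if k = 0 then 1 else 0)"
    if u: "u \<in> carrier L" "v \<in> carrier L" "w \<in> carrier L" "u \<sqsubseteq> w" "w \<sqsubseteq> v" for u v w
  proof -
    have "u \<sqinter> w = u" using u le_iff_join[of u w] by simp
    moreover have "u \<sqsubseteq> v" using u le_trans[of u w v] by simp
    ultimately have "u \<in> position_class u v w 0 k \<longleftrightarrow> k = 0"
      using u by (simp add: position_class_def)
    moreover have "x = u" if "x \<in> position_class u v w 0 k" for x
      using that u height_eqD[of u x] by (simp add: position_class_def)
    ultimately have "position_class u v w 0 k = {x. x = u \<and> k = 0}"
      by (intro Set.set_eqI) auto
    then have "position_class u v w 0 k = (if k = 0 then {u} else {})" by simp
    then show ?thesis by simp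
  qed
  show ?case using *[of c d l] *[of c' d' l'] assms by simp
next
  case (Suc m)
  have pos: "0 < gauss_number q (Suc i)" for i by (simp add: gauss_number_Suc)
  consider "k \<le> m" | "k = Suc m" | "Suc m < k" by linarith
  then show ?case
  proof cases
    case 1
    then obtain i where i: "Suc m - k = Suc i" by (metis Suc_diff_le)
    have "card (position_class c d l (Suc m) k) * gauss_number q (Suc i) =
        card (position_class c' d' l' (Suc m) k) * gauss_number q (Suc i)"
      using position_class_recursion[of c l d k m] position_class_recursion[of c' l' d' k m]
        assms 1 Suc unfolding i by simp
    then show ?thesis using pos[of i] by simp
  next
    case 2
    have "card (position_class c d l (Suc m) k) * gauss_number q (Suc m) =
        card (position_class c' d' l' (Suc m) k) * gauss_number q (Suc m)"
      using position_class_diagonal_recursion[of c l d m]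
        position_class_diagonal_recursion[of c' l' d' m] assms 2 Suc[of m] by simp
    then show ?thesis using pos[of m] by simp
  next
    case 3
    have *: "position_class u v w (Suc m) k = {}" if u: "w \<in> carrier L" for u v w
    proof -
      have "h (x \<sqinter> w) \<le> h x" if "x \<in> carrier L" for x
        using that u by (intro height_mono meet_left) auto
      then have "x \<notin> position_class u v w (Suc m) k" for x
        using 3 by (force simp: position_class_def)
      then show ?thesis by blast
    qed
    then show ?thesis using assms by simp
  qed
qed

lemma height_bottom [simp]: "h \<bottom> = 0"
  unfolding height_def
proof (rule Greatest_equality)
  show "\<exists>c. c 0 = \<bottom> \<and> c 0 = \<bottom> \<and> (\<forall>i\<le>0. c i \<in> carrier L) \<and>
      (\<forall>i<0. c i \<sqsubset> c (Suc i))"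
    by (intro exI[of _ "\<lambda>_. \<bottom>"]) simp
next
  fix k assume "\<exists>c. c 0 = \<bottom> \<and> c k = \<bottom> \<and> (\<forall>i\<le>k. c i \<in> carrier L) \<and> (\<forall>i<k. c i \<sqsubset> c (Suc i))"
  then obtain c where c: "c 0 = \<bottom>" "c k = \<bottom>" "\<forall>i\<le>k. c i \<in> carrier L" "\<forall>i<k. c i \<sqsubset> c (Suc i)"
    by blast
  have "i \<le> k \<Longrightarrow> i \<le> k \<and> h (c 0) + i \<le> h (c i)" for i
  proof (induction i)
    case (Suc i)
    then have "h (c i) < h (c (Suc i))" using c lless_eq by (intro height_less) auto
    then show ?case using Suc by simp
  qed simp
  from this[of k] show "k \<le> 0" using c by simp
qed

lemma ex_max_height:
  assumes "P x" "\<And>x. P x \<Longrightarrow> x \<in> carrier L"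
  obtains l where "P l" "\<And>y. P y \<Longrightarrow> h y \<le> h l"
proof -
  have "h y < Suc (h \<top>)" if "P y" for y
    using that assms(2) height_mono[of y \<top>] by (simp add: less_Suc_eq_le)
  then show thesis using that ex_has_greatest_nat[of P x h "Suc (h \<top>)"] assms(1) by metis
qed

lemma ex_min_height:
  assumes "P x"
  obtains l where "P l" "\<And>y. P y \<Longrightarrow> h l \<le> h y"
  using ex_has_least_nat[of P x h] assms that by metis

lemma coatom_join_eq:
  assumes "a \<in> carrier L" "b \<in> carrier L" "H \<in> coatoms_of a b" "x \<in> carrier L" "x \<sqsubseteq> b" "\<not> x \<sqsubseteq> H"
  shows "x \<squnion> H = b"
proof -
  have H: "H \<in> carrier L" "H \<sqsubseteq> b" "h H + 1 = h b" using assms by (auto simp: coatoms_of_def)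
  have le: "x \<squnion> H \<sqsubseteq> b" using H assms by (intro join_le) auto
  have "H \<noteq> x \<squnion> H" using join_left[of x H] H assms by metis
  then have "h H < h (x \<squnion> H)" using H assms join_right by (intro height_less) auto
  then show ?thesis using H assms le height_eqD[of "x \<squnion> H" b] by simp
qed

lemma meet_mono_left:
  assumes "x \<in> carrier L" "y \<in> carrier L" "z \<in> carrier L" "x \<sqsubseteq> y"
  shows "x \<sqinter> z \<sqsubseteq> y \<sqinter> z"
  using assms meet_left[of x z] meet_right[of x z] le_trans[of "x \<sqinter> z" x y]
  by (intro meet_le) auto

end

section \<open>Rank functions and prime-free intervals\<close>

locale q_matroid = q_lattice M q for M :: "'a ranked_lattice" (structure) and q +
  assumes rank_function: "rank_function M"
begin

abbreviation r :: "'a \<Rightarrow> nat" where "r \<equiv> rk M"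

lemma rank_le_height: "x \<in> carrier M \<Longrightarrow> r x \<le> h x"
  and rank_mono: "\<lbrakk>x \<in> carrier M; y \<in> carrier M; x \<sqsubseteq> y\<rbrakk> \<Longrightarrow> r x \<le> r y"
  and rank_submodular: "\<lbrakk>x \<in> carrier M; y \<in> carrier M\<rbrakk> \<Longrightarrow> r (x \<squnion> y) + r (x \<sqinter> y) \<le> r x + r y"
  using rank_function unfolding rank_function_def by auto

lemma rank_bottom [simp]: "r \<bottom> = 0"
  using rank_le_height[of \<bottom>] by simp

text \<open>
  A cover of \<open>x\<close> is the join of \<open>x\<close> and an atom, whose rank is at most one.
\<close>

lemma rank_cover:
  assumes "x \<in> carrier M" "z \<in> carrier M" "x \<sqsubseteq> z" "h z = h x + 1"
  shows "r z \<le> r x + 1"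
proof -
  have "\<not> z \<sqsubseteq> x" using assms height_mono[of z x] by auto
  then obtain f where f: "f \<in> atoms_of \<bottom> z" "\<not> f \<sqsubseteq> x"
    using atom_avoiding[of \<bottom> z x] assms by auto
  then have fc: "f \<in> carrier M" "f \<sqsubseteq> z" "h f = 1" by (auto simp: atoms_of_def)
  have le: "x \<squnion> f \<sqsubseteq> z" using fc assms by (intro join_le) auto
  have "x \<noteq> x \<squnion> f" using join_right[of x f] f fc assms by metis
  then have "h x < h (x \<squnion> f)" using fc assms join_left by (intro height_less) auto
  then have "x \<squnion> f = z" using fc assms le height_eqD[of "x \<squnion> f" z] by simp
  then show ?thesis using rank_submodular[of x f] rank_le_height[of f] fc assms by simp
qed

lemma rank_increment:
  assumes "x \<in> carrier M" "y \<in> carrier M" "x \<sqsubseteq> y"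
  shows "r y + h x \<le> r x + h y"
  using assms
proof (induction "h y - h x" arbitrary: x rule: less_induct)
  case less
  show ?case
  proof (cases "x = y")
    case False
    obtain z where z: "z \<in> carrier M" "x \<sqsubseteq> z" "z \<sqsubseteq> y" "h z = h x + 1"
      using cover_exists less.prems False by metis
    then have "h z \<le> h y" using less.prems height_mono[of z y] by simp
    then have "r y + h z \<le> r z + h y" using less.hyps[of z] z less.prems by simp
    then show ?thesis using rank_cover[of x z] z less.prems by simp
  qed simp
qed

lemma nullity_mono:
  assumes "x \<in> carrier M" "y \<in> carrier M" "x \<sqsubseteq> y"
  shows "nullity M x \<le> nullity M y"
  using rank_increment[OF assms] rank_le_height[of x] rank_le_height[of y] assms
  by (simp add: nullity_def)

text \<open>
  By submodularity the elements of rank \<open>r c\<close> in \<open>[c, d]\<close> are closed under joins, so one of greatest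
  height is the greatest of them.
\<close>

lemma loop_element:
  assumes "c \<in> carrier M" "d \<in> carrier M" "c \<sqsubseteq> d"
  obtains l where "l \<in> carrier M" "c \<sqsubseteq> l" "l \<sqsubseteq> d" "r l = r c"
    "\<And>x. \<lbrakk>x \<in> carrier M; c \<sqsubseteq> x; x \<sqsubseteq> d; r x = r c\<rbrakk> \<Longrightarrow> x \<sqsubseteq> l"
proof -
  define P where "P x \<longleftrightarrow> x \<in> carrier M \<and> c \<sqsubseteq> x \<and> x \<sqsubseteq> d \<and> r x = r c" for x
  have "P c" "\<And>x. P x \<Longrightarrow> x \<in> carrier M" using assms by (auto simp: P_def)
  then obtain l where l: "P l" and max: "\<And>y. P y \<Longrightarrow> h y \<le> h l"
    using ex_max_height by metis
  have "x \<sqsubseteq> l" if x: "P x" for x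
  proof -
    have xl: "x \<squnion> l \<in> carrier M" "x \<sqsubseteq> x \<squnion> l" "l \<sqsubseteq> x \<squnion> l" "x \<squnion> l \<sqsubseteq> d" "c \<sqsubseteq> x \<sqinter> l"
      using x l assms join_left join_right join_le meet_le unfolding P_def by auto
    then have "c \<sqsubseteq> x \<squnion> l" using le_trans[of c x "x \<squnion> l"] x assms by (simp add: P_def)
    moreover from this have "r (x \<squnion> l) = r c"
      using rank_submodular[of x l] rank_mono[of c "x \<sqinter> l"] rank_mono[of c "x \<squnion> l"] xl x l assms
      by (simp add: P_def)
    ultimately have "h (x \<squnion> l) \<le> h l" using xl by (intro max) (simp add: P_def)
    then have "l = x \<squnion> l" using xl l by (intro height_eqD) (auto simp: P_def)
    then show ?thesis using xl by simp
  qed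
  then show thesis using that[of l] l by (simp add: P_def)
qed

text \<open>
  Rank increments bound \<open>r x\<close> above by the claimed value. Let \<open>x\<close> be a minimal element where it is
  smaller. If \<open>x \<sqinter> l\<close> were not \<open>c\<close>, some coatom \<open>z\<close> of \<open>[c, x]\<close> would not lie above \<open>x \<sqinter> l\<close>, and the
  value of \<open>r z\<close>, known by minimality, would exceed \<open>r x\<close>. So \<open>x \<sqinter> l = c\<close>, and \<open>x\<close> behaves like a
  circuit: everything strictly below it in \<open>[c, x]\<close> has full rank over \<open>c\<close>, while \<open>x\<close> has no larger
  rank than its coatoms. As \<open>x\<close> is not below \<open>l\<close>, it has height at least two over \<open>c\<close>, and the
  diamond between it and an element two steps below is prime.
\<close>

lemma prime_free_rank:
  assumes cd: "c \<in> carrier M" "d \<in> carrier M" "c \<sqsubseteq> d" and pf: "prime_free_interval M c d"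
  obtains l where "l \<in> carrier M" "c \<sqsubseteq> l" "l \<sqsubseteq> d" "r l = r c"
    "\<And>x. \<lbrakk>x \<in> carrier M; c \<sqsubseteq> x; x \<sqsubseteq> d\<rbrakk> \<Longrightarrow> r x + h (x \<sqinter> l) = r c + h x"
proof -
  obtain l where l: "l \<in> carrier M" "c \<sqsubseteq> l" "l \<sqsubseteq> d" "r l = r c"
    and lmax: "\<And>x. \<lbrakk>x \<in> carrier M; c \<sqsubseteq> x; x \<sqsubseteq> d; r x = r c\<rbrakk> \<Longrightarrow> x \<sqsubseteq> l"
    using loop_element[OF cd] by metis
  have meet: "x \<sqinter> l \<in> carrier M" "c \<sqsubseteq> x \<sqinter> l" "x \<sqinter> l \<sqsubseteq> x" "x \<sqinter> l \<sqsubseteq> l" "r (x \<sqinter> l) = r c"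
    if x: "x \<in> carrier M" "c \<sqsubseteq> x" for x
  proof -
    show *: "x \<sqinter> l \<in> carrier M" "c \<sqsubseteq> x \<sqinter> l" "x \<sqinter> l \<sqsubseteq> x" "x \<sqinter> l \<sqsubseteq> l"
      using x l cd meet_left meet_right meet_le by auto
    show "r (x \<sqinter> l) = r c"
      using rank_mono[of c "x \<sqinter> l"] rank_mono[of "x \<sqinter> l" l] * l cd by simp
  qed
  have "r x + h (x \<sqinter> l) = r c + h x" if x: "x \<in> carrier M" "c \<sqsubseteq> x" "x \<sqsubseteq> d" for x
    using x
  proof (induction "h x" arbitrary: x rule: less_induct)
    case less
    note x = less.prems
    have IH: "r z + h (z \<sqinter> l) = r c + h z"
      if z: "z \<in> carrier M" "c \<sqsubseteq> z" "z \<sqsubseteq> x" "h z < h x" for z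
      using less.hyps[of z] z le_trans[of z x d] x cd by simp
    have upper: "r x + h (x \<sqinter> l) \<le> r c + h x"
      using rank_increment[of "x \<sqinter> l" x] meet[OF x(1,2)] x by simp
    show ?case
    proof (rule ccontr)
      assume "r x + h (x \<sqinter> l) \<noteq> r c + h x"
      with upper have less: "r x + h (x \<sqinter> l) < r c + h x" by simp
      have xl_c: "x \<sqinter> l = c"
      proof (rule ccontr)
        assume "x \<sqinter> l \<noteq> c"
        then have "\<not> x \<sqinter> l \<sqsubseteq> c" using meet[OF x(1,2)] cd le_antisym[of c "x \<sqinter> l"] by metis
        then obtain z where z: "z \<in> coatoms_of c x" "\<not> x \<sqinter> l \<sqsubseteq> z"
          using coatom_avoiding[of x c "x \<sqinter> l"] meet[OF x(1,2)] x cd by metis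
        then have zc: "z \<in> carrier M" "c \<sqsubseteq> z" "z \<sqsubseteq> x" "h z + 1 = h x"
          by (auto simp: coatoms_of_def)
        have "z \<sqinter> l \<sqsubseteq> x \<sqinter> l" using meet_mono_left zc x l by simp
        moreover have "z \<sqinter> l \<noteq> x \<sqinter> l" using z(2) meet(3)[OF zc(1,2)] by metis
        ultimately have "h (z \<sqinter> l) < h (x \<sqinter> l)"
          using meet(1) zc x by (intro height_less) auto
        moreover have "r z \<le> r x" using rank_mono zc x by simp
        ultimately show False using IH[of z] zc less by simp
      qed
      have small: "r z + h c = r c + h z" if z: "z \<in> carrier M" "c \<sqsubseteq> z" "z \<sqsubseteq> x" "h z < h x" for z
      proof -
        have "z \<sqinter> l \<sqsubseteq> c" using meet_mono_left[of z x l] z x l xl_c by simp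
        then have "z \<sqinter> l = c" using meet[OF z(1,2)] cd le_antisym by metis
        then show ?thesis using IH[OF z] by simp
      qed
      have "x \<noteq> c" using less xl_c by auto
      then obtain z where z: "z \<in> carrier M" "c \<sqsubseteq> z" "z \<sqsubseteq> x" "h z + 1 = h x"
        using cocover_exists[of c x] x cd by metis
      have "z \<noteq> c"
      proof
        assume "z = c"
        then have "r x = r c" using less xl_c z rank_mono[of c x] x cd by simp
        then have "x \<sqsubseteq> l" using lmax x by simp
        then have "x = c" using xl_c le_iff_join[of x l] x l by simp
        then show False using \<open>x \<noteq> c\<close> by simp
      qed
      then obtain w where w: "w \<in> carrier M" "c \<sqsubseteq> w" "w \<sqsubseteq> z" "h w + 1 = h z"
        using cocover_exists[of c z] z cd by metis
      have wx: "w \<sqsubseteq> x" using le_trans[of w z x] w z x by simp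
      have "prime_diamond M w x"
        unfolding prime_diamond_def diamond_def
      proof (intro conjI ballI impI)
        show "w \<in> carrier M" "x \<in> carrier M" "w \<sqsubseteq> x" "h x = h w + 2"
          using w x wx z by auto
        fix y assume y: "y \<in> carrier M" "w \<sqsubset> y \<and> y \<sqsubset> x"
        then have wy: "w \<sqsubseteq> y" "y \<sqsubseteq> x" "w \<noteq> y" "y \<noteq> x" using lless_eq by auto
        then have "h w < h y" "h y < h x" using height_less y w x by auto
        moreover from this have hy: "h y = h w + 1" using w z by simp
        moreover have "c \<sqsubseteq> y" using le_trans[of c w y] w y wy cd by simp
        ultimately have ry: "r y + h c = r c + h y" "r w + h c = r c + h w"
          using small y w wx wy by auto
        then show "r y = r w + 1" using hy by simp
        show "r x = r y" using ry hy rank_mono[of y x] y x wy less xl_c w z by simp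
      qed
      then show False
        using pf w x unfolding prime_free_interval_def by blast
    qed
  qed
  then show thesis using that[of l] l by simp
qed

text \<open>
  The element \<open>K\<close> has the rank of \<open>a\<close>, and above it the rank grows as fast as the height. So
  \<open>\<nu> x - \<nu> a = h (x \<sqinter> K) - h a\<close> throughout \<open>[a, b]\<close>. In a prime diamond \<open>[c, d]\<close> the nullity
  would be constant except for an increase at \<open>d\<close>; but \<open>c \<squnion> (d \<sqinter> K)\<close> is a middle element with the
  same meet with \<open>K\<close> as \<open>d\<close>.
\<close>

lemma prime_freeI_of_loop_element:
  assumes ab: "a \<in> carrier M" "b \<in> carrier M" "a \<sqsubseteq> b"
    and K: "K \<in> carrier M" "a \<sqsubseteq> K" "K \<sqsubseteq> b" "r K = r a" "h K + r b = h b + r K"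
  shows "prime_free_interval M a b"
proof -
  have rank: "r x + h (x \<sqinter> K) = r a + h x" if x: "x \<in> carrier M" "a \<sqsubseteq> x" "x \<sqsubseteq> b" for x
  proof -
    have m: "x \<sqinter> K \<in> carrier M" "a \<sqsubseteq> x \<sqinter> K" "x \<sqinter> K \<sqsubseteq> x" "x \<sqinter> K \<sqsubseteq> K"
      using x K ab meet_left meet_right meet_le by auto
    have j: "x \<squnion> K \<in> carrier M" "K \<sqsubseteq> x \<squnion> K" "x \<squnion> K \<sqsubseteq> b"
      using x K ab join_right join_le by auto
    have "r (x \<sqinter> K) = r a"
      using rank_mono[of a "x \<sqinter> K"] rank_mono[of "x \<sqinter> K" K] m K ab by simp
    then show ?thesis
      using rank_increment[of "x \<sqinter> K" x] rank_increment[of "x \<squnion> K" b] rank_submodular[of x K]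
        height_modular[of x K] m j x K ab by simp
  qed
  have False if p: "prime_diamond M c d" "a \<sqsubseteq> c" "d \<sqsubseteq> b" for c d
  proof -
    have c: "c \<in> carrier M" "d \<in> carrier M" "c \<sqsubseteq> d" "h d = h c + 2"
      using p unfolding prime_diamond_def diamond_def by auto
    have mid: "r x = r c + 1" "r d = r x" if "x \<in> carrier M" "c \<sqsubseteq> x" "x \<sqsubseteq> d" "h x = h c + 1" for x
    proof -
      have "c \<sqsubset> x" "x \<sqsubset> d" using that c lless_eq by auto
      then show "r x = r c + 1" "r d = r x" using p that unfolding prime_diamond_def by auto
    qed
    have ac: "a \<sqsubseteq> d" "c \<sqsubseteq> b" using le_trans[of a c d] le_trans[of c d b] c p ab by auto
    have "c \<noteq> d" using c by auto
    then obtain z where z: "z \<in> carrier M" "c \<sqsubseteq> z" "z \<sqsubseteq> d" "h z = h c + 1"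
      using cover_exists[of c d] c by metis
    have rc: "r d = r c + 1" using mid z by simp
    have cK: "c \<sqinter> K \<in> carrier M" "d \<sqinter> K \<in> carrier M" using c K by auto
    have hdK: "h (d \<sqinter> K) = h (c \<sqinter> K) + 1"
      using rank[of c] rank[of d] c p ac rc by simp
    define x where "x = c \<squnion> (d \<sqinter> K)"
    have "c \<sqinter> (d \<sqinter> K) = c \<sqinter> K"
    proof (rule le_antisym)
      show "c \<sqinter> (d \<sqinter> K) \<sqsubseteq> c \<sqinter> K"
        using c K cK meet_left[of c "d \<sqinter> K"] meet_right[of c "d \<sqinter> K"] meet_right[of d K]
          le_trans[of "c \<sqinter> (d \<sqinter> K)" "d \<sqinter> K" K]
        by (intro meet_le) auto
      show "c \<sqinter> K \<sqsubseteq> c \<sqinter> (d \<sqinter> K)"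
        by (rule meet_le) (use c K cK meet_left[of c K] meet_mono_left[of c d K] in auto)
    qed (use c K cK in auto)
    then have hx: "h x = h c + 1"
      using height_modular[of c "d \<sqinter> K"] c cK hdK by (simp add: x_def)
    have x: "x \<in> carrier M" "c \<sqsubseteq> x" "x \<sqsubseteq> d" "d \<sqinter> K \<sqsubseteq> x"
      using c cK join_left[of c "d \<sqinter> K"] join_right[of c "d \<sqinter> K"] meet_left[of d K] K
        join_le[of c d "d \<sqinter> K"] by (auto simp: x_def)
    have "d \<sqinter> K \<sqsubseteq> x \<sqinter> K" using x cK K c meet_right[of d K] by (intro meet_le) auto
    then have "h (d \<sqinter> K) \<le> h (x \<sqinter> K)" using x cK K by (intro height_mono) auto
    moreover have "a \<sqsubseteq> x" "x \<sqsubseteq> b"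
      using le_trans[of a c x] le_trans[of x d b] x c p ab by auto
    ultimately show False
      using rank[of x] rank[of c] mid[of x] x hx hdK c p ac by simp
  qed
  then show ?thesis unfolding prime_free_interval_def by blast
qed

text \<open>
  Let \<open>K\<close> be of least height among the elements of \<open>[a, b]\<close> with the nullity of \<open>b\<close>. It lies below
  every coloop \<open>H\<close>, since otherwise \<open>K \<sqinter> H\<close> has height one less and rank at least one less,
  so no smaller nullity. As \<open>[a, b]\<close> has a prime diamond, the rank of \<open>K\<close> exceeds that of \<open>a\<close> by the
  previous lemma, and therefore \<open>[a, K]\<close> has an atom that is not a loop.
\<close>

lemma admissible_atom_exists:
  assumes ab: "a \<in> carrier M" "b \<in> carrier M" "a \<sqsubseteq> b" and npf: "\<not> prime_free_interval M a b"
  obtains e where "e \<in> atoms_of a b" "r e = r a + 1"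
    "\<And>H. \<lbrakk>H \<in> coatoms_of a b; r H + 1 = r b\<rbrakk> \<Longrightarrow> e \<sqsubseteq> H"
proof -
  \<comment> \<open>the last equation says that \<open>K\<close> and \<open>b\<close> have equal nullity\<close>
  define P where "P K \<longleftrightarrow> K \<in> carrier M \<and> a \<sqsubseteq> K \<and> K \<sqsubseteq> b \<and> h K + r b = h b + r K" for K
  have "P b" using ab by (simp add: P_def)
  then obtain K where "P K" and min: "\<And>y. P y \<Longrightarrow> h K \<le> h y" using ex_min_height by metis
  then have K: "K \<in> carrier M" "a \<sqsubseteq> K" "K \<sqsubseteq> b" "h K + r b = h b + r K" by (auto simp: P_def)
  have "r K \<noteq> r a" using prime_freeI_of_loop_element[OF ab K(1,2,3)] K npf by auto
  obtain l where l: "l \<in> carrier M" "a \<sqsubseteq> l" "l \<sqsubseteq> K" "r l = r a"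
    and lmax: "\<And>x. \<lbrakk>x \<in> carrier M; a \<sqsubseteq> x; x \<sqsubseteq> K; r x = r a\<rbrakk> \<Longrightarrow> x \<sqsubseteq> l"
    using loop_element[of a K] ab K by metis
  have "\<not> K \<sqsubseteq> l"
    using rank_mono[of K l] rank_mono[of a K] \<open>r K \<noteq> r a\<close> l K ab by auto
  then obtain e where e: "e \<in> atoms_of a K" "\<not> e \<sqsubseteq> l"
    using atom_avoiding[of a K l] l K ab by metis
  then have ec: "e \<in> carrier M" "a \<sqsubseteq> e" "e \<sqsubseteq> K" "h e = h a + 1" by (auto simp: atoms_of_def)
  have "r e = r a + 1"
    using lmax[of e] e(2) ec rank_increment[of a e] rank_mono[of a e] ab by fastforce
  moreover have "e \<sqsubseteq> H" if H: "H \<in> coatoms_of a b" "r H + 1 = r b" for H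
  proof -
    have Hc: "H \<in> carrier M" "a \<sqsubseteq> H" "H \<sqsubseteq> b" "h H + 1 = h b"
      using H by (auto simp: coatoms_of_def)
    have "K \<sqsubseteq> H"
    proof (rule ccontr)
      assume "\<not> K \<sqsubseteq> H"
      then have j: "K \<squnion> H = b" using coatom_join_eq[of a b H K] H K ab by simp
      have m: "K \<sqinter> H \<in> carrier M" "a \<sqsubseteq> K \<sqinter> H" "K \<sqinter> H \<sqsubseteq> K" "K \<sqinter> H \<sqsubseteq> b"
        using K Hc ab meet_left[of K H] meet_le[of a K H] le_trans[of "K \<sqinter> H" K b] by auto
      have hm: "h (K \<sqinter> H) + 1 = h K" using height_modular[of K H] j K Hc by simp
      have "r (K \<sqinter> H) + 1 \<le> r K" using rank_submodular[of K H] j K Hc H by simp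
      then have "P (K \<sqinter> H)"
        using m hm K rank_increment[of "K \<sqinter> H" K] by (simp add: P_def)
      then show False using min hm by fastforce
    qed
    then show ?thesis using le_trans[of e K H] ec K Hc by simp
  qed
  moreover have "e \<in> atoms_of a b"
    using ec K ab le_trans[of e K b] by (simp add: atoms_of_def)
  ultimately show thesis using that by metis
qed

end

context q_lattice
begin

section \<open>Interval partitions\<close>

text \<open>
  Interval partitions of \<open>[a, b]\<close> in elementwise form. The set of pairs refers to the order of the
  surrounding lattice, so that partitions of all its minors can be handled in that one lattice.
\<close>

definition tiles :: "'a \<Rightarrow> 'a \<Rightarrow> ('a \<times> 'a) set \<Rightarrow> bool" where
  "tiles a b P \<longleftrightarrow>
     (\<forall>(c, d)\<in>P. c \<in> carrier L \<and> d \<in> carrier L \<and> a \<sqsubseteq> c \<and> c \<sqsubseteq> d \<and> d \<sqsubseteq> b) \<and>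
     (\<forall>x\<in>carrier L. a \<sqsubseteq> x \<longrightarrow> x \<sqsubseteq> b \<longrightarrow> (\<exists>!p. p \<in> P \<and> fst p \<sqsubseteq> x \<and> x \<sqsubseteq> snd p))"

lemma tilesD:
  assumes "tiles a b P" "(c, d) \<in> P"
  shows "c \<in> carrier L" "d \<in> carrier L" "a \<sqsubseteq> c" "c \<sqsubseteq> d" "d \<sqsubseteq> b"
  using assms unfolding tiles_def by auto

lemma tiles_cover:
  assumes "tiles a b P" "x \<in> carrier L" "a \<sqsubseteq> x" "x \<sqsubseteq> b"
  obtains c d where "(c, d) \<in> P" "c \<sqsubseteq> x" "x \<sqsubseteq> d"
proof -
  obtain p where "p \<in> P" "fst p \<sqsubseteq> x" "x \<sqsubseteq> snd p" using assms unfolding tiles_def by meson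
  then show thesis using that[of "fst p" "snd p"] by simp
qed

lemma tiles_unique:
  assumes ab: "a \<in> carrier L" "b \<in> carrier L"
    and P: "tiles a b P" and "(c, d) \<in> P" "(c', d') \<in> P"
    and x: "x \<in> carrier L" "c \<sqsubseteq> x" "x \<sqsubseteq> d" "c' \<sqsubseteq> x" "x \<sqsubseteq> d'"
  shows "(c, d) = (c', d')"
proof -
  have "a \<sqsubseteq> x" using le_trans[of a c x] tilesD[OF P \<open>(c, d) \<in> P\<close>] x ab by simp
  moreover have "x \<sqsubseteq> b" using le_trans[of x d b] tilesD[OF P \<open>(c, d) \<in> P\<close>] x ab by simp
  ultimately have "\<exists>!p. p \<in> P \<and> fst p \<sqsubseteq> x \<and> x \<sqsubseteq> snd p" using P x unfolding tiles_def by simp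
  moreover have "(c, d) \<in> P \<and> fst (c, d) \<sqsubseteq> x \<and> x \<sqsubseteq> snd (c, d)"
    "(c', d') \<in> P \<and> fst (c', d') \<sqsubseteq> x \<and> x \<sqsubseteq> snd (c', d')" using assms by simp_all
  ultimately show ?thesis by (elim ex1E) metis
qed

lemma finite_tiles: "tiles a b P \<Longrightarrow> finite P"
  using finite_carrier tilesD(1,2)
  by (intro finite_subset[of P "carrier L \<times> carrier L"]) auto

lemma tiles_singleton: "\<lbrakk>a \<in> carrier L; b \<in> carrier L; a \<sqsubseteq> b\<rbrakk> \<Longrightarrow> tiles a b {(a, b)}"
  unfolding tiles_def by auto

text \<open>
  Blocks of different pieces are disjoint, hence a common pair of end points is impossible.
\<close>

lemma tiles_refine:
  assumes ab: "a \<in> carrier L" "b \<in> carrier L" and P: "tiles a b P"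
    and Q: "\<And>c d. (c, d) \<in> P \<Longrightarrow> tiles c d (Q (c, d))"
  shows "tiles a b (\<Union>p\<in>P. Q p)"
    and "\<lbrakk>p \<in> P; p' \<in> P; p \<noteq> p'\<rbrakk> \<Longrightarrow> Q p \<inter> Q p' = {}"
proof -
  have sub: "u \<in> carrier L \<and> v \<in> carrier L \<and> c \<sqsubseteq> u \<and> u \<sqsubseteq> v \<and> v \<sqsubseteq> d \<and>
      a \<sqsubseteq> u \<and> v \<sqsubseteq> b" if "(c, d) \<in> P" "(u, v) \<in> Q (c, d)" for c d u v
    using tilesD[OF Q[OF that(1)] that(2)] tilesD[OF P that(1)] ab
      le_trans[of a c u] le_trans[of v d b] by simp
  have same: "p = p'" if "p \<in> P" "p' \<in> P" "(u, v) \<in> Q p" "(u', v') \<in> Q p'"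
    "x \<in> carrier L" "u \<sqsubseteq> x" "x \<sqsubseteq> v" "u' \<sqsubseteq> x" "x \<sqsubseteq> v'" for p p' u v u' v' x
  proof -
    obtain c d c' d' where p: "p = (c, d)" "p' = (c', d')" by fastforce
    have "c \<sqsubseteq> x" "x \<sqsubseteq> d" "c' \<sqsubseteq> x" "x \<sqsubseteq> d'"
      using sub[of c d u v] sub[of c' d' u' v'] that p tilesD[OF P, of c d] tilesD[OF P, of c' d']
        le_trans[of c u x] le_trans[of x v d] le_trans[of c' u' x] le_trans[of x v' d'] by auto
    then show ?thesis using tiles_unique[OF ab P, of c d c' d' x] that p by simp
  qed
  show "tiles a b (\<Union>p\<in>P. Q p)"
    unfolding tiles_def
  proof (intro conjI ballI impI)
    fix uv assume "uv \<in> (\<Union>p\<in>P. Q p)"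
    then show "case uv of (u, v) \<Rightarrow> u \<in> carrier L \<and> v \<in> carrier L \<and> a \<sqsubseteq> u \<and> u \<sqsubseteq> v \<and> v \<sqsubseteq> b"
      using sub by fastforce
  next
    fix x assume x: "x \<in> carrier L" "a \<sqsubseteq> x" "x \<sqsubseteq> b"
    obtain c d where cd: "(c, d) \<in> P" "c \<sqsubseteq> x" "x \<sqsubseteq> d" using tiles_cover[OF P x] by metis
    obtain u v where uv: "(u, v) \<in> Q (c, d)" "u \<sqsubseteq> x" "x \<sqsubseteq> v"
      using tiles_cover[OF Q[OF cd(1)] x(1) cd(2,3)] by metis
    show "\<exists>!p. p \<in> (\<Union>p\<in>P. Q p) \<and> fst p \<sqsubseteq> x \<and> x \<sqsubseteq> snd p"
    proof (rule ex1I[of _ "(u, v)"])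
      show "(u, v) \<in> (\<Union>p\<in>P. Q p) \<and> fst (u, v) \<sqsubseteq> x \<and> x \<sqsubseteq> snd (u, v)"
        using uv cd by auto
      fix p assume p: "p \<in> (\<Union>p\<in>P. Q p) \<and> fst p \<sqsubseteq> x \<and> x \<sqsubseteq> snd p"
      then obtain u' v' p' where p': "p = (u', v')" "p' \<in> P" "(u', v') \<in> Q p'" by (cases p) auto
      then have "p' = (c, d)" using same[of p' "(c, d)" u' v' u v x] p cd uv x by simp
      then have "(u', v') = (u, v)"
        using tiles_unique[of c d "Q (c, d)" u' v' u v x] Q cd tilesD[OF P cd(1)] p p' uv x by simp
      then show "p = (u, v)" using p' by simp
    qed
  qed
  show "Q p \<inter> Q p' = {}" if "p \<in> P" "p' \<in> P" "p \<noteq> p'"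
  proof (rule ccontr)
    assume "Q p \<inter> Q p' \<noteq> {}"
    then obtain u v where uv: "(u, v) \<in> Q p" "(u, v) \<in> Q p'" by auto
    moreover have "u \<in> carrier L \<and> u \<sqsubseteq> v"
      using sub[of "fst p" "snd p" u v] uv that by simp
    ultimately show False using same[of p p' u v u v u] that by simp
  qed
qed

lemma card_tiles:
  assumes ab: "a \<in> carrier L" "b \<in> carrier L" and P: "tiles a b P"
  shows "card {x \<in> carrier L. a \<sqsubseteq> x \<and> x \<sqsubseteq> b \<and> A x} =
    (\<Sum>(c, d)\<in>P. card {x \<in> carrier L. c \<sqsubseteq> x \<and> x \<sqsubseteq> d \<and> A x})"
proof -
  let ?B = "\<lambda>p. {x \<in> carrier L. fst p \<sqsubseteq> x \<and> x \<sqsubseteq> snd p \<and> A x}"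
  have "{x \<in> carrier L. a \<sqsubseteq> x \<and> x \<sqsubseteq> b \<and> A x} = (\<Union>p\<in>P. ?B p)"
  proof (rule Set.set_eqI)
    fix x
    have "a \<sqsubseteq> x \<and> x \<sqsubseteq> b" if "p \<in> P" "x \<in> carrier L" "fst p \<sqsubseteq> x" "x \<sqsubseteq> snd p" for p
      using that tilesD[OF P, of "fst p" "snd p"] le_trans[of a "fst p" x] le_trans[of x "snd p" b] ab
      by simp
    moreover have "\<exists>p\<in>P. fst p \<sqsubseteq> x \<and> x \<sqsubseteq> snd p" if "x \<in> carrier L" "a \<sqsubseteq> x" "x \<sqsubseteq> b"
      using tiles_cover[OF P that] by (metis fst_conv snd_conv)
    ultimately show "x \<in> {x \<in> carrier L. a \<sqsubseteq> x \<and> x \<sqsubseteq> b \<and> A x} \<longleftrightarrow> x \<in> (\<Union>p\<in>P. ?B p)"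
      by auto
  qed
  also have "card \<dots> = (\<Sum>p\<in>P. card (?B p))"
  proof (rule card_UN_disjoint)
    show "\<forall>i\<in>P. \<forall>j\<in>P. i \<noteq> j \<longrightarrow> ?B i \<inter> ?B j = {}"
      using tiles_unique[OF ab P] by (auto simp: set_eq_iff)
  qed (use finite_tiles[OF P] finite_carrier in auto)
  finally show ?thesis by (simp add: case_prod_unfold)
qed

text \<open>
  A structure on \<open>[a, b]\<close> with the order induced from the lattice. It stands for an interval lattice,
  for the minor on \<open>[a, b]\<close>, and for the whole lattice when \<open>a = \<bottom>\<close> and \<open>b = \<top>\<close>.
\<close>

context
  fixes J :: "('a, 'd) gorder_scheme" and a b
  assumes J: "carrier J = \<lbrace>a..b\<rbrace>" "le J = le L" "eq J = eq L"
    and ab: "a \<in> carrier L" "b \<in> carrier L" "a \<sqsubseteq> b"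
begin

lemma mem_interval: "x \<in> carrier J \<longleftrightarrow> x \<in> carrier L \<and> a \<sqsubseteq> x \<and> x \<sqsubseteq> b"
  using J by (simp add: at_least_at_most_def)

lemma bottom_interval: "\<bottom>\<^bsub>J\<^esub> = a"
proof -
  have "least J a (carrier J)" using mem_interval ab J by (auto simp: least_def)
  moreover have "x = a" if "least J x (carrier J)" for x
    using that mem_interval ab J by (intro le_antisym) (auto simp: least_def)
  ultimately show ?thesis unfolding bottom_def by (rule some_equality)
qed

lemma top_interval: "\<top>\<^bsub>J\<^esub> = b"
proof -
  have "greatest J b (carrier J)" using mem_interval ab J by (auto simp: greatest_def)
  moreover have "x = b" if "greatest J x (carrier J)" for x
    using that mem_interval ab J by (intro le_antisym) (auto simp: greatest_def)
  ultimately show ?thesis unfolding top_def by (rule some_equality)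
qed

lemma height_interval:
  assumes x: "x \<in> carrier L" "a \<sqsubseteq> x" "x \<sqsubseteq> b"
  shows "height J x = h x - h a"
proof (rule height_eqI)
  have less: "u \<sqsubset>\<^bsub>J\<^esub> v \<longleftrightarrow> u \<sqsubseteq> v \<and> u \<noteq> v" for u v
    using J lless_eq[of u v] by (simp add: lless_def)
  show "\<bottom>\<^bsub>J\<^esub> \<in> carrier J" using bottom_interval mem_interval ab by simp
  show "h u - h a < h v - h a" if "u \<in> carrier J" "v \<in> carrier J" "u \<sqsubset>\<^bsub>J\<^esub> v" for u v
    using that less mem_interval height_less[of u v] height_mono[of a u] ab by auto
  show "u = \<bottom>\<^bsub>J\<^esub>" if "u \<in> carrier J" "h u - h a = 0" for u
    using that bottom_interval mem_interval height_eqD[of a u] ab by auto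
  show "\<exists>v\<in>carrier J. v \<sqsubset>\<^bsub>J\<^esub> u \<and> h v - h a = n" if u: "u \<in> carrier J" "h u - h a = Suc n" for u n
  proof -
    have uc: "u \<in> carrier L" "a \<sqsubseteq> u" "u \<sqsubseteq> b" "a \<noteq> u" using u mem_interval by auto
    then obtain v where v: "v \<in> carrier L" "a \<sqsubseteq> v" "v \<sqsubseteq> u" "h v + 1 = h u"
      using cocover_exists[of a u] ab by metis
    then have "v \<sqsubseteq> b" "v \<noteq> u" using le_trans[of v u b] uc ab by auto
    then show ?thesis using v u less mem_interval by (intro bexI[of _ v]) auto
  qed
  show "x \<in> carrier J" using mem_interval x by simp
qed

lemma meet_interval:
  assumes "x \<in> carrier J" "y \<in> carrier J"
  shows "x \<sqinter>\<^bsub>J\<^esub> y = x \<sqinter> y"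
proof -
  have xy: "x \<in> carrier L" "y \<in> carrier L" "a \<sqsubseteq> x" "a \<sqsubseteq> y" "x \<sqsubseteq> b" "y \<sqsubseteq> b"
    using assms mem_interval by auto
  have lb: "x \<sqinter> y \<in> carrier L" "x \<sqinter> y \<sqsubseteq> x" "x \<sqinter> y \<sqsubseteq> y" "a \<sqsubseteq> x \<sqinter> y"
    using xy ab meet_left meet_right meet_le by auto
  then have c: "x \<sqinter> y \<in> carrier J" using mem_interval le_trans[of "x \<sqinter> y" x b] xy ab by simp
  have "greatest J (x \<sqinter> y) (Lower J {x, y})"
    using lb c assms J mem_interval meet_le[of _ x y] xy by (auto simp: greatest_def Lower_def)
  moreover have "z = x \<sqinter> y" if z: "greatest J z (Lower J {x, y})" for z
  proof -
    have "z \<sqsubseteq> x \<sqinter> y" "x \<sqinter> y \<sqsubseteq> z" "z \<in> carrier L"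
      using z calculation J mem_interval c unfolding greatest_def Lower_def by auto
    then show ?thesis using lb le_antisym by simp
  qed
  ultimately show ?thesis unfolding meet_def[of J] Lattice.inf_def by (rule some_equality)
qed

lemma join_interval:
  assumes "x \<in> carrier J" "y \<in> carrier J"
  shows "x \<squnion>\<^bsub>J\<^esub> y = x \<squnion> y"
proof -
  have xy: "x \<in> carrier L" "y \<in> carrier L" "a \<sqsubseteq> x" "a \<sqsubseteq> y" "x \<sqsubseteq> b" "y \<sqsubseteq> b"
    using assms mem_interval by auto
  have ub: "x \<squnion> y \<in> carrier L" "x \<sqsubseteq> x \<squnion> y" "y \<sqsubseteq> x \<squnion> y" "x \<squnion> y \<sqsubseteq> b"
    using xy ab join_left join_right join_le by auto
  then have c: "x \<squnion> y \<in> carrier J" using mem_interval le_trans[of a x "x \<squnion> y"] xy ab by simp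
  have "least J (x \<squnion> y) (Upper J {x, y})"
    using ub c assms J mem_interval join_le[of x _ y] xy by (auto simp: least_def Upper_def)
  moreover have "z = x \<squnion> y" if z: "least J z (Upper J {x, y})" for z
  proof -
    have "z \<sqsubseteq> x \<squnion> y" "x \<squnion> y \<sqsubseteq> z" "z \<in> carrier L"
      using z calculation J mem_interval c unfolding least_def Upper_def by auto
    then show ?thesis using ub le_antisym by simp
  qed
  ultimately show ?thesis unfolding join_def[of J] Lattice.sup_def by (rule some_equality)
qed

lemma interval_partition_interval: "interval_partition J P \<longleftrightarrow> tiles a b P"
proof
  assume P: "interval_partition J P"
  let ?B = "\<lambda>(c, d). \<lbrace>c..d\<rbrace>\<^bsub>J\<^esub>"
  have sub: "c \<in> carrier J \<and> d \<in> carrier J" if "(c, d) \<in> P" for c d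
    using P that by (auto simp: interval_partition_def)
  have part: "partition_on (carrier J) (?B ` P)" using P by (simp add: interval_partition_def)
  have B: "x \<in> ?B (c, d) \<longleftrightarrow> x \<in> carrier L \<and> c \<sqsubseteq> x \<and> x \<sqsubseteq> d" if "(c, d) \<in> P" for c d x
    using sub[OF that] J mem_interval le_trans[of a c x] le_trans[of x d b] ab
    by (auto simp: at_least_at_most_def)
  have le: "c \<sqsubseteq> d" if "(c, d) \<in> P" for c d
  proof -
    have "?B (c, d) \<noteq> {}" using partition_onD3[OF part] that by force
    then obtain x where "x \<in> ?B (c, d)" by blast
    then show ?thesis using B[OF that] le_trans[of c x d] sub[OF that] mem_interval by simp
  qed
  show "tiles a b P"
    unfolding tiles_def
  proof (intro conjI ballI impI)
    fix p assume "p \<in> P"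
    then show "case p of (c, d) \<Rightarrow> c \<in> carrier L \<and> d \<in> carrier L \<and> a \<sqsubseteq> c \<and> c \<sqsubseteq> d \<and> d \<sqsubseteq> b"
      using sub le mem_interval by (cases p) simp
  next
    fix x assume x: "x \<in> carrier L" "a \<sqsubseteq> x" "x \<sqsubseteq> b"
    then have "x \<in> \<Union>(?B ` P)" using partition_onD1[OF part] mem_interval by simp
    then obtain c d where cd: "(c, d) \<in> P" "x \<in> ?B (c, d)" by auto
    show "\<exists>!p. p \<in> P \<and> fst p \<sqsubseteq> x \<and> x \<sqsubseteq> snd p"
    proof (rule ex1I[of _ "(c, d)"])
      show "(c, d) \<in> P \<and> fst (c, d) \<sqsubseteq> x \<and> x \<sqsubseteq> snd (c, d)" using cd B by simp
      fix p assume p: "p \<in> P \<and> fst p \<sqsubseteq> x \<and> x \<sqsubseteq> snd p"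
      obtain u v where uv: "p = (u, v)" by fastforce
      then have "x \<in> ?B (u, v)" using B[of u v x] p x by simp
      then have "?B (u, v) \<inter> ?B (c, d) \<noteq> {}" using cd by blast
      then have eq: "?B (u, v) = ?B (c, d)"
        using partition_onD2[OF part] p uv cd(1) unfolding disjoint_def by blast
      have uvP: "(u, v) \<in> P" using p uv by simp
      have "u \<in> ?B (u, v)" "v \<in> ?B (u, v)"
        unfolding B[OF uvP] using le[OF uvP] sub[OF uvP] mem_interval by auto
      then have 1: "u \<in> ?B (c, d)" "v \<in> ?B (c, d)" unfolding eq .
      have "c \<in> ?B (c, d)" "d \<in> ?B (c, d)"
        unfolding B[OF cd(1)] using le[OF cd(1)] sub[OF cd(1)] mem_interval by auto
      then have 2: "c \<in> ?B (u, v)" "d \<in> ?B (u, v)" unfolding eq .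
      have "c \<sqsubseteq> u" "u \<sqsubseteq> c" "d \<sqsubseteq> v" "v \<sqsubseteq> d"
        using 1 2 unfolding B[OF cd(1)] B[OF uvP] by auto
      then show "p = (c, d)"
        using uv le_antisym[of u c] le_antisym[of v d] sub[of u v] sub[OF cd(1)] p mem_interval by simp
    qed
  qed
next
  assume P: "tiles a b P"
  have sub: "c \<in> carrier J \<and> d \<in> carrier J" if "(c, d) \<in> P" for c d
    using tilesD[OF P that] mem_interval le_trans[of a c d] le_trans[of c d b] ab by simp
  have B: "x \<in> \<lbrace>c..d\<rbrace>\<^bsub>J\<^esub> \<longleftrightarrow> x \<in> carrier L \<and> c \<sqsubseteq> x \<and> x \<sqsubseteq> d" if "(c, d) \<in> P" for c d x
    using sub[OF that] J mem_interval le_trans[of a c x] le_trans[of x d b] ab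
    by (auto simp: at_least_at_most_def)
  show "interval_partition J P"
    unfolding interval_partition_def
  proof (intro conjI partition_onI)
    show "P \<subseteq> carrier J \<times> carrier J" using sub by auto
    show "\<Union>((\<lambda>(c, d). \<lbrace>c..d\<rbrace>\<^bsub>J\<^esub>) ` P) = carrier J"
    proof (rule Set.set_eqI)
      fix x
      show "x \<in> \<Union>((\<lambda>(c, d). \<lbrace>c..d\<rbrace>\<^bsub>J\<^esub>) ` P) \<longleftrightarrow> x \<in> carrier J"
      proof
        assume "x \<in> carrier J"
        then obtain c d where "(c, d) \<in> P" "c \<sqsubseteq> x" "x \<sqsubseteq> d" "x \<in> carrier L"
          using tiles_cover[OF P, of x] mem_interval by metis
        then show "x \<in> \<Union>((\<lambda>(c, d). \<lbrace>c..d\<rbrace>\<^bsub>J\<^esub>) ` P)" using B by fast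
      qed (auto simp: at_least_at_most_def)
    qed
    show "{} \<notin> (\<lambda>(c, d). \<lbrace>c..d\<rbrace>\<^bsub>J\<^esub>) ` P"
    proof
      assume "{} \<in> (\<lambda>(c, d). \<lbrace>c..d\<rbrace>\<^bsub>J\<^esub>) ` P"
      then obtain c d where cd: "(c, d) \<in> P" "\<lbrace>c..d\<rbrace>\<^bsub>J\<^esub> = {}" by auto
      then show False using B[OF cd(1), of c] tilesD[OF P cd(1)] by simp
    qed
    show "disjnt p p'" if p: "p \<in> (\<lambda>(c, d). \<lbrace>c..d\<rbrace>\<^bsub>J\<^esub>) ` P"
      "p' \<in> (\<lambda>(c, d). \<lbrace>c..d\<rbrace>\<^bsub>J\<^esub>) ` P" and ne: "p \<noteq> p'" for p p'
    proof -
      obtain c d where cd: "(c, d) \<in> P" "p = \<lbrace>c..d\<rbrace>\<^bsub>J\<^esub>" using p by auto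
      obtain c' d' where cd': "(c', d') \<in> P" "p' = \<lbrace>c'..d'\<rbrace>\<^bsub>J\<^esub>" using p by auto
      have "False" if x: "x \<in> p" "x \<in> p'" for x
        using tiles_unique[OF ab(1,2) P cd(1) cd'(1), of x] B[OF cd(1)] B[OF cd'(1)] x cd cd' ne
        by simp
      then show ?thesis by (auto simp: disjnt_def)
    qed
  qed
qed

end

end

section \<open>Independence of the Tutte partition\<close>

text \<open>
  Choose \<open>m\<close> with greatest coordinate sum in \<open>A + B\<close>. In the sums for \<open>s = m\<close> only the copies of \<open>m\<close>
  contribute, so \<open>m\<close> has the same multiplicity in both multisets. Remove one copy and repeat.
\<close>

lemma multiset_eq_of_triangular_sums:
  fixes A B :: "(nat \<times> nat) multiset" and C :: "nat \<times> nat \<Rightarrow> nat \<times> nat \<Rightarrow> nat"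
  assumes "\<And>t. t \<in># A + B \<Longrightarrow> C t t = 1"
    and "\<And>t s. t \<in># A + B \<Longrightarrow> C t s \<noteq> 0 \<Longrightarrow> fst s \<le> fst t \<and> snd s \<le> snd t"
    and "\<And>s. (\<Sum>t\<in>#A. C t s) = (\<Sum>t\<in>#B. C t s)"
  shows "A = B"
  using assms
proof (induction "size A" arbitrary: A B)
  case 0
  have "B = {#}"
  proof (rule ccontr)
    assume "B \<noteq> {#}"
    then obtain t B' where B: "B = add_mset t B'" by (meson multiset_cases)
    show False using 0(4)[of t] 0(2)[of t] 0(1) B by simp
  qed
  then show ?case using 0 by simp
next
  case (Suc k)
  define w where "w t = fst t + snd t" for t :: "nat \<times> nat"
  have "A + B \<noteq> {#}" using Suc.hyps(2) by auto
  then have "set_mset (A + B) \<noteq> {}" by (metis set_mset_eq_empty_iff)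
  then obtain m where m: "m \<in># A + B" "\<And>t. t \<in># A + B \<Longrightarrow> w t \<le> w m"
    using Max_in[of "w ` set_mset (A + B)"] Max_ge[of "w ` set_mset (A + B)"]
    by (smt (verit) finite_imageI finite_set_mset image_iff image_is_empty)
  have "C t m = (if t = m then 1 else 0)" if "t \<in># A + B" for t
  proof (cases "t = m")
    case True
    then show ?thesis using Suc.prems(1) that by simp
  next
    case False
    have "C t m = 0"
    proof (rule ccontr)
      assume "C t m \<noteq> 0"
      then have "fst m \<le> fst t" "snd m \<le> snd t" using Suc.prems(2)[OF that] by auto
      then have "t = m" using m(2)[OF that] by (simp add: w_def prod_eq_iff)
      then show False using False by simp
    qed
    then show ?thesis using False by simp
  qed
  then have "(\<Sum>t\<in>#D. C t m) = count D m" if "D \<subseteq># A + B" for D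
  proof -
    have "(\<Sum>t\<in>#D. C t m) = (\<Sum>t\<in>#D. if t = m then 1 else 0)"
      using \<open>\<And>t. t \<in># A + B \<Longrightarrow> C t m = (if t = m then 1 else 0)\<close> mset_subset_eqD[OF that]
      by (intro arg_cong[of _ _ sum_mset] image_mset_cong) auto
    then show ?thesis by (simp add: sum_mset_delta)
  qed
  then have "count A m = count B m" using Suc.prems(3)[of m] by simp
  then have "m \<in># A" "m \<in># B" using m(1) by (auto simp flip: count_greater_zero_iff)
  then obtain A' B' where AB: "A = add_mset m A'" "B = add_mset m B'"
    by (metis insert_DiffM)
  have "A' = B'"
  proof (rule Suc.hyps(1))
    show "k = size A'" using Suc.hyps(2) AB by simp
    show "C t t = 1" if "t \<in># A' + B'" for t using Suc.prems(1)[of t] that AB by auto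
    show "fst s \<le> fst t \<and> snd s \<le> snd t" if "t \<in># A' + B'" "C t s \<noteq> 0" for t s
      using Suc.prems(2)[of t s] that AB by auto
    show "(\<Sum>t\<in>#A'. C t s) = (\<Sum>t\<in>#B'. C t s)" for s using Suc.prems(3)[of s] AB by simp
  qed
  then show ?case using AB by simp
qed

context q_matroid
begin

text \<open>
  The Tutte partitions of the minor on \<open>[a, b]\<close>, see \<open>Tutte_partition_minor\<close>. The condition on \<open>c\<close>
  says that it has full rank over \<open>a\<close>.
\<close>

definition Tutte_tiling :: "'a \<Rightarrow> 'a \<Rightarrow> ('a \<times> 'a) set \<Rightarrow> bool" where
  "Tutte_tiling a b P \<longleftrightarrow> tiles a b P \<and>
     (\<forall>(c, d)\<in>P. r c + h a = r a + h c \<and> r d = r b \<and> prime_free_interval M c d)"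

definition block_type :: "'a \<times> 'a \<Rightarrow> nat \<times> nat" where
  "block_type = (\<lambda>(c, d). (r d - r c, nullity M d - nullity M c))"

definition type_monomial :: "nat \<times> nat \<Rightarrow> int poly poly" where
  "type_monomial = (\<lambda>(i, j). monom (monom 1 i) j)"

definition prime_free_block :: "'a \<times> 'a \<Rightarrow> bool" where
  "prime_free_block = (\<lambda>(c, d). c \<in> carrier M \<and> d \<in> carrier M \<and> c \<sqsubseteq> d \<and> prime_free_interval M c d)"

text \<open>
  The coefficients of the corank-nullity polynomial of the minor on \<open>[c, d]\<close>.
\<close>

definition rank_count :: "'a \<times> 'a \<Rightarrow> nat \<times> nat \<Rightarrow> nat" where
  "rank_count = (\<lambda>(c, d) (i, j). card {x \<in> carrier M. c \<sqsubseteq> x \<and> x \<sqsubseteq> d \<and>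
     r d - r x = i \<and> nullity M x - nullity M c = j})"

lemma type_monomial_mult: "type_monomial (i, j) * type_monomial (k, m) = type_monomial (i + k, j + m)"
  by (simp add: type_monomial_def mult_monom)

text \<open>
  The formula of \<open>prime_free_rank\<close>, solved for corank and nullity; none of the subtractions is
  truncated.
\<close>

definition block_ranks :: "'a \<Rightarrow> 'a \<Rightarrow> 'a \<Rightarrow> bool" where
  "block_ranks c d l \<longleftrightarrow> (\<forall>x\<in>carrier M. c \<sqsubseteq> x \<longrightarrow> x \<sqsubseteq> d \<longrightarrow>
     r d - r x + h x = fst (block_type (c, d)) + h (x \<sqinter> l) \<and>
     nullity M x - nullity M c + h c = h (x \<sqinter> l))"

lemma prime_free_block_structure:
  assumes "prime_free_block (c, d)"
  obtains l where "l \<in> carrier M" "c \<sqsubseteq> l" "l \<sqsubseteq> d"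
    "h d - h l = fst (block_type (c, d))" "h l - h c = snd (block_type (c, d))"
    "block_ranks c d l"
proof -
  have cd: "c \<in> carrier M" "d \<in> carrier M" "c \<sqsubseteq> d" "prime_free_interval M c d"
    using assms by (auto simp: prime_free_block_def)
  obtain l where l: "l \<in> carrier M" "c \<sqsubseteq> l" "l \<sqsubseteq> d" "r l = r c"
    and rank: "\<And>x. \<lbrakk>x \<in> carrier M; c \<sqsubseteq> x; x \<sqsubseteq> d\<rbrakk> \<Longrightarrow> r x + h (x \<sqinter> l) = r c + h x"
    using prime_free_rank[OF cd] by metis
  have "d \<sqinter> l = l"
    using cd l meet_le[of l d l] meet_right[of d l] le_antisym[of "d \<sqinter> l" l] by simp
  then have rd: "r d + h l = r c + h d" using rank[of d] cd by simp
  have ineq: "r c \<le> h c" "r d \<le> h d" "h c \<le> h l" "h l \<le> h d"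
    using rank_le_height height_mono cd l by auto
  have 1: "h d - h l = fst (block_type (c, d))" "h l - h c = snd (block_type (c, d))"
    using rd ineq by (auto simp: block_type_def nullity_def)
  have "r d - r x + h x = fst (block_type (c, d)) + h (x \<sqinter> l) \<and>
       nullity M x - nullity M c + h c = h (x \<sqinter> l)"
    if x: "x \<in> carrier M" "c \<sqsubseteq> x" "x \<sqsubseteq> d" for x
  proof -
    have "c \<sqsubseteq> x \<sqinter> l" using x l cd by (intro meet_le) auto
    then have "h c \<le> h (x \<sqinter> l)" "r x \<le> h x" "r x \<le> r d" "r c \<le> r x" "h x \<le> h d"
      "h (x \<sqinter> l) \<le> h x"
      using height_mono rank_le_height rank_mono meet_left x l cd by auto
    then show ?thesis
      using rank[OF x] rd ineq by (auto simp: block_type_def nullity_def)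
  qed
  then show thesis using that[of l] l 1 by (simp add: block_ranks_def)
qed

text \<open>
  By the previous lemma, corank \<open>i\<close> and nullity \<open>j\<close> prescribe the heights of \<open>x\<close> and of its meet with
  the loop element; so the elements counted form a \<open>position_class\<close>.
\<close>

lemma rank_count_cong:
  assumes "prime_free_block p" "prime_free_block p'" "block_type p = block_type p'"
  shows "rank_count p s = rank_count p' s"
proof -
  obtain c d c' d' i j where p: "p = (c, d)" "p' = (c', d')" "s = (i, j)" by fastforce
  have count: "rank_count (u, v) (i, j) =
      (if i \<le> fst (block_type (u, v)) then card (position_class u v l (fst (block_type (u, v)) - i + j) j) else 0)"
    if l: "l \<in> carrier M" "u \<sqsubseteq> l" "l \<sqsubseteq> v"
      "block_ranks u v l"
      and uv: "u \<in> carrier M" "v \<in> carrier M" for u v l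
  proof -
    let ?t = "fst (block_type (u, v))"
    have le: "h (x \<sqinter> l) \<le> h x" if "x \<in> carrier M" for x
      using that l height_mono[of "x \<sqinter> l" x] meet_left[of x l] by simp
    have iff: "r v - r x = i \<and> nullity M x - nullity M u = j \<longleftrightarrow>
        i \<le> ?t \<and> h x = h u + (?t - i + j) \<and> h (x \<sqinter> l) = h u + j"
      if x: "x \<in> carrier M" "u \<sqsubseteq> x" "x \<sqsubseteq> v" for x
      using l(4)[unfolded block_ranks_def, rule_format, OF x] le[OF x(1)] by auto
    have "{x \<in> carrier M. u \<sqsubseteq> x \<and> x \<sqsubseteq> v \<and> r v - r x = i \<and> nullity M x - nullity M u = j} =
        (if i \<le> ?t then position_class u v l (?t - i + j) j else {})"
    proof (rule Set.set_eqI)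
      fix x
      show "x \<in> {x \<in> carrier M. u \<sqsubseteq> x \<and> x \<sqsubseteq> v \<and> r v - r x = i \<and> nullity M x - nullity M u = j}
          \<longleftrightarrow> x \<in> (if i \<le> ?t then position_class u v l (?t - i + j) j else {})"
      proof (cases "i \<le> ?t")
        case True
        then have eq: "(if i \<le> ?t then position_class u v l (?t - i + j) j else {}) =
          position_class u v l (?t - i + j) j" by simp
        have "x \<in> carrier M \<and> u \<sqsubseteq> x \<and> x \<sqsubseteq> v \<longrightarrow>
          (r v - r x = i \<and> nullity M x - nullity M u = j \<longleftrightarrow>
           h x = h u + (?t - i + j) \<and> h (x \<sqinter> l) = h u + j)"
          using iff[of x] True by (simp del: One_nat_def)
        then show ?thesis unfolding eq unfolding position_class_def mem_Collect_eq by argo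
      next
        case False
        then have eq: "(if i \<le> ?t then position_class u v l (?t - i + j) j else {}) = {}" by simp
        show ?thesis unfolding eq mem_Collect_eq using iff[of x] False by simp
      qed
    qed
    then show ?thesis by (simp add: rank_count_def)
  qed
  obtain l where l: "l \<in> carrier M" "c \<sqsubseteq> l" "l \<sqsubseteq> d"
    "h d - h l = fst (block_type (c, d))" "h l - h c = snd (block_type (c, d))"
    "block_ranks c d l"
    using prime_free_block_structure[of c d] assms(1) p by metis
  obtain l' where l': "l' \<in> carrier M" "c' \<sqsubseteq> l'" "l' \<sqsubseteq> d'"
    "h d' - h l' = fst (block_type (c', d'))" "h l' - h c' = snd (block_type (c', d'))"
    "block_ranks c' d' l'"
    using prime_free_block_structure[of c' d'] assms(2) p by metis
  have cd: "c \<in> carrier M" "d \<in> carrier M" "c' \<in> carrier M" "d' \<in> carrier M"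
    using assms p by (auto simp: prime_free_block_def)
  have ty: "block_type (c, d) = block_type (c', d')" using assms p by simp
  have "h d - h c = h d' - h c'" "h l - h c = h l' - h c'"
    using l(4,5) l'(4,5) ty height_mono[of c l] height_mono[of l d] height_mono[of c' l']
      height_mono[of l' d'] l(1-3) l'(1-3) cd by auto
  then have "card (position_class c d l m k) = card (position_class c' d' l' m k)" for m k
    using card_position_class_cong cd l(1-3) l'(1-3) by metis
  then show ?thesis
    using count[OF l(1-3,6) cd(1,2)] count[OF l'(1-3,6) cd(3,4)] ty p by simp
qed

text \<open>
  Only the loop element has the full corank and the full nullity.
\<close>

lemma rank_count_self:
  assumes "prime_free_block p"
  shows "rank_count p (block_type p) = 1"
proof -
  obtain c d where p: "p = (c, d)" by fastforce
  obtain l where l: "l \<in> carrier M" "c \<sqsubseteq> l" "l \<sqsubseteq> d"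
    "h d - h l = fst (block_type (c, d))" "h l - h c = snd (block_type (c, d))"
    "block_ranks c d l"
    using prime_free_block_structure[of c d] assms p by metis
  have cd: "c \<in> carrier M" "d \<in> carrier M" using assms p by (auto simp: prime_free_block_def)
  note ranks = l(6)[unfolded block_ranks_def, rule_format]
  have hc: "h c \<le> h l" using height_mono l cd by simp
  have "r d - r x = fst (block_type (c, d)) \<and> nullity M x - nullity M c = snd (block_type (c, d))
      \<longleftrightarrow> x = l" if x: "x \<in> carrier M" "c \<sqsubseteq> x" "x \<sqsubseteq> d" for x
  proof
    assume "r d - r x = fst (block_type (c, d)) \<and> nullity M x - nullity M c = snd (block_type (c, d))"
    then have "h x = h (x \<sqinter> l)" "h (x \<sqinter> l) = h l" using ranks[OF x] l(5) hc by auto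
    then have "x \<sqinter> l = x" "x \<sqinter> l = l"
      using x l meet_left[of x l] meet_right[of x l] height_eqD[of "x \<sqinter> l" x]
        height_eqD[of "x \<sqinter> l" l] by auto
    then show "x = l" by simp
  next
    assume "x = l"
    moreover have "l \<sqinter> l = l" using l le_iff_join[of l l] by simp
    ultimately show "r d - r x = fst (block_type (c, d)) \<and>
        nullity M x - nullity M c = snd (block_type (c, d))"
      using l(5) ranks[OF x] hc by (simp; linarith)
  qed
  then have "{x \<in> carrier M. c \<sqsubseteq> x \<and> x \<sqsubseteq> d \<and> r d - r x = fst (block_type (c, d)) \<and>
      nullity M x - nullity M c = snd (block_type (c, d))} = {l}" using l(1-3) by auto
  then show ?thesis unfolding p rank_count_def by (simp add: case_prod_unfold)
qed

lemma rank_count_le: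
  assumes "prime_free_block p" "rank_count p s \<noteq> 0"
  shows "fst s \<le> fst (block_type p) \<and> snd s \<le> snd (block_type p)"
proof -
  obtain c d i j where p: "p = (c, d)" "s = (i, j)" by fastforce
  have "{x \<in> carrier M. c \<sqsubseteq> x \<and> x \<sqsubseteq> d \<and> r d - r x = i \<and> nullity M x - nullity M c = j} \<noteq> {}"
    using assms(2) p unfolding rank_count_def by (metis (no_types, lifting) card.empty case_prod_conv)
  then obtain x where x: "x \<in> carrier M" "c \<sqsubseteq> x" "x \<sqsubseteq> d" "r d - r x = i" "nullity M x - nullity M c = j"
    by blast
  have "c \<in> carrier M" "d \<in> carrier M" using assms p by (auto simp: prime_free_block_def)
  then have "r c \<le> r x" "nullity M x \<le> nullity M d" using x rank_mono nullity_mono by auto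
  then show ?thesis using x p by (auto simp: block_type_def)
qed

text \<open>
  Since \<open>r d = r b\<close> and \<open>\<nu> c = \<nu> a\<close>, corank and nullity within a block agree with those in \<open>[a, b]\<close>.
\<close>

lemma rank_count_tiling:
  assumes ab: "a \<in> carrier M" "b \<in> carrier M" and P: "Tutte_tiling a b P"
  shows "rank_count (a, b) s = (\<Sum>p\<in>P. rank_count p s)"
proof -
  obtain i j where s: "s = (i, j)" by fastforce
  have T: "tiles a b P" using P by (simp add: Tutte_tiling_def)
  have "rank_count (c, d) (i, j) =
      card {x \<in> carrier M. c \<sqsubseteq> x \<and> x \<sqsubseteq> d \<and> r b - r x = i \<and> nullity M x - nullity M a = j}"
    if "(c, d) \<in> P" for c d
  proof -
    have "r c + h a = r a + h c" "r d = r b" using P that by (auto simp: Tutte_tiling_def)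
    moreover from this have "nullity M c = nullity M a"
      using rank_le_height[of a] rank_le_height[of c] ab tilesD[OF T that] by (auto simp: nullity_def)
    ultimately show ?thesis by (simp add: rank_count_def)
  qed
  then show ?thesis
    using card_tiles[OF ab T, of "\<lambda>x. r b - r x = i \<and> nullity M x - nullity M a = j"]
    by (simp add: rank_count_def s case_prod_unfold)
qed

text \<open>
  \<open>C\<close> expresses \<open>rank_count\<close> as a function of the type of a block. The system of equations
  \<open>rank_count_tiling\<close> is triangular by \<open>rank_count_self\<close> and \<open>rank_count_le\<close>.
\<close>

theorem sum_type_monomial_unique:
  assumes ab: "a \<in> carrier M" "b \<in> carrier M"
    and P: "Tutte_tiling a b P" and Q: "Tutte_tiling a b Q"
  shows "(\<Sum>p\<in>P. type_monomial (block_type p)) = (\<Sum>p\<in>Q. type_monomial (block_type p))"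
proof -
  define C where "C t = rank_count (SOME p. prime_free_block p \<and> block_type p = t)" for t
  have C: "C (block_type p) s = rank_count p s" if "prime_free_block p" for p s
  proof -
    have "prime_free_block p \<and> block_type p = block_type p" using that by simp
    then have "prime_free_block (SOME p'. prime_free_block p' \<and> block_type p' = block_type p) \<and>
      block_type (SOME p'. prime_free_block p' \<and> block_type p' = block_type p) = block_type p"
      by (rule someI[of "\<lambda>p'. prime_free_block p' \<and> block_type p' = block_type p"])
    then show ?thesis unfolding C_def using rank_count_cong that by blast
  qed
  have fin: "finite R" and pfb: "\<And>p. p \<in> R \<Longrightarrow> prime_free_block p"
    if "Tutte_tiling a b R" for R
  proof -
    have T: "tiles a b R" using that by (simp add: Tutte_tiling_def)
    show "finite R" using finite_tiles[OF T] .
    show "prime_free_block p" if "p \<in> R" for p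
      using \<open>Tutte_tiling a b R\<close> tilesD[OF T, of "fst p" "snd p"] that
      by (auto simp: Tutte_tiling_def prime_free_block_def)
  qed
  let ?A = "\<lambda>R. image_mset block_type (mset_set R)"
  have "?A P = ?A Q"
  proof (rule multiset_eq_of_triangular_sums[where C = C])
    have mem: "\<exists>p. prime_free_block p \<and> t = block_type p" if "t \<in># ?A P + ?A Q" for t
    proof -
      have "t \<in> block_type ` (P \<union> Q)" using that fin[OF P] fin[OF Q] by auto
      then obtain p where "p \<in> P \<union> Q" "t = block_type p" by (rule imageE)
      then show ?thesis using pfb[OF P] pfb[OF Q] by (metis UnE)
    qed
    show "C t t = 1" if "t \<in># ?A P + ?A Q" for t
      using mem[OF that] C rank_count_self by metis
    show "fst s \<le> fst t \<and> snd s \<le> snd t" if "t \<in># ?A P + ?A Q" "C t s \<noteq> 0" for t s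
      using mem[OF that(1)] that(2) C rank_count_le by metis
    have "(\<Sum>t\<in>#?A R. C t s) = rank_count (a, b) s" if R: "Tutte_tiling a b R" for R s
    proof -
      have "(\<Sum>t\<in>#?A R. C t s) = (\<Sum>p\<in>R. C (block_type p) s)"
        by (simp add: sum_unfold_sum_mset image_mset.compositionality comp_def)
      then show ?thesis using rank_count_tiling[OF ab R, of s] C pfb[OF R] by simp
    qed
    then show "(\<Sum>t\<in>#?A P. C t s) = (\<Sum>t\<in>#?A Q. C t s)" for s using P Q by simp
  qed
  moreover have "(\<Sum>p\<in>R. type_monomial (block_type p)) = (\<Sum>t\<in>#?A R. type_monomial t)" for R
    by (simp add: sum_unfold_sum_mset image_mset.compositionality comp_def)
  ultimately show ?thesis by simp
qed

section \<open>The Tutte polynomial of a minor\<close>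

lemma minor_simps:
  "carrier (minor M a b) = \<lbrace>a..b\<rbrace>" "le (minor M a b) = le M" "eq (minor M a b) = eq M"
  "rk (minor M a b) = (\<lambda>x. r x - r a)"
  by (simp_all add: minor_def interval_lattice_def)

lemma minor_bottom_top: "minor M \<bottom> \<top> = M"
proof -
  have "\<lbrace>\<bottom>..\<top>\<rbrace> = carrier M" by (auto simp: at_least_at_most_def)
  then show ?thesis by (simp add: minor_def interval_lattice_def)
qed

context
  fixes a b
  assumes ab: "a \<in> carrier M" "b \<in> carrier M" "a \<sqsubseteq> b"
begin

lemmas interval_facts =
  mem_interval[OF minor_simps(1-3) ab] bottom_interval[OF minor_simps(1-3) ab]
  top_interval[OF minor_simps(1-3) ab] height_interval[OF minor_simps(1-3) ab]
  interval_partition_interval[OF minor_simps(1-3) ab]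

lemma prime_diamond_minor:
  assumes u: "u \<in> carrier M" "a \<sqsubseteq> u" and v: "v \<in> carrier M" "v \<sqsubseteq> b" and "u \<sqsubseteq> v"
  shows "prime_diamond (minor M a b) u v \<longleftrightarrow> prime_diamond M u v"
proof -
  have uv: "u \<sqsubseteq> b" "a \<sqsubseteq> v" using assms ab le_trans[of u v b] le_trans[of a u v] by auto
  have less: "x \<sqsubset>\<^bsub>minor M a b\<^esub> y \<longleftrightarrow> x \<sqsubset> y" for x y by (simp add: lless_def minor_simps)
  have "diamond (minor M a b) u v \<longleftrightarrow> diamond M u v"
    using assms uv height_mono[of a u] height_mono[of a v] ab
    by (auto simp: diamond_def interval_facts minor_simps(2))
  moreover have "rk (minor M a b) x = rk (minor M a b) u + 1 \<and> rk (minor M a b) v = rk (minor M a b) x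
      \<longleftrightarrow> r x = r u + 1 \<and> r v = r x" if "x \<in> carrier M" "u \<sqsubset> x" "x \<sqsubset> v" for x
    using that lless_eq le_trans[of a u x] rank_mono[of a u] rank_mono[of a x] rank_mono[of a v] u v uv ab
    by (auto simp: minor_simps(4))
  moreover have "x \<in> carrier (minor M a b) \<longleftrightarrow> x \<in> carrier M" if "u \<sqsubset> x" "x \<sqsubset> v" for x
    using that lless_eq le_trans[of a u x] le_trans[of x v b] u v ab by (auto simp: interval_facts)
  ultimately show ?thesis unfolding prime_diamond_def less by metis
qed

lemma prime_free_interval_minor:
  assumes c: "c \<in> carrier M" "a \<sqsubseteq> c" and d: "d \<in> carrier M" "d \<sqsubseteq> b"
  shows "prime_free_interval (minor M a b) c d \<longleftrightarrow> prime_free_interval M c d"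
proof -
  have "prime_diamond (minor M a b) u v \<and> c \<sqsubseteq> u \<and> v \<sqsubseteq> d \<longleftrightarrow>
      prime_diamond M u v \<and> c \<sqsubseteq> u \<and> v \<sqsubseteq> d" for u v
  proof (cases "u \<in> carrier M \<and> v \<in> carrier M \<and> u \<sqsubseteq> v \<and> c \<sqsubseteq> u \<and> v \<sqsubseteq> d")
    case True
    then show ?thesis
      using prime_diamond_minor[of u v] le_trans[of a c u] le_trans[of v d b] c d ab by simp
  next
    case False
    then show ?thesis
      unfolding prime_diamond_def diamond_def by (auto simp: interval_facts minor_simps(2))
  qed
  then show ?thesis unfolding prime_free_interval_def minor_simps(2) by metis
qed

lemma Tutte_partition_minor: "Tutte_partition (minor M a b) P \<longleftrightarrow> Tutte_tiling a b P"
proof -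
  have "rk (minor M a b) c = height (minor M a b) c \<and>
      rk (minor M a b) d = rk (minor M a b) \<top>\<^bsub>minor M a b\<^esub> \<and> prime_free_interval (minor M a b) c d
    \<longleftrightarrow> r c + h a = r a + h c \<and> r d = r b \<and> prime_free_interval M c d"
    if "tiles a b P" "(c, d) \<in> P" for c d
  proof -
    note cd = tilesD[OF that]
    have le: "c \<sqsubseteq> b" "a \<sqsubseteq> d" using cd le_trans[of c d b] le_trans[of a c d] ab by auto
    then have "r a \<le> r c" "r a \<le> r d" "r d \<le> r b" "h a \<le> h c"
      using cd ab rank_mono height_mono by auto
    then show ?thesis
      using prime_free_interval_minor[of c d] cd le
      by (auto simp: interval_facts minor_simps(4))
  qed
  then show ?thesis
    unfolding Tutte_partition_def Tutte_tiling_def interval_facts by fastforce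
qed

lemma Tutte_sum_minor:
  assumes "tiles a b P"
  shows "Tutte_sum (minor M a b) P = (\<Sum>p\<in>P. type_monomial (block_type p))"
  unfolding Tutte_sum_def
proof (rule sum.cong[OF HOL.refl])
  fix p assume "p \<in> P"
  moreover obtain c d where p: "p = (c, d)" by fastforce
  ultimately have cd: "c \<in> carrier M" "d \<in> carrier M" "a \<sqsubseteq> c" "c \<sqsubseteq> d" "d \<sqsubseteq> b"
    using tilesD[OF assms, of c d] by auto
  have le: "c \<sqsubseteq> b" "a \<sqsubseteq> d" using cd le_trans[of c d b] le_trans[of a c d] ab by auto
  have ineq: "r a \<le> r c" "r a \<le> r d" "h a \<le> h c" "h a \<le> h d" "r c + h a \<le> r a + h c"
    "r d + h a \<le> r a + h d" "r c \<le> h c" "r d \<le> h d" "r a \<le> h a"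
    using cd le ab rank_mono height_mono rank_increment rank_le_height by auto
  have "nullity (minor M a b) d - nullity (minor M a b) c = nullity M d - nullity M c"
    using ineq cd le unfolding nullity_def minor_simps(4) by (simp add: interval_facts)
  then show "(case p of (c, d) \<Rightarrow> monom (monom 1 (rk (minor M a b) d - rk (minor M a b) c))
      (nullity (minor M a b) d - nullity (minor M a b) c)) = type_monomial (block_type p)"
    using ineq unfolding p by (simp add: type_monomial_def block_type_def minor_simps(4))
qed

lemma Tutte_polynomial_minor:
  assumes "Tutte_tiling a b P"
  shows "Tutte_polynomial (minor M a b) = (\<Sum>p\<in>P. type_monomial (block_type p))"
proof -
  have sum: "Tutte_sum (minor M a b) Q = (\<Sum>p\<in>P. type_monomial (block_type p))"
    if "Tutte_tiling a b Q" for Q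
    using that Tutte_sum_minor sum_type_monomial_unique[OF ab(1,2) that assms]
    by (simp add: Tutte_tiling_def)
  show ?thesis
    unfolding Tutte_polynomial_def Tutte_partition_minor
  proof (rule the_equality)
    show "(\<exists>P. Tutte_tiling a b P) \<and> (\<forall>Q. Tutte_tiling a b Q \<longrightarrow>
        Tutte_sum (minor M a b) Q = (\<Sum>p\<in>P. type_monomial (block_type p)))"
      using sum assms by blast
    show "t = (\<Sum>p\<in>P. type_monomial (block_type p))"
      if "(\<exists>P. Tutte_tiling a b P) \<and> (\<forall>Q. Tutte_tiling a b Q \<longrightarrow> Tutte_sum (minor M a b) Q = t)" for t
      using sum[OF assms] assms that by metis
  qed
qed

lemma Tutte_tiling_prime_free:
  assumes "prime_free_interval M a b"
  shows "Tutte_tiling a b {(a, b)}"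
  using tiles_singleton[OF ab] assms by (simp add: Tutte_tiling_def)

end

lemma prime_free_interval_mono:
  assumes "prime_free_interval M a b" "a \<in> carrier M" "b \<in> carrier M" "a' \<in> carrier M" "b' \<in> carrier M"
    "a \<sqsubseteq> a'" "b' \<sqsubseteq> b"
  shows "prime_free_interval M a' b'"
proof -
  have "False" if "prime_diamond M c d" "a' \<sqsubseteq> c" "d \<sqsubseteq> b'" for c d
  proof -
    have "c \<in> carrier M" "d \<in> carrier M" using that by (auto simp: prime_diamond_def diamond_def)
    then have "a \<sqsubseteq> c" "d \<sqsubseteq> b" using that assms le_trans[of a a' c] le_trans[of d b' b] by auto
    then show False using that assms(1) unfolding prime_free_interval_def by metis
  qed
  then show ?thesis unfolding prime_free_interval_def by metis
qed

text \<open>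
  Here all three lattices are single blocks.
\<close>

lemma Tutte_polynomial_prime_free:
  assumes "prime_free M" "atom M e"
  shows "Tutte_polynomial M = Tutte_polynomial (restriction M e) * Tutte_polynomial (contraction M e)"
proof -
  have e: "e \<in> carrier M" using assms by (simp add: atom_def)
  have pf: "prime_free_interval M \<bottom> \<top>" "prime_free_interval M \<bottom> e" "prime_free_interval M e \<top>"
    using assms(1) prime_free_interval_mono[of \<bottom> \<top>] e unfolding prime_free_def by auto
  have tau: "Tutte_polynomial (minor M a b) = type_monomial (block_type (a, b))"
    if "a \<in> carrier M" "b \<in> carrier M" "a \<sqsubseteq> b" "prime_free_interval M a b" for a b
    using Tutte_polynomial_minor[OF that(1-3) Tutte_tiling_prime_free[OF that]] by simp
  have "nullity M \<bottom> = 0" by (simp add: nullity_def)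
  moreover have "nullity M e \<le> nullity M \<top>" "r e \<le> r \<top>"
    using nullity_mono rank_mono e by auto
  ultimately show ?thesis
    using tau[of \<bottom> \<top>] tau[of \<bottom> e] tau[of e \<top>] pf e
    unfolding restriction_def contraction_def
    by (simp add: minor_bottom_top block_type_def type_monomial_mult)
qed

end

section \<open>Isomorphisms\<close>

text \<open>
  Lattice isomorphisms reduced to their effect on the order, which is all that heights and interval
  partitions depend on.
\<close>

definition order_iso :: "('a, 'c) gorder_scheme \<Rightarrow> ('b, 'd) gorder_scheme \<Rightarrow> ('a \<Rightarrow> 'b) \<Rightarrow> bool" where
  "order_iso L1 L2 \<phi> \<longleftrightarrow> bij_betw \<phi> (carrier L1) (carrier L2) \<and>
     (\<forall>x\<in>carrier L1. \<forall>y\<in>carrier L1. \<phi> x \<sqsubseteq>\<^bsub>L2\<^esub> \<phi> y \<longleftrightarrow> x \<sqsubseteq>\<^bsub>L1\<^esub> y)"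

lemma order_isoD:
  assumes "order_iso L1 L2 \<phi>"
  shows "x \<in> carrier L1 \<Longrightarrow> \<phi> x \<in> carrier L2"
    and "\<lbrakk>x \<in> carrier L1; y \<in> carrier L1\<rbrakk> \<Longrightarrow> \<phi> x \<sqsubseteq>\<^bsub>L2\<^esub> \<phi> y \<longleftrightarrow> x \<sqsubseteq>\<^bsub>L1\<^esub> y"
    and "\<lbrakk>x \<in> carrier L1; y \<in> carrier L1\<rbrakk> \<Longrightarrow> \<phi> x = \<phi> y \<longleftrightarrow> x = y"
    and "u \<in> carrier L2 \<Longrightarrow> \<exists>x\<in>carrier L1. u = \<phi> x"
  using assms unfolding order_iso_def bij_betw_def inj_on_def by auto

lemma lattice_iso_imp_order_iso:
  assumes "lattice_iso L1 L2 \<phi>"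
  shows "order_iso L1 L2 \<phi>"
proof -
  interpret L1: lattice L1 using assms by (simp add: lattice_iso_def join_pres_def)
  interpret L2: lattice L2 using assms by (simp add: lattice_iso_def join_pres_def)
  have bij: "bij_betw \<phi> (carrier L1) (carrier L2)" using assms by (simp add: lattice_iso_def)
  have "\<phi> x \<sqsubseteq>\<^bsub>L2\<^esub> \<phi> y \<longleftrightarrow> x \<sqsubseteq>\<^bsub>L1\<^esub> y" if xy: "x \<in> carrier L1" "y \<in> carrier L1" for x y
  proof -
    have "\<phi> (x \<squnion>\<^bsub>L1\<^esub> y) = \<phi> x \<squnion>\<^bsub>L2\<^esub> \<phi> y"
      using assms xy by (simp add: lattice_iso_def join_pres_def)
    moreover have "\<phi> x \<in> carrier L2" "\<phi> y \<in> carrier L2" using bij xy by (auto simp: bij_betw_def)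
    moreover have "\<phi> (x \<squnion>\<^bsub>L1\<^esub> y) = \<phi> y \<longleftrightarrow> x \<squnion>\<^bsub>L1\<^esub> y = y"
      using bij xy inj_on_eq_iff[of \<phi> "carrier L1" "x \<squnion>\<^bsub>L1\<^esub> y" y] by (simp add: bij_betw_def)
    ultimately show ?thesis using L1.le_iff_meet[of x y] L2.le_iff_meet[of "\<phi> x" "\<phi> y"] xy by simp
  qed
  then show ?thesis using bij by (simp add: order_iso_def)
qed

lemma order_iso_comp:
  assumes "order_iso L1 L2 \<phi>" "order_iso L2 L3 \<psi>"
  shows "order_iso L1 L3 (\<psi> \<circ> \<phi>)"
  using assms order_isoD(1)[OF assms(1)] bij_betw_trans[of \<phi> "carrier L1" "carrier L2" \<psi> "carrier L3"]
  unfolding order_iso_def by simp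

lemma order_iso_inv:
  assumes "order_iso L1 L2 \<phi>"
  shows "order_iso L2 L1 (inv_into (carrier L1) \<phi>)"
proof -
  have bij: "bij_betw \<phi> (carrier L1) (carrier L2)" using assms by (simp add: order_iso_def)
  have "inv_into (carrier L1) \<phi> u \<in> carrier L1" "\<phi> (inv_into (carrier L1) \<phi> u) = u"
    if "u \<in> carrier L2" for u
    using bij that by (auto simp: bij_betw_def inv_into_into f_inv_into_f)
  then show ?thesis
    using bij_betw_inv_into[OF bij] order_isoD(2)[OF assms] unfolding order_iso_def by metis
qed

context q_lattice
begin

context
  fixes L1 :: "('b, 'd) gorder_scheme" and \<phi> :: "'b \<Rightarrow> 'a"
  assumes po: "partial_order L1" and iso: "order_iso L1 L \<phi>"
begin

interpretation L1: partial_order L1 by (rule po)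

lemma order_iso_bottom: "\<bottom>\<^bsub>L1\<^esub> \<in> carrier L1" "\<phi> \<bottom>\<^bsub>L1\<^esub> = \<bottom>"
proof -
  obtain b where b: "b \<in> carrier L1" "\<bottom> = \<phi> b" using order_isoD(4)[OF iso, of \<bottom>] by auto
  have "b \<sqsubseteq>\<^bsub>L1\<^esub> x" if "x \<in> carrier L1" for x
    using order_isoD(2)[OF iso b(1) that] bottom_lower[OF order_isoD(1)[OF iso that]] b by simp
  then have "least L1 b (carrier L1)" using b by (simp add: least_def)
  then show "\<bottom>\<^bsub>L1\<^esub> \<in> carrier L1" "\<phi> \<bottom>\<^bsub>L1\<^esub> = \<bottom>" using L1.bottom_eqI b by auto
qed

lemma order_iso_top: "\<top>\<^bsub>L1\<^esub> \<in> carrier L1" "\<phi> \<top>\<^bsub>L1\<^esub> = \<top>"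
proof -
  obtain b where b: "b \<in> carrier L1" "\<top> = \<phi> b" using order_isoD(4)[OF iso, of \<top>] by auto
  have "x \<sqsubseteq>\<^bsub>L1\<^esub> b" if "x \<in> carrier L1" for x
    using order_isoD(2)[OF iso that b(1)] top_higher[OF order_isoD(1)[OF iso that]] b by simp
  then have g: "greatest L1 b (carrier L1)" using b by (simp add: greatest_def)
  have "\<top>\<^bsub>L1\<^esub> = b"
    unfolding top_def by (rule some_equality, rule g) (rule L1.greatest_unique[OF _ g])
  then show "\<top>\<^bsub>L1\<^esub> \<in> carrier L1" "\<phi> \<top>\<^bsub>L1\<^esub> = \<top>" using b by auto
qed

lemma order_iso_height:
  assumes x: "x \<in> carrier L1"
  shows "height L1 x = h (\<phi> x)"
proof (rule height_eqI)
  note cl = order_isoD(1)[OF iso] and le = order_isoD(2)[OF iso] and eq = order_isoD(3)[OF iso]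
  show "\<bottom>\<^bsub>L1\<^esub> \<in> carrier L1" by (rule order_iso_bottom)
  show "h (\<phi> u) < h (\<phi> v)" if "u \<in> carrier L1" "v \<in> carrier L1" "u \<sqsubset>\<^bsub>L1\<^esub> v" for u v
    using that cl le eq L1.lless_eq by (intro height_less) auto
  show "u = \<bottom>\<^bsub>L1\<^esub>" if "u \<in> carrier L1" "h (\<phi> u) = 0" for u
    using that cl[of u] eq[of u "\<bottom>\<^bsub>L1\<^esub>"] order_iso_bottom height_eqD[of \<bottom> "\<phi> u"] by simp
  show "\<exists>v\<in>carrier L1. v \<sqsubset>\<^bsub>L1\<^esub> u \<and> h (\<phi> v) = n"
    if u: "u \<in> carrier L1" "h (\<phi> u) = Suc n" for u n
  proof -
    have "\<bottom> \<noteq> \<phi> u" using u(2) by (metis height_bottom nat.distinct(1))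
    then obtain w where w: "w \<in> carrier L" "w \<sqsubseteq> \<phi> u" "h w + 1 = h (\<phi> u)"
      using cocover_exists[of \<bottom> "\<phi> u"] cl[OF u(1)] by auto
    obtain v where v: "v \<in> carrier L1" "w = \<phi> v" using order_isoD(4)[OF iso w(1)] by auto
    then have "v \<sqsubseteq>\<^bsub>L1\<^esub> u" "v \<noteq> u" using w le[of v u] u by auto
    then show ?thesis using v w u L1.lless_eq by (intro bexI[of _ v]) auto
  qed
qed (rule x)

end

lemma tiles_iso:
  fixes L1 :: "('b, 'd) gorder_scheme"
  assumes L1: "q_lattice L1 p" and iso: "order_iso L1 L \<phi>"
    and ab: "a \<in> carrier L1" "b \<in> carrier L1"
    and P: "q_lattice.tiles L1 a b P"
  shows "tiles (\<phi> a) (\<phi> b) (map_prod \<phi> \<phi> ` P)"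
proof -
  interpret L1: q_lattice L1 p by (rule L1)
  note cl = order_isoD(1)[OF iso] and le = order_isoD(2)[OF iso] and eq = order_isoD(3)[OF iso]
  show ?thesis
    unfolding tiles_def
  proof (intro conjI ballI impI)
    fix uv assume "uv \<in> map_prod \<phi> \<phi> ` P"
    then obtain c d where cd: "(c, d) \<in> P" "uv = (\<phi> c, \<phi> d)" by auto
    then show "case uv of (u, v) \<Rightarrow> u \<in> carrier L \<and> v \<in> carrier L \<and> \<phi> a \<sqsubseteq> u \<and> u \<sqsubseteq> v \<and> v \<sqsubseteq> \<phi> b"
      using L1.tilesD[OF P cd(1)] cl le ab by simp
  next
    fix y assume y: "y \<in> carrier L" "\<phi> a \<sqsubseteq> y" "y \<sqsubseteq> \<phi> b"
    then obtain x where x: "x \<in> carrier L1" "y = \<phi> x" using order_isoD(4)[OF iso] by metis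
    then have "a \<sqsubseteq>\<^bsub>L1\<^esub> x" "x \<sqsubseteq>\<^bsub>L1\<^esub> b" using y le ab by auto
    then obtain c d where cd: "(c, d) \<in> P" "c \<sqsubseteq>\<^bsub>L1\<^esub> x" "x \<sqsubseteq>\<^bsub>L1\<^esub> d"
      using L1.tiles_cover[OF P x(1)] by metis
    show "\<exists>!p. p \<in> map_prod \<phi> \<phi> ` P \<and> fst p \<sqsubseteq> y \<and> y \<sqsubseteq> snd p"
    proof (rule ex1I[of _ "(\<phi> c, \<phi> d)"])
      show "(\<phi> c, \<phi> d) \<in> map_prod \<phi> \<phi> ` P \<and> fst (\<phi> c, \<phi> d) \<sqsubseteq> y \<and> y \<sqsubseteq> snd (\<phi> c, \<phi> d)"
        using cd x le L1.tilesD[OF P cd(1)] by force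
      fix p assume p: "p \<in> map_prod \<phi> \<phi> ` P \<and> fst p \<sqsubseteq> y \<and> y \<sqsubseteq> snd p"
      then obtain c' d' where cd': "(c', d') \<in> P" "p = (\<phi> c', \<phi> d')" by auto
      then have "c' \<sqsubseteq>\<^bsub>L1\<^esub> x" "x \<sqsubseteq>\<^bsub>L1\<^esub> d'" using p x le L1.tilesD[OF P cd'(1)] by auto
      then have "(c', d') = (c, d)" using L1.tiles_unique[OF ab P cd'(1) cd(1) x(1)] cd by simp
      then show "p = (\<phi> c, \<phi> d)" using cd' by simp
    qed
  qed
qed

text \<open>
  Proper interval decompositions in which both the atom \<open>e\<close> and the coatom \<open>H\<close> opposite to it are
  prescribed. For \<open>\<not> e \<sqsubseteq> H\<close> these two are complements in \<open>[a, b]\<close>.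
\<close>

definition antiflag_decomposition :: "'a \<Rightarrow> 'a \<Rightarrow> 'a \<Rightarrow> 'a \<Rightarrow> ('a \<times> 'a) set \<Rightarrow> bool" where
  "antiflag_decomposition a b e H F \<longleftrightarrow>
     finite F \<and> card F = q ^ (h b - h a - 1) - 1 \<and> tiles a b ({(e, b), (a, H)} \<union> F) \<and>
     (\<forall>(c, d)\<in>F. c \<in> atoms_of a b \<and> d \<in> coatoms_of a b)"

lemma antiflag_decomposition_iso:
  assumes iso: "order_iso L L \<psi>" and ab: "a \<in> carrier L" "b \<in> carrier L" "\<psi> a = a" "\<psi> b = b"
    and F: "antiflag_decomposition a b e H F" and eH: "e \<in> carrier L" "H \<in> carrier L"
  shows "antiflag_decomposition a b (\<psi> e) (\<psi> H) (map_prod \<psi> \<psi> ` F)"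
proof -
  note cl = order_isoD(1)[OF iso] and le = order_isoD(2)[OF iso] and eq = order_isoD(3)[OF iso]
  have ht: "h (\<psi> x) = h x" if "x \<in> carrier L" for x
    using order_iso_height[OF _ iso that] partial_order_axioms by simp
  have sub: "F \<subseteq> carrier L \<times> carrier L"
    using F by (auto simp: antiflag_decomposition_def atoms_of_def coatoms_of_def)
  have "inj_on (map_prod \<psi> \<psi>) F"
    using sub eq by (auto simp: inj_on_def) (metis mem_Sigma_iff subsetD)+
  then have "card (map_prod \<psi> \<psi> ` F) = card F" by (rule card_image)
  moreover have "tiles a b (map_prod \<psi> \<psi> ` ({(e, b), (a, H)} \<union> F))"
    using tiles_iso[OF q_lattice_axioms iso ab(1,2)] F ab unfolding antiflag_decomposition_def by metis
  then have "tiles a b ({(\<psi> e, b), (a, \<psi> H)} \<union> map_prod \<psi> \<psi> ` F)"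
    using ab by (simp add: image_Un)
  moreover have "\<psi> c \<in> atoms_of a b \<and> \<psi> d \<in> coatoms_of a b" if "(c, d) \<in> F" for c d
  proof -
    have "c \<in> atoms_of a b" "d \<in> coatoms_of a b"
      using F that by (auto simp: antiflag_decomposition_def)
    then show ?thesis
      using cl ht le[of a c] le[of c b] le[of a d] le[of d b] ab by (auto simp: atoms_of_def coatoms_of_def)
  qed
  ultimately show ?thesis
    using F by (auto simp: antiflag_decomposition_def)
qed

end

context q_matroid
begin

lemma Tutte_tiling_iso:
  fixes M1 :: "'b ranked_lattice"
  assumes M1: "q_matroid M1 p" and iso: "order_iso M1 M \<phi>"
    and rk: "\<And>x. x \<in> carrier M1 \<Longrightarrow> rk M1 x = r (\<phi> x)"
    and ab: "a \<in> carrier M1" "b \<in> carrier M1"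
    and P: "q_matroid.Tutte_tiling M1 a b P"
  shows "Tutte_tiling (\<phi> a) (\<phi> b) (map_prod \<phi> \<phi> ` P)"
    and "(\<Sum>p\<in>map_prod \<phi> \<phi> ` P. type_monomial (block_type p)) =
      (\<Sum>p\<in>P. type_monomial (q_matroid.block_type M1 p))"
proof -
  interpret M1: q_matroid M1 p by (rule M1)
  note cl = order_isoD(1)[OF iso] and le = order_isoD(2)[OF iso] and eq = order_isoD(3)[OF iso]
  have ht: "height M1 x = h (\<phi> x)" if "x \<in> carrier M1" for x
    using order_iso_height[OF _ iso that] M1.partial_order_axioms by simp
  have T: "M1.tiles a b P" using P by (simp add: M1.Tutte_tiling_def)
  have pf: "prime_free_interval M (\<phi> c) (\<phi> d)"
    if pf: "prime_free_interval M1 c d" and cd: "c \<in> carrier M1" "d \<in> carrier M1" for c d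
  proof -
    have False if uv: "prime_diamond M u v" "\<phi> c \<sqsubseteq> u" "v \<sqsubseteq> \<phi> d" for u v
    proof -
      have "u \<in> carrier M" "v \<in> carrier M" using uv by (auto simp: prime_diamond_def diamond_def)
      then obtain u' v' where u': "u' \<in> carrier M1" "u = \<phi> u'" and v': "v' \<in> carrier M1" "v = \<phi> v'"
        using order_isoD(4)[OF iso] by metis
      have "prime_diamond M1 u' v'"
        unfolding prime_diamond_def diamond_def
      proof (intro conjI ballI impI)
        show "u' \<in> carrier M1" "v' \<in> carrier M1" "u' \<sqsubseteq>\<^bsub>M1\<^esub> v'" "height M1 v' = height M1 u' + 2"
          using uv(1) u' v' le ht by (auto simp: prime_diamond_def diamond_def)
        fix x assume x: "x \<in> carrier M1" "u' \<sqsubset>\<^bsub>M1\<^esub> x \<and> x \<sqsubset>\<^bsub>M1\<^esub> v'"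
        then have "u \<sqsubset> \<phi> x \<and> \<phi> x \<sqsubset> v"
          using lless_eq M1.lless_eq le eq u' v' by auto
        then have "r (\<phi> x) = r u + 1 \<and> r v = r (\<phi> x)"
          using uv(1) cl[OF x(1)] by (simp add: prime_diamond_def)
        then show "rk M1 x = rk M1 u' + 1" "rk M1 v' = rk M1 x" using rk u' v' x by auto
      qed
      moreover have "c \<sqsubseteq>\<^bsub>M1\<^esub> u'" "v' \<sqsubseteq>\<^bsub>M1\<^esub> d" using uv u' v' le cd by auto
      ultimately show False using pf unfolding prime_free_interval_def by metis
    qed
    then show ?thesis unfolding prime_free_interval_def by metis
  qed
  have "r (\<phi> c) + h (\<phi> a) = r (\<phi> a) + h (\<phi> c) \<and> r (\<phi> d) = r (\<phi> b) \<and>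
      prime_free_interval M (\<phi> c) (\<phi> d)" if "(c, d) \<in> P" for c d
    using P that M1.tilesD[OF T that] pf[of c d] rk ht ab by (auto simp: M1.Tutte_tiling_def)
  moreover have "tiles (\<phi> a) (\<phi> b) (map_prod \<phi> \<phi> ` P)"
    using tiles_iso[OF M1.q_lattice_axioms iso ab T] .
  ultimately show "Tutte_tiling (\<phi> a) (\<phi> b) (map_prod \<phi> \<phi> ` P)"
    unfolding Tutte_tiling_def by auto
  have inj: "inj_on (map_prod \<phi> \<phi>) P"
  proof (rule inj_onI)
    fix p p' assume *: "p \<in> P" "p' \<in> P" "map_prod \<phi> \<phi> p = map_prod \<phi> \<phi> p'"
    then show "p = p'"
      using M1.tilesD[OF T, of "fst p" "snd p"] M1.tilesD[OF T, of "fst p'" "snd p'"] eq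
      by (cases p, cases p') auto
  qed
  have "block_type (map_prod \<phi> \<phi> p) = M1.block_type p" if "p \<in> P" for p
    using M1.tilesD[OF T, of "fst p" "snd p"] that rk ht
    by (cases p) (simp add: block_type_def M1.block_type_def nullity_def)
  then show "(\<Sum>p\<in>map_prod \<phi> \<phi> ` P. type_monomial (block_type p)) =
      (\<Sum>p\<in>P. type_monomial (M1.block_type p))"
    by (simp add: sum.reindex[OF inj])
qed

end

section \<open>Existence of Tutte partitions and the decomposition identity\<close>

locale decomposable_q_matroid = q_matroid +
  assumes antiflag_decomposition_exists:
    "\<lbrakk>a \<in> carrier M; b \<in> carrier M; a \<sqsubseteq> b; e \<in> atoms_of a b; H \<in> coatoms_of a b; \<not> e \<sqsubseteq> H\<rbrakk>
      \<Longrightarrow> \<exists>F. antiflag_decomposition a b e H F"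
begin

text \<open>
  Take for \<open>H\<close> a coatom above the loop element \<open>l\<close> but not above \<open>e\<close>. For any further block
  \<open>[c, d]\<close>, the blocks being disjoint, \<open>d\<close> is not above \<open>e\<close>, so it is not a coloop, and the atom \<open>c\<close>
  is not below \<open>H\<close>, so it is not a loop.
\<close>

lemma admissible_decomposition:
  assumes ab: "a \<in> carrier M" "b \<in> carrier M" "a \<sqsubseteq> b"
    and e: "e \<in> atoms_of a b" "r e = r a + 1"
    and coloop: "\<And>H. \<lbrakk>H \<in> coatoms_of a b; r H + 1 = r b\<rbrakk> \<Longrightarrow> e \<sqsubseteq> H"
  obtains H F where "H \<in> coatoms_of a b" "\<not> e \<sqsubseteq> H" "antiflag_decomposition a b e H F"
    "\<And>c d. (c, d) \<in> {(e, b), (a, H)} \<union> F \<Longrightarrow> r c + h a = r a + h c \<and> r d = r b"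
proof -
  have ec: "e \<in> carrier M" "a \<sqsubseteq> e" "e \<sqsubseteq> b" "h e = h a + 1" using e by (auto simp: atoms_of_def)
  obtain l where l: "l \<in> carrier M" "a \<sqsubseteq> l" "l \<sqsubseteq> b" "r l = r a"
    and lmax: "\<And>x. \<lbrakk>x \<in> carrier M; a \<sqsubseteq> x; x \<sqsubseteq> b; r x = r a\<rbrakk> \<Longrightarrow> x \<sqsubseteq> l"
    using loop_element[OF ab] by metis
  have "\<not> e \<sqsubseteq> l" using rank_mono[of e l] e(2) l ec by auto
  then obtain H where H: "H \<in> coatoms_of l b" "\<not> e \<sqsubseteq> H"
    using coatom_avoiding[of b l e] l ec ab by metis
  then have Hc: "H \<in> carrier M" "l \<sqsubseteq> H" "H \<sqsubseteq> b" "h H + 1 = h b" by (auto simp: coatoms_of_def)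
  have "a \<sqsubseteq> H" using le_trans[of a l H] l Hc ab by simp
  then have Hab: "H \<in> coatoms_of a b" using Hc by (simp add: coatoms_of_def)
  obtain F where F: "antiflag_decomposition a b e H F"
    using antiflag_decomposition_exists[OF ab e(1) Hab H(2)] by blast
  let ?P = "{(e, b), (a, H)} \<union> F"
  have T: "tiles a b ?P" using F by (simp add: antiflag_decomposition_def)
  have full: "r d = r b" if d: "d \<in> coatoms_of a b" "\<not> e \<sqsubseteq> d" for d
  proof -
    have dc: "d \<in> carrier M" "d \<sqsubseteq> b" "h b = h d + 1" using d by (auto simp: coatoms_of_def)
    have "r d + 1 \<noteq> r b" using coloop d by blast
    then show ?thesis using rank_cover[of d b] rank_mono[of d b] dc ab by simp
  qed
  have "r c + h a = r a + h c \<and> r d = r b" if cd: "(c, d) \<in> ?P" for c d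
  proof -
    consider "(c, d) = (e, b)" | "(c, d) = (a, H)" | "(c, d) \<in> F" using cd by auto
    then show ?thesis
    proof cases
      case 1
      then show ?thesis using e ec by simp
    next
      case 2
      then show ?thesis using full Hab H by simp
    next
      case 3
      then have at: "c \<in> atoms_of a b" "d \<in> coatoms_of a b"
        using F by (auto simp: antiflag_decomposition_def)
      then have c: "c \<in> carrier M" "a \<sqsubseteq> c" "c \<sqsubseteq> b" "h c = h a + 1"
        and d: "d \<in> carrier M" "a \<sqsubseteq> d" "d \<sqsubseteq> b" "h d + 1 = h b"
        by (auto simp: atoms_of_def coatoms_of_def)
      have "\<not> e \<sqsubseteq> d"
        using tiles_unique[OF ab(1,2) T cd, of e b d] tilesD[OF T cd] d by auto
      moreover have "\<not> c \<sqsubseteq> H"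
        using tiles_unique[OF ab(1,2) T cd, of a H c] tilesD[OF T cd] c by auto
      then have "\<not> c \<sqsubseteq> l" using le_trans[of c l H] c l Hc by auto
      then have "r c \<noteq> r a" using lmax c by auto
      then have "r c = r a + 1" using rank_cover[of a c] rank_mono[of a c] c ab by simp
      ultimately show ?thesis using full at c by simp
    qed
  qed
  then show thesis using that Hab H F by metis
qed

text \<open>
  The two conditions on the ends of the outer blocks are exactly what makes rank conditions
  relative to a block into conditions relative to \<open>[a, b]\<close>.
\<close>

lemma Tutte_tiling_glue:
  assumes ab: "a \<in> carrier M" "b \<in> carrier M"
    and T: "tiles a b P"
    and indep: "\<And>c d. (c, d) \<in> P \<Longrightarrow> r c + h a = r a + h c \<and> r d = r b"
    and Q: "\<And>c d. (c, d) \<in> P \<Longrightarrow> Tutte_tiling c d (Q (c, d))"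
  shows "Tutte_tiling a b (\<Union>p\<in>P. Q p)"
    and "(\<Sum>p\<in>(\<Union>p\<in>P. Q p). f p) = (\<Sum>p\<in>P. \<Sum>p'\<in>Q p. f p')"
proof -
  have TQ: "tiles c d (Q (c, d))" if "(c, d) \<in> P" for c d
    using Q that by (simp add: Tutte_tiling_def)
  note refine = tiles_refine[OF ab T TQ]
  have "r u + h a = r a + h u \<and> r v = r b \<and> prime_free_interval M u v"
    if "(u, v) \<in> Q p" "p \<in> P" for u v p
    using Q[of "fst p" "snd p"] indep[of "fst p" "snd p"] that by (auto simp: Tutte_tiling_def)
  then show "Tutte_tiling a b (\<Union>p\<in>P. Q p)"
    using refine(1) unfolding Tutte_tiling_def by auto
  show "(\<Sum>p\<in>(\<Union>p\<in>P. Q p). f p) = (\<Sum>p\<in>P. \<Sum>p'\<in>Q p. f p')"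
  proof (rule sum.UNION_disjoint)
    show "finite P" by (rule finite_tiles[OF T])
    show "\<forall>p\<in>P. finite (Q p)" using TQ finite_tiles by fastforce
    show "\<forall>p\<in>P. \<forall>p'\<in>P. p \<noteq> p' \<longrightarrow> Q p \<inter> Q p' = {}" using refine(2) by blast
  qed
qed

theorem Tutte_tiling_exists:
  assumes "a \<in> carrier M" "b \<in> carrier M" "a \<sqsubseteq> b"
  shows "\<exists>P. Tutte_tiling a b P"
  using assms
proof (induction "h b - h a" arbitrary: a b rule: less_induct)
  case less
  note ab = less.prems
  show ?case
  proof (cases "prime_free_interval M a b")
    case True
    then show ?thesis using Tutte_tiling_prime_free[OF ab] by blast
  next
    case False
    obtain e where e: "e \<in> atoms_of a b" "r e = r a + 1"
      "\<And>H. \<lbrakk>H \<in> coatoms_of a b; r H + 1 = r b\<rbrakk> \<Longrightarrow> e \<sqsubseteq> H"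
      using admissible_atom_exists[OF ab False] by metis
    obtain H F where HF: "H \<in> coatoms_of a b" "\<not> e \<sqsubseteq> H" "antiflag_decomposition a b e H F"
      "\<And>c d. (c, d) \<in> {(e, b), (a, H)} \<union> F \<Longrightarrow> r c + h a = r a + h c \<and> r d = r b"
      using admissible_decomposition[OF ab e] by metis
    let ?P = "{(e, b), (a, H)} \<union> F"
    have T: "tiles a b ?P" using HF(3) by (simp add: antiflag_decomposition_def)
    have "\<exists>Q. Tutte_tiling (fst p) (snd p) Q" if p: "p \<in> ?P" for p
    proof -
      obtain c d where cd: "p = (c, d)" by fastforce
      then have cdP: "(c, d) \<in> ?P" using p by simp
      note c = tilesD[OF T cdP]
      have "h c \<noteq> h a \<or> h d \<noteq> h b"
        using cdP e(1) HF(1,3) by (auto simp: antiflag_decomposition_def atoms_of_def coatoms_of_def)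
      then have "h d - h c < h b - h a"
        using height_mono[of a c] height_mono[of c d] height_mono[of d b] c ab by auto
      then show ?thesis using less.hyps[of d c] c cd by simp
    qed
    then obtain Q where "\<And>p. p \<in> ?P \<Longrightarrow> Tutte_tiling (fst p) (snd p) (Q p)" by metis
    then have "\<And>c d. (c, d) \<in> ?P \<Longrightarrow> Tutte_tiling c d (Q (c, d))" by fastforce
    then show ?thesis using Tutte_tiling_glue(1)[OF ab(1,2) T HF(4)] by blast
  qed
qed

lemma Tutte_polynomial_tiles:
  assumes ab: "a \<in> carrier M" "b \<in> carrier M" "a \<sqsubseteq> b" and T: "tiles a b P"
    and indep: "\<And>c d. (c, d) \<in> P \<Longrightarrow> r c + h a = r a + h c \<and> r d = r b"
  shows "Tutte_polynomial (minor M a b) = (\<Sum>(c, d)\<in>P. Tutte_polynomial (minor M c d))"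
proof -
  have "\<exists>Q. Tutte_tiling (fst p) (snd p) Q" if "p \<in> P" for p
    using Tutte_tiling_exists[of "fst p" "snd p"] tilesD[OF T, of "fst p" "snd p"] that by simp
  then obtain Q where "\<And>p. p \<in> P \<Longrightarrow> Tutte_tiling (fst p) (snd p) (Q p)" by metis
  then have Q: "\<And>c d. (c, d) \<in> P \<Longrightarrow> Tutte_tiling c d (Q (c, d))" by fastforce
  have "Tutte_polynomial (minor M a b) = (\<Sum>p\<in>P. \<Sum>p'\<in>Q p. type_monomial (block_type p'))"
    using Tutte_polynomial_minor[OF ab Tutte_tiling_glue(1)[OF ab(1,2) T indep Q]]
      Tutte_tiling_glue(2)[OF ab(1,2) T indep Q, of "\<lambda>p. type_monomial (block_type p)"] by simp
  also have "\<dots> = (\<Sum>(c, d)\<in>P. Tutte_polynomial (minor M c d))"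
  proof (rule sum.cong[OF HOL.refl])
    fix p assume p: "p \<in> P"
    obtain c d where cd: "p = (c, d)" by fastforce
    then show "(\<Sum>p'\<in>Q p. type_monomial (block_type p')) =
        (case p of (c, d) \<Rightarrow> Tutte_polynomial (minor M c d))"
      using Tutte_polynomial_minor[OF _ _ _ Q[of c d]] tilesD[OF T, of c d] p by simp
  qed
  finally show ?thesis .
qed

lemma Tutte_polynomial_decomposition:
  assumes e: "atom M e" "independent_element M e" "\<And>x. coloop M x \<Longrightarrow> e \<sqsubseteq> x"
  shows "\<exists>P. proper_interval_decomposition q M e P \<and>
    Tutte_polynomial M = (\<Sum>(a, b)\<in>P. Tutte_polynomial (minor M a b))"
proof -
  have J: "carrier M = \<lbrace>\<bottom>..\<top>\<rbrace>" by (auto simp: at_least_at_most_def)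
  have bt: "\<bottom> \<in> carrier M" "\<top> \<in> carrier M" "\<bottom> \<sqsubseteq> \<top>" by auto
  have ee: "e \<in> atoms_of \<bottom> \<top>" "r e = r \<bottom> + 1"
    using e(1,2) by (auto simp: atom_def independent_element_def atoms_of_def)
  have "e \<sqsubseteq> H" if "H \<in> coatoms_of \<bottom> \<top>" "r H + 1 = r \<top>" for H
    using e(3)[of H] that by (auto simp: coloop_def coatom_def coatoms_of_def)
  then obtain H F where HF: "H \<in> coatoms_of \<bottom> \<top>" "\<not> e \<sqsubseteq> H" "antiflag_decomposition \<bottom> \<top> e H F"
    "\<And>c d. (c, d) \<in> {(e, \<top>), (\<bottom>, H)} \<union> F \<Longrightarrow> r c + h \<bottom> = r \<bottom> + h c \<and> r d = r \<top>"
    using admissible_decomposition[OF bt ee] by metis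
  let ?P = "{(e, \<top>), (\<bottom>, H)} \<union> F"
  have T: "tiles \<bottom> \<top> ?P" using HF(3) by (simp add: antiflag_decomposition_def)
  have ec: "e \<in> carrier M" "h e = 1" using e by (auto simp: atom_def)
  have Hc: "H \<in> carrier M" using HF by (simp add: coatoms_of_def)
  have "is_complement M e H"
  proof -
    have j: "e \<squnion> H = \<top>" using coatom_join_eq[OF bt(1,2) HF(1) ec(1)] HF(2) ec by simp
    then have "h (e \<sqinter> H) = 0"
      using height_modular[of e H] ec Hc HF(1) by (simp add: coatoms_of_def)
    then have "e \<sqinter> H = \<bottom>" using height_eqD[of \<bottom> "e \<sqinter> H"] ec Hc by simp
    then show ?thesis using j Hc by (simp add: is_complement_def)
  qed
  moreover have "atom M a \<and> coatom M b \<and> a \<sqsubseteq> b" if "(a, b) \<in> F" for a b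
    using HF(3) that tilesD(4)[OF T, of a b]
    by (auto simp: antiflag_decomposition_def atoms_of_def coatoms_of_def atom_def coatom_def)
  ultimately have "proper_interval_decomposition q M e ?P"
    unfolding proper_interval_decomposition_def
    using e(1) interval_partition_interval[OF J HOL.refl HOL.refl bt, of ?P] T HF(3)
    by (intro conjI exI[of _ H] exI[of _ F]) (auto simp: antiflag_decomposition_def)
  moreover have "Tutte_polynomial M = (\<Sum>(a, b)\<in>?P. Tutte_polynomial (minor M a b))"
    using Tutte_polynomial_tiles[OF bt T HF(4)] by (simp only: minor_bottom_top)
  ultimately show ?thesis by blast
qed

lemma Tutte_polynomial_iso:
  fixes M' :: "'b ranked_lattice"
  assumes M': "q_matroid M' p" and "ranked_iso M M'"
  shows "Tutte_polynomial M = Tutte_polynomial M'"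
proof -
  interpret M': q_matroid M' p by (rule M')
  obtain \<phi> where \<phi>: "lattice_iso M M' \<phi>" "\<And>x. x \<in> carrier M \<Longrightarrow> r x = rk M' (\<phi> x)"
    using assms(2) by (auto simp: ranked_iso_def)
  have iso: "order_iso M M' \<phi>" by (rule lattice_iso_imp_order_iso[OF \<phi>(1)])
  obtain P where P: "Tutte_tiling \<bottom> \<top> P" using Tutte_tiling_exists[of \<bottom> \<top>] by auto
  have bt: "\<bottom> \<in> carrier M" "\<top> \<in> carrier M" "\<bottom> \<sqsubseteq> \<top>" by auto
  have bt': "\<bottom>\<^bsub>M'\<^esub> \<in> carrier M'" "\<top>\<^bsub>M'\<^esub> \<in> carrier M'" "\<bottom>\<^bsub>M'\<^esub> \<sqsubseteq>\<^bsub>M'\<^esub> \<top>\<^bsub>M'\<^esub>" by auto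
  have eq: "\<phi> \<bottom> = \<bottom>\<^bsub>M'\<^esub>" "\<phi> \<top> = \<top>\<^bsub>M'\<^esub>"
    using M'.order_iso_bottom M'.order_iso_top partial_order_axioms iso by auto
  note tr = M'.Tutte_tiling_iso[OF q_matroid_axioms iso \<phi>(2) bt(1,2) P]
  have "Tutte_polynomial M = (\<Sum>p\<in>P. type_monomial (block_type p))"
    using Tutte_polynomial_minor[OF bt P] by (simp add: minor_bottom_top)
  also have "\<dots> = Tutte_polynomial M'"
    using M'.Tutte_polynomial_minor[OF bt', of "map_prod \<phi> \<phi> ` P"] tr
    by (simp add: M'.minor_bottom_top eq)
  finally show ?thesis .
qed

end

section \<open>Boolean lattices\<close>

lemma (in lattice) join_eqI:
  assumes "x \<in> carrier L" "y \<in> carrier L" "s \<in> carrier L" "x \<sqsubseteq> s" "y \<sqsubseteq> s"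
    and "\<And>z. \<lbrakk>z \<in> carrier L; x \<sqsubseteq> z; y \<sqsubseteq> z\<rbrakk> \<Longrightarrow> s \<sqsubseteq> z"
  shows "x \<squnion> y = s"
  using assms join_le[of x s y] assms(6)[of "x \<squnion> y"] join_left[of x y] join_right[of x y]
  by (intro le_antisym) auto

lemma (in lattice) meet_eqI:
  assumes "x \<in> carrier L" "y \<in> carrier L" "s \<in> carrier L" "s \<sqsubseteq> x" "s \<sqsubseteq> y"
    and "\<And>z. \<lbrakk>z \<in> carrier L; z \<sqsubseteq> x; z \<sqsubseteq> y\<rbrakk> \<Longrightarrow> z \<sqsubseteq> s"
  shows "x \<sqinter> y = s"
  using assms meet_le[of s x y] assms(6)[of "x \<sqinter> y"] meet_left[of x y] meet_right[of x y]
  by (intro le_antisym) auto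

lemma q_lattice_lattice_iso:
  assumes "q_lattice L q" and iso: "lattice_iso L1 L \<phi>"
  shows "q_lattice L1 q"
proof -
  interpret L: q_lattice L q by fact
  interpret L1: lattice L1 using iso by (simp add: lattice_iso_def join_pres_def)
  have oi: "order_iso L1 L \<phi>" by (rule lattice_iso_imp_order_iso[OF iso])
  note cl = order_isoD(1)[OF oi] and le = order_isoD(2)[OF oi] and eq = order_isoD(3)[OF oi]
  have ht: "height L1 x = height L (\<phi> x)" if "x \<in> carrier L1" for x
    using L.order_iso_height[OF L1.partial_order_axioms oi that] .
  have bij: "bij_betw \<phi> (carrier L1) (carrier L)" using oi by (simp add: order_iso_def)
  show ?thesis
  proof
    show "0 < q" by (rule L.q_pos)
    show "finite (carrier L1)" using bij_betw_finite[OF bij] L.finite_carrier by simp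
    show "carrier L1 \<noteq> {}" using bij L.carrier_nonempty by (auto simp: bij_betw_def)
    show "height L1 x < height L1 y"
      if "x \<in> carrier L1" "y \<in> carrier L1" "x \<sqsubseteq>\<^bsub>L1\<^esub> y" "x \<noteq> y" for x y
      using that L.height_less[of "\<phi> x" "\<phi> y"] cl le eq ht by simp
    show "height L1 (x \<squnion>\<^bsub>L1\<^esub> y) + height L1 (x \<sqinter>\<^bsub>L1\<^esub> y) = height L1 x + height L1 y"
      if "x \<in> carrier L1" "y \<in> carrier L1" for x y
      using that L.height_modular[of "\<phi> x" "\<phi> y"] cl ht iso
      by (simp add: lattice_iso_def join_pres_def meet_pres_def)
    show "\<exists>z\<in>carrier L1. x \<sqsubseteq>\<^bsub>L1\<^esub> z \<and> z \<sqsubseteq>\<^bsub>L1\<^esub> y \<and> height L1 z = height L1 x + 1"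
      if xy: "x \<in> carrier L1" "y \<in> carrier L1" "x \<sqsubseteq>\<^bsub>L1\<^esub> y" "x \<noteq> y" for x y
    proof -
      obtain w where w: "w \<in> carrier L" "\<phi> x \<sqsubseteq>\<^bsub>L\<^esub> w" "w \<sqsubseteq>\<^bsub>L\<^esub> \<phi> y" "height L w = height L (\<phi> x) + 1"
        using L.cover_exists[of "\<phi> x" "\<phi> y"] xy cl le eq by auto
      obtain z where "z \<in> carrier L1" "w = \<phi> z" using order_isoD(4)[OF oi w(1)] by auto
      then show ?thesis using w xy le ht by (intro bexI[of _ z]) auto
    qed
    show "card {x \<in> carrier L1. a \<sqsubseteq>\<^bsub>L1\<^esub> x \<and> x \<sqsubseteq>\<^bsub>L1\<^esub> b \<and> height L1 x = height L1 a + 1} = q + 1"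
      (is "card ?A = _")
      if ab: "a \<in> carrier L1" "b \<in> carrier L1" "a \<sqsubseteq>\<^bsub>L1\<^esub> b" "height L1 b = height L1 a + 2" for a b
    proof -
      let ?B = "{x \<in> carrier L. \<phi> a \<sqsubseteq>\<^bsub>L\<^esub> x \<and> x \<sqsubseteq>\<^bsub>L\<^esub> \<phi> b \<and> height L x = height L (\<phi> a) + 1}"
      have "?B \<subseteq> \<phi> ` ?A"
      proof (rule subsetI)
        fix y assume y: "y \<in> ?B"
        then obtain x where x: "x \<in> carrier L1" "y = \<phi> x" using order_isoD(4)[OF oi, of y] by auto
        then have "x \<in> ?A" using y le[of a x] le[of x b] ht ab by simp
        then show "y \<in> \<phi> ` ?A" using x by simp
      qed
      moreover have "\<phi> ` ?A \<subseteq> ?B"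
      proof (rule image_subsetI)
        show "\<phi> x \<in> ?B" if "x \<in> ?A" for x
          using that cl le[of a x] le[of x b] ht[of x] ht[of a] ab by simp
      qed
      ultimately have img: "\<phi> ` ?A = ?B" by (intro subset_antisym)
      have inj: "inj_on \<phi> ?A"
        by (rule inj_on_subset[of \<phi> "carrier L1"]) (use bij in \<open>auto simp: bij_betw_def\<close>)
      have "card ?A = card ?B" using card_image[OF inj] unfolding img by (rule sym)
      also have "\<dots> = q + 1"
        using ab cl le[of a b] ht[of a] ht[of b] by (intro L.diamond_card) auto
      finally show ?thesis .
    qed
  qed
qed

lemma gauss_number_1 [simp]: "gauss_number (Suc 0) d = d"
  by (simp add: gauss_number_def)

text \<open>
  For \<open>q = 1\<close> the interval \<open>[a, b]\<close> has only one more atom than \<open>[a, H]\<close>, namely \<open>e\<close>. An element \<open>x\<close> not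
  below \<open>H\<close> has an atom not below \<open>H\<close>, so it lies above \<open>e\<close>.
\<close>

lemma antiflag_decomposition_Boolean:
  fixes L (structure)
  assumes "q_lattice L 1" and ab: "a \<in> carrier L" "b \<in> carrier L" "a \<sqsubseteq> b"
    and e: "e \<in> q_lattice.atoms_of L a b" and H: "H \<in> q_lattice.coatoms_of L a b"
    and eH: "\<not> e \<sqsubseteq> H"
  shows "q_lattice.antiflag_decomposition L 1 a b e H {}"
proof -
  interpret q_lattice L 1 by fact
  have ec: "e \<in> carrier L" "a \<sqsubseteq> e" "e \<sqsubseteq> b" "h e = h a + 1" using e by (auto simp: atoms_of_def)
  have Hc: "H \<in> carrier L" "a \<sqsubseteq> H" "H \<sqsubseteq> b" "h H + 1 = h b"
    using H by (auto simp: coatoms_of_def)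
  have sub: "atoms_of a H \<subseteq> atoms_of a b"
  proof (rule subsetI)
    show "x \<in> atoms_of a b" if "x \<in> atoms_of a H" for x
      using that Hc ab le_trans[of x H b] by (simp add: atoms_of_def)
  qed
  have "card (atoms_of a b - atoms_of a H) = (h b - h a) - (h H - h a)"
    using card_Diff_subset[OF _ sub] card_atoms_of[OF ab] card_atoms_of[OF ab(1) Hc(1,2)] by simp
  then have "card (atoms_of a b - atoms_of a H) \<le> 1" using Hc by simp
  moreover have "e \<in> atoms_of a b - atoms_of a H" using e eH by (auto simp: atoms_of_def)
  moreover have "f \<in> atoms_of a b - atoms_of a H"
    if "f \<in> atoms_of a b" "\<not> f \<sqsubseteq> H" for f
    using that by (simp add: atoms_of_def)
  ultimately have only: "f = e" if "f \<in> atoms_of a b" "\<not> f \<sqsubseteq> H" for f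
    using that card_le_Suc0_iff_eq[of "atoms_of a b - atoms_of a H"] by (metis One_nat_def finite_Diff finite_atoms_of)
  have split: "e \<sqsubseteq> x \<longleftrightarrow> \<not> x \<sqsubseteq> H" if x: "x \<in> carrier L" "a \<sqsubseteq> x" "x \<sqsubseteq> b" for x
  proof
    assume "e \<sqsubseteq> x"
    then show "\<not> x \<sqsubseteq> H" using le_trans[of e x H] eH ec Hc x by auto
  next
    assume "\<not> x \<sqsubseteq> H"
    then obtain f where f: "f \<in> atoms_of a x" "\<not> f \<sqsubseteq> H"
      using atom_avoiding[of a x H] x Hc ab by metis
    then have "f \<in> atoms_of a b" using le_trans[of f x b] x ab by (auto simp: atoms_of_def)
    then show "e \<sqsubseteq> x" using only f by (auto simp: atoms_of_def)
  qed
  have "tiles a b {(e, b), (a, H)}"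
    unfolding tiles_def
  proof (intro conjI ballI impI)
    fix p assume "p \<in> {(e, b), (a, H)}"
    then show "case p of (c, d) \<Rightarrow>
        c \<in> carrier L \<and> d \<in> carrier L \<and> a \<sqsubseteq> c \<and> c \<sqsubseteq> d \<and> d \<sqsubseteq> b"
      using ec Hc ab by auto
  next
    fix x assume x: "x \<in> carrier L" "a \<sqsubseteq> x" "x \<sqsubseteq> b"
    show "\<exists>!p. p \<in> {(e, b), (a, H)} \<and> fst p \<sqsubseteq> x \<and> x \<sqsubseteq> snd p"
    proof (cases "x \<sqsubseteq> H")
      case True
      then have "\<not> e \<sqsubseteq> x" using split[OF x] by simp
      then show ?thesis using True x by (intro ex1I[of _ "(a, H)"]) auto
    next
      case False
      then have "e \<sqsubseteq> x" using split[OF x] by simp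
      then show ?thesis using False x by (intro ex1I[of _ "(e, b)"]) auto
    qed
  qed
  then show ?thesis unfolding antiflag_decomposition_def by simp
qed

context q_lattice
begin

text \<open>
  The complement \<open>H\<close> of \<open>e\<close> that belongs to the decomposition is a coatom by modularity.
\<close>

lemma proper_interval_decompositionD:
  assumes ab: "a \<in> carrier L" "b \<in> carrier L" "a \<sqsubseteq> b"
    and P: "proper_interval_decomposition q (interval_lattice L a b) e P"
  obtains H F where "e \<in> atoms_of a b" "H \<in> coatoms_of a b" "\<not> e \<sqsubseteq> H"
    "antiflag_decomposition a b e H F"
proof -
  define J where "J = interval_lattice L a b"
  have J: "carrier J = \<lbrace>a..b\<rbrace>" "le J = le L" "eq J = eq L"
    by (simp_all add: J_def interval_lattice_def)
  note mem = mem_interval[OF J ab] and bt = bottom_interval[OF J ab] top_interval[OF J ab]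
    and ht = height_interval[OF J ab]
  have "atom J e" "interval_partition J P" using P by (simp_all add: proper_interval_decomposition_def J_def)
  then have T: "tiles a b P" and e: "e \<in> carrier J" "height J e = 1"
    using interval_partition_interval[OF J ab] by (auto simp: atom_def)
  obtain H F where HF: "is_complement J e H" "P = {(e, \<top>\<^bsub>J\<^esub>), (\<bottom>\<^bsub>J\<^esub>, H)} \<union> F" "finite F"
    "card F = q ^ (height J \<top>\<^bsub>J\<^esub> - 1) - 1"
    "\<forall>(c, d)\<in>F. atom J c \<and> coatom J d \<and> c \<sqsubseteq>\<^bsub>J\<^esub> d"
    using P unfolding proper_interval_decomposition_def J_def[symmetric] by auto
  have ec: "e \<in> carrier L" "a \<sqsubseteq> e" "e \<sqsubseteq> b" using e mem by auto
  have "h e - h a = 1" using e ht ec by simp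
  then have he: "h e = h a + 1" by simp
  have HJ: "H \<in> carrier J" using HF(1) by (simp add: is_complement_def)
  then have Hc: "H \<in> carrier L" "a \<sqsubseteq> H" "H \<sqsubseteq> b" using mem by auto
  have "e \<sqinter> H = a" "e \<squnion> H = b"
    using HF(1) meet_interval[OF J ab e(1) HJ] join_interval[OF J ab e(1) HJ] bt
    by (auto simp: is_complement_def)
  then have hH: "h H + 1 = h b" "\<not> e \<sqsubseteq> H"
    using height_modular[of e H] ec Hc he le_iff_join[of e H] by auto
  have "c \<in> atoms_of a b \<and> d \<in> coatoms_of a b" if "(c, d) \<in> F" for c d
  proof -
    have cd: "c \<in> carrier J" "height J c = 1" "d \<in> carrier J" "height J d + 1 = height J b"
      using HF(5) that bt by (auto simp: atom_def coatom_def)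
    then have c: "c \<in> carrier L" "a \<sqsubseteq> c" "c \<sqsubseteq> b" "d \<in> carrier L" "a \<sqsubseteq> d" "d \<sqsubseteq> b"
      using mem by auto
    have "h c - h a = 1" "h d - h a + 1 = h b - h a" using cd c ht ab by simp_all
    then show ?thesis using c height_mono[of a d] ab by (auto simp: atoms_of_def coatoms_of_def)
  qed
  then have "antiflag_decomposition a b e H F"
    using HF(2-4) T bt ht[of b] ab by (auto simp: antiflag_decomposition_def)
  moreover have "e \<in> atoms_of a b" "H \<in> coatoms_of a b"
    using ec he Hc hH by (auto simp: atoms_of_def coatoms_of_def)
  ultimately show thesis using that hH by metis
qed

end

lemma q_lattice_subset_lattice:
  assumes E: "finite E"
  shows "q_lattice (subset_lattice E) 1"
proof -
  let ?L = "subset_lattice E"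
  interpret lattice ?L by (rule lattice_subset_lattice)
  have mem: "x \<in> carrier ?L \<longleftrightarrow> x \<subseteq> E" for x by (simp add: subset_lattice_def)
  have le: "x \<sqsubseteq>\<^bsub>?L\<^esub> y \<longleftrightarrow> x \<subseteq> y" for x y by (simp add: subset_lattice_def)
  have ht: "height ?L x = card x" if "x \<subseteq> E" for x using height_subset_lattice[OF E that] .
  have fin: "finite x" if "x \<subseteq> E" for x using that E finite_subset by blast
  have join: "x \<squnion>\<^bsub>?L\<^esub> y = x \<union> y" if "x \<subseteq> E" "y \<subseteq> E" for x y
    using that by (intro join_eqI) (auto simp: mem le)
  have meet: "x \<sqinter>\<^bsub>?L\<^esub> y = x \<inter> y" if "x \<subseteq> E" "y \<subseteq> E" for x y
    using that by (intro meet_eqI) (auto simp: mem le)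
  show ?thesis
  proof
    show "0 < (1::nat)" by simp
    show "finite (carrier ?L)" "carrier ?L \<noteq> {}" using E by (auto simp: subset_lattice_def)
    show "height ?L x < height ?L y" if "x \<in> carrier ?L" "y \<in> carrier ?L" "x \<sqsubseteq>\<^bsub>?L\<^esub> y" "x \<noteq> y" for x y
      using that fin by (auto simp: mem le ht intro!: psubset_card_mono)
    show "height ?L (x \<squnion>\<^bsub>?L\<^esub> y) + height ?L (x \<sqinter>\<^bsub>?L\<^esub> y) = height ?L x + height ?L y"
      if xy: "x \<in> carrier ?L" "y \<in> carrier ?L" for x y
    proof -
      have "x \<subseteq> E" "y \<subseteq> E" "x \<union> y \<subseteq> E" "x \<inter> y \<subseteq> E" using xy by (auto simp: mem)
      then show ?thesis using card_Un_Int[of x y] fin by (simp add: join meet ht)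
    qed
    show "\<exists>z\<in>carrier ?L. x \<sqsubseteq>\<^bsub>?L\<^esub> z \<and> z \<sqsubseteq>\<^bsub>?L\<^esub> y \<and> height ?L z = height ?L x + 1"
      if xy: "x \<in> carrier ?L" "y \<in> carrier ?L" "x \<sqsubseteq>\<^bsub>?L\<^esub> y" "x \<noteq> y" for x y
    proof -
      obtain v where v: "v \<in> y" "v \<notin> x" using xy le by auto
      then have "insert v x \<subseteq> E" "x \<subseteq> E" using xy by (auto simp: mem)
      then show ?thesis using v xy fin by (intro bexI[of _ "insert v x"]) (auto simp: mem le ht)
    qed
    show "card {x \<in> carrier ?L. a \<sqsubseteq>\<^bsub>?L\<^esub> x \<and> x \<sqsubseteq>\<^bsub>?L\<^esub> b \<and> height ?L x = height ?L a + 1} = 1 + 1"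
      (is "card ?A = _")
      if ab: "a \<in> carrier ?L" "b \<in> carrier ?L" "a \<sqsubseteq>\<^bsub>?L\<^esub> b" "height ?L b = height ?L a + 2" for a b
    proof -
      have ab: "a \<subseteq> b" "b \<subseteq> E" "a \<subseteq> E" "card b = card a + 2" using ab by (auto simp: mem le ht)
      have "?A =
          (\<lambda>v. insert v a) ` (b - a)"
      proof (rule Set.set_eqI)
        fix x
        show "x \<in> ?A \<longleftrightarrow>
            x \<in> (\<lambda>v. insert v a) ` (b - a)"
        proof
          assume "x \<in> ?A"
          then have x: "a \<subseteq> x" "x \<subseteq> b" "card x = card a + 1" "x \<subseteq> E" using ab by (auto simp: mem le ht)
          then have "card (x - a) = 1" using fin ab by (simp add: card_Diff_subset)
          then obtain v where "x - a = {v}" using card_1_singletonE by blast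
          then have "x = insert v a" "v \<in> b - a" using x by auto
          then show "x \<in> (\<lambda>v. insert v a) ` (b - a)" by blast
        next
          assume "x \<in> (\<lambda>v. insert v a) ` (b - a)"
          then obtain v where "v \<in> b - a" "x = insert v a" by auto
          then show "x \<in> ?A"
            using ab fin[of a] ht[of "insert v a"] by (auto simp: mem le ht)
        qed
      qed
      moreover have "inj_on (\<lambda>v. insert v a) (b - a)" by (auto simp: inj_on_def)
      ultimately show ?thesis using ab fin by (simp add: card_image card_Diff_subset)
    qed
  qed
qed

section \<open>Subspace lattices over a finite field\<close>

text \<open>
  Over a finite field dimensions can be read off from cardinalities, and the lattice identities
  become identities between powers of \<open>CARD('k)\<close>.
\<close>

locale finite_subspace = vector_space scale
  for scale :: "'k::{field,finite} \<Rightarrow> 'v::ab_group_add \<Rightarrow> 'v" (infixr \<open>*s\<close> 75) +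
  fixes V :: "'v set"
  assumes subspace_V: "subspace V" and finite_V: "finite V"
begin

abbreviation Sub :: "'v set gorder" where "Sub \<equiv> subspace_lattice (*s) V"

lemma mem_Sub: "W \<in> carrier Sub \<longleftrightarrow> subspace W \<and> W \<subseteq> V"
  by (simp add: subspace_lattice_def)

lemma le_Sub: "W \<sqsubseteq>\<^bsub>Sub\<^esub> W' \<longleftrightarrow> W \<subseteq> W'"
  by (simp add: subspace_lattice_def)

lemma finite_mem_Sub: "W \<in> carrier Sub \<Longrightarrow> finite W"
  using finite_V finite_subset by (auto simp: mem_Sub)

lemma one_less_card_field: "1 < CARD('k)"
proof -
  have "card {0, 1 :: 'k} \<le> CARD('k)" by (intro card_mono) auto
  then show ?thesis by simp
qed

lemma card_field_power_inject: "CARD('k) ^ m = CARD('k) ^ n \<Longrightarrow> m = n"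
  using power_inject_exp[OF one_less_card_field] by simp

lemma card_span_insert:
  assumes "subspace W" "finite W" "v \<notin> W"
  shows "card (span (insert v W)) = CARD('k) * card W"
proof -
  let ?f = "\<lambda>(c, w). w + c *s v"
  have "bij_betw ?f (UNIV \<times> W) (span (insert v W))"
    unfolding bij_betw_def
  proof
    show "inj_on ?f (UNIV \<times> W)"
    proof (rule inj_onI, clarify)
      fix c d w u assume *: "w \<in> W" "u \<in> W" "w + c *s v = u + d *s v"
      then have eq: "(c - d) *s v = u - w" by (simp add: algebra_simps)
      have "c = d"
      proof (rule ccontr)
        assume "c \<noteq> d"
        then have "v = inverse (c - d) *s (u - w)" unfolding eq[symmetric] by simp
        moreover have "inverse (c - d) *s (u - w) \<in> W"
          using * assms by (intro subspace_scale subspace_diff) auto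
        ultimately show False using assms(3) by simp
      qed
      then show "c = d \<and> w = u" using * by simp
    qed
    have sp: "span W = W" using assms(1) by simp
    show "?f ` (UNIV \<times> W) = span (insert v W)"
      unfolding span_insert sp
    proof (intro equalityI subsetI)
      fix x assume "x \<in> ?f ` (UNIV \<times> W)"
      then obtain c w where "w \<in> W" "x = w + c *s v" by auto
      then have "x - c *s v \<in> W" by simp
      then show "x \<in> {x. \<exists>k. x - k *s v \<in> W}" by (intro CollectI exI)
    next
      fix x assume "x \<in> {x. \<exists>k. x - k *s v \<in> W}"
      then obtain k where "x - k *s v \<in> W" by blast
      then show "x \<in> ?f ` (UNIV \<times> W)" by (intro image_eqI[of _ _ "(k, x - k *s v)"]) auto
    qed
  qed
  then show ?thesis using bij_betw_same_card by (fastforce simp: card_cartesian_product)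
qed

lemma card_mem_Sub:
  assumes "W \<in> carrier Sub"
  shows "card W = CARD('k) ^ height Sub W"
proof -
  have W: "subspace W" "W \<subseteq> V" "finite W" using assms finite_mem_Sub by (auto simp: mem_Sub)
  obtain B where B: "B \<subseteq> W" "independent B" "W \<subseteq> span B" "card B = dim W"
    using basis_exists by blast
  have "finite B" using B W finite_subset by blast
  then have "independent B \<longrightarrow> card (span B) = CARD('k) ^ card B \<and> finite (span B)"
  proof (induction B)
    case (insert v B)
    show ?case
    proof
      assume ind: "independent (insert v B)"
      then have "v \<notin> span B" "independent B" using insert.hyps by (auto simp: independent_insert)
      then have "card (span (insert v (span B))) = CARD('k) * CARD('k) ^ card B" "finite (span B)"
        using card_span_insert[of "span B" v] insert.IH by auto
      moreover have "span (insert v (span B)) = span (insert v B)"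
        unfolding span_insert span_span by (rule HOL.refl)
      ultimately have *: "card (span (insert v B)) = CARD('k) ^ card (insert v B)"
        using insert.hyps by simp
      have "card (span (insert v B)) \<noteq> 0" unfolding * by simp
      then have "finite (span (insert v B))" by (metis card.infinite)
      with * show "card (span (insert v B)) = CARD('k) ^ card (insert v B) \<and>
          finite (span (insert v B))" by (rule conjI)
    qed
  qed simp
  moreover have "span B = W" by (rule span_subspace[OF B(1,3) W(1)])
  moreover have "height Sub W = dim W"
    by (rule height_subspace_lattice[OF finite_V span_superset subspace_V W(1,2)])
  ultimately show ?thesis using B by simp
qed

text \<open>
  The sum map from \<open>x \<times> y\<close> onto the span of \<open>x \<union> y\<close> has the translates of \<open>x \<inter> y\<close>,
  embedded by \<open>t \<mapsto> (t, - t)\<close>, as fibres.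
\<close>

lemma card_span_Un:
  assumes "subspace x" "subspace y" "finite x" "finite y"
  shows "card (span (x \<union> y)) * card (x \<inter> y) = card x * card y"
proof -
  let ?S = "span (x \<union> y)"
  have S: "?S = {u + w | u w. u \<in> x \<and> w \<in> y}"
    using span_Un[of x y] assms by (simp add: span_eq_iff[THEN iffD2])
  have "?S = (\<lambda>(u, w). u + w) ` (x \<times> y)" unfolding S by auto
  then have fin: "finite ?S" using assms by simp
  have fibre: "card {p \<in> x \<times> y. fst p + snd p = s} = card (x \<inter> y)" if "s \<in> ?S" for s
  proof -
    obtain u w where s: "s = u + w" "u \<in> x" "w \<in> y" using \<open>s \<in> ?S\<close> S by auto
    let ?F = "{p \<in> x \<times> y. fst p + snd p = s}"
    let ?g = "\<lambda>t. (u + t, w - t)"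
    have "bij_betw ?g (x \<inter> y) ?F"
      unfolding bij_betw_def
    proof
      show "inj_on ?g (x \<inter> y)" by (auto simp: inj_on_def)
      show "?g ` (x \<inter> y) = ?F"
      proof
        show "?g ` (x \<inter> y) \<subseteq> ?F"
          using s assms subspace_add subspace_diff by auto
        show "?F \<subseteq> ?g ` (x \<inter> y)"
        proof
          fix p assume p: "p \<in> ?F"
          then obtain u' w' where p': "p = (u', w')" "u' \<in> x" "w' \<in> y" "u' + w' = u + w"
            using s by auto
          then have t: "u' - u = w - w'" by (simp add: algebra_simps)
          have "u' - u \<in> x" using p' s assms subspace_diff by blast
          moreover have "u' - u \<in> y" unfolding t using p' s assms subspace_diff by blast
          moreover have "p = ?g (u' - u)" using p' by (simp add: algebra_simps)
          ultimately show "p \<in> ?g ` (x \<inter> y)" by blast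
        qed
      qed
    qed
    then show ?thesis using bij_betw_same_card by fastforce
  qed
  have "(\<Sum>p\<in>x \<times> y. card {s \<in> ?S. fst p + snd p = s}) = card (x \<inter> y) * card ?S"
    using fibre fin assms by (intro sum_multicount) auto
  moreover have "card {s \<in> ?S. fst p + snd p = s} = 1" if "p \<in> x \<times> y" for p
  proof -
    have "fst p + snd p \<in> ?S"
      unfolding S using that by (intro CollectI exI[of _ "fst p"] exI[of _ "snd p"]) auto
    then have "{s \<in> ?S. fst p + snd p = s} = {fst p + snd p}" by auto
    then show ?thesis by simp
  qed
  ultimately show ?thesis by (simp add: card_cartesian_product mult.commute)
qed

lemma height_le_iff_card_le:
  assumes "x \<in> carrier Sub" "y \<in> carrier Sub"
  shows "height Sub x \<le> height Sub y \<longleftrightarrow> card x \<le> card y"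
  unfolding card_mem_Sub[OF assms(1)] card_mem_Sub[OF assms(2)]
  by (rule power_increasing_iff[OF one_less_card_field, symmetric])

lemma span_insert_mem_Sub:
  assumes "x \<in> carrier Sub" "v \<in> V" "v \<notin> x"
  shows "span (insert v x) \<in> carrier Sub" "height Sub (span (insert v x)) = height Sub x + 1"
proof -
  have "insert v x \<subseteq> V" "subspace x" using assms by (auto simp: mem_Sub)
  then show *: "span (insert v x) \<in> carrier Sub"
    using span_minimal[of "insert v x" V] subspace_V by (simp add: mem_Sub)
  have "card (span (insert v x)) = CARD('k) * card x"
    by (rule card_span_insert[OF \<open>subspace x\<close> finite_mem_Sub[OF assms(1)] assms(3)])
  then have "CARD('k) ^ height Sub (span (insert v x)) = CARD('k) ^ (height Sub x + 1)"
    unfolding card_mem_Sub[OF *] card_mem_Sub[OF assms(1)] by simp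
  then show "height Sub (span (insert v x)) = height Sub x + 1"
    by (rule card_field_power_inject)
qed

lemma finite_Sub: "finite (carrier Sub)"
  by (rule finite_subset[of _ "Pow V"]) (use finite_V in \<open>auto simp: mem_Sub\<close>)

lemma height_less_Sub:
  assumes "x \<in> carrier Sub" "y \<in> carrier Sub" "x \<subseteq> y" "x \<noteq> y"
  shows "height Sub x < height Sub y"
proof -
  have "card x < card y" using assms finite_mem_Sub by (intro psubset_card_mono) auto
  then show ?thesis using height_le_iff_card_le[of y x] assms by linarith
qed

lemma cover_Sub:
  assumes "x \<in> carrier Sub" "y \<in> carrier Sub" "x \<subseteq> y" "x \<noteq> y"
  obtains z where "z \<in> carrier Sub" "x \<subseteq> z" "z \<subseteq> y" "height Sub z = height Sub x + 1"
proof -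
  obtain v where v: "v \<in> y" "v \<notin> x" using assms by auto
  then have "v \<in> V" "insert v x \<subseteq> y" using assms by (auto simp: mem_Sub)
  then have "span (insert v x) \<subseteq> y" using assms span_minimal by (simp add: mem_Sub)
  moreover have "x \<subseteq> span (insert v x)" using span_superset[of "insert v x"] by simp
  ultimately show thesis
    using that span_insert_mem_Sub[OF assms(1) \<open>v \<in> V\<close> v(2)] by blast
qed

text \<open>
  The middle elements \<open>p\<close> partition \<open>b - a\<close> into the sets \<open>p - a\<close>. With \<open>q = CARD('k)\<close> this reads
  \<open>(q\<^sup>2 - 1) |a| = N (q - 1) |a|\<close> for their number \<open>N\<close>.
\<close>

lemma card_diamond_Sub:
  assumes ab: "a \<in> carrier Sub" "b \<in> carrier Sub" "a \<subseteq> b" "height Sub b = height Sub a + 2"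
  shows "card {x \<in> carrier Sub. a \<subseteq> x \<and> x \<subseteq> b \<and> height Sub x = height Sub a + 1} = CARD('k) + 1"
    (is "card ?A = _")
proof -
  have a: "subspace a" "a \<subseteq> b" "finite a" "finite b" "subspace b" "b \<subseteq> V"
    using ab finite_mem_Sub by (auto simp: le_Sub mem_Sub)
  have gen: "p = span (insert v a)" if p: "p \<in> ?A" "v \<in> p" "v \<notin> a" for p v
  proof -
    have pc: "p \<in> carrier Sub" "a \<subseteq> p" "height Sub p = height Sub a + 1"
      using p by (auto simp: le_Sub)
    then have "v \<in> V" using p by (auto simp: mem_Sub)
    note s = span_insert_mem_Sub[OF ab(1) this p(3)]
    have "span (insert v a) \<subseteq> p" using pc p span_minimal[of "insert v a" p] by (auto simp: mem_Sub)
    then show ?thesis using height_less_Sub[OF s(1) pc(1)] s(2) pc(3) by fastforce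
  qed
  have "b - a = (\<Union>p\<in>?A. p - a)"
  proof
    show "b - a \<subseteq> (\<Union>p\<in>?A. p - a)"
    proof
      fix v assume v: "v \<in> b - a"
      then have "v \<in> V" "v \<notin> a" using a by auto
      note s = span_insert_mem_Sub[OF ab(1) this]
      have "span (insert v a) \<subseteq> b" using v a span_minimal[of "insert v a" b] by auto
      moreover have "insert v a \<subseteq> span (insert v a)" by (rule span_superset)
      ultimately show "v \<in> (\<Union>p\<in>?A. p - a)"
        using s v by (intro UN_I[of "span (insert v a)"]) (auto simp: le_Sub)
    qed
  qed (auto simp: le_Sub)
  then have "card (b - a) = card (\<Union>p\<in>?A. p - a)" by simp
  also have "\<dots> = (\<Sum>p\<in>?A. card (p - a))"
  proof (rule card_UN_disjoint)
    show "finite ?A" using finite_Sub by simp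
    show "\<forall>p\<in>?A. finite (p - a)" using finite_mem_Sub by simp
    show "\<forall>p\<in>?A. \<forall>p'\<in>?A. p \<noteq> p' \<longrightarrow> (p - a) \<inter> (p' - a) = {}"
    proof (intro ballI impI equals0I)
      fix p p' v assume "p \<in> ?A" "p' \<in> ?A" "p \<noteq> p'" "v \<in> (p - a) \<inter> (p' - a)"
      then show False using gen[of p v] gen[of p' v] by (metis DiffD1 DiffD2 IntD1 IntD2)
    qed
  qed
  also have "\<dots> = (\<Sum>p\<in>?A. CARD('k) * card a - card a)"
  proof (rule sum.cong[OF HOL.refl])
    fix p assume p: "p \<in> ?A"
    then have "card p = CARD('k) * card a" using card_mem_Sub[of p] card_mem_Sub[OF ab(1)] by simp
    then show "card (p - a) = CARD('k) * card a - card a"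
      using p a by (simp add: card_Diff_subset le_Sub)
  qed
  finally have "card b - card a = card ?A * (CARD('k) * card a - card a)"
    using a by (simp add: card_Diff_subset)
  moreover have "card b = CARD('k) * CARD('k) * card a"
    using card_mem_Sub[OF ab(1)] card_mem_Sub[OF ab(2)] ab(4) by simp
  \<comment> \<open>writing \<open>q = k + 1\<close> avoids the truncated subtraction in \<open>q - 1\<close>\<close>
  moreover obtain k where k: "CARD('k) = Suc k" "k > 0"
    using one_less_card_field by (metis Suc_lessE One_nat_def)
  ultimately have eq: "card ?A * (k * card a) = (k + 2) * (k * card a)"
    by (simp add: algebra_simps)
  have "k * card a \<noteq> 0" using k card_mem_Sub[OF ab(1)] by simp
  then have "card ?A = k + 2" using mult_right_cancel[THEN iffD1, OF _ eq] by blast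
  then show ?thesis unfolding k by simp
qed

lemma q_lattice_Sub: "q_lattice Sub CARD('k)"
proof -
  interpret L: lattice Sub by (rule lattice_subspace_lattice[OF subspace_V])
  have join: "x \<squnion>\<^bsub>Sub\<^esub> y = span (x \<union> y)" if xy: "x \<in> carrier Sub" "y \<in> carrier Sub" for x y
  proof (rule L.join_eqI[OF xy])
    have "x \<union> y \<subseteq> V" using xy by (simp add: mem_Sub)
    then show "span (x \<union> y) \<in> carrier Sub" using subspace_V span_minimal by (simp add: mem_Sub)
    show "x \<sqsubseteq>\<^bsub>Sub\<^esub> span (x \<union> y)" "y \<sqsubseteq>\<^bsub>Sub\<^esub> span (x \<union> y)"
      using span_superset[of "x \<union> y"] by (simp_all add: le_Sub)
    show "span (x \<union> y) \<sqsubseteq>\<^bsub>Sub\<^esub> z" if "z \<in> carrier Sub" "x \<sqsubseteq>\<^bsub>Sub\<^esub> z" "y \<sqsubseteq>\<^bsub>Sub\<^esub> z" for z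
      using that span_minimal[of "x \<union> y" z] by (simp add: le_Sub mem_Sub)
  qed
  have meet: "x \<sqinter>\<^bsub>Sub\<^esub> y = x \<inter> y" if xy: "x \<in> carrier Sub" "y \<in> carrier Sub" for x y
  proof (rule L.meet_eqI[OF xy])
    have "x \<inter> y \<subseteq> V" using xy le_infI1[of x V y] by (simp add: mem_Sub)
    then show "x \<inter> y \<in> carrier Sub" using xy subspace_inter by (simp add: mem_Sub)
  qed (simp_all add: le_Sub)
  show ?thesis
  proof
    show "0 < CARD('k)" using one_less_card_field by simp
    show "finite (carrier Sub)" by (rule finite_Sub)
    have "V \<in> carrier Sub" using subspace_V by (simp add: mem_Sub)
    then show "carrier Sub \<noteq> {}" by (metis empty_iff)
    show "height Sub x < height Sub y"
      if "x \<in> carrier Sub" "y \<in> carrier Sub" "x \<sqsubseteq>\<^bsub>Sub\<^esub> y" "x \<noteq> y" for x y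
      using height_less_Sub that by (simp add: le_Sub)
    show "height Sub (x \<squnion>\<^bsub>Sub\<^esub> y) + height Sub (x \<sqinter>\<^bsub>Sub\<^esub> y) = height Sub x + height Sub y"
      if xy: "x \<in> carrier Sub" "y \<in> carrier Sub" for x y
    proof (rule card_field_power_inject)
      note c = L.join_closed[OF xy] L.meet_closed[OF xy]
      have "card (x \<squnion>\<^bsub>Sub\<^esub> y) * card (x \<sqinter>\<^bsub>Sub\<^esub> y) = card x * card y"
        unfolding join[OF xy] meet[OF xy]
        by (rule card_span_Un) (use xy finite_mem_Sub in \<open>simp_all add: mem_Sub\<close>)
      then show "CARD('k) ^ (height Sub (x \<squnion>\<^bsub>Sub\<^esub> y) + height Sub (x \<sqinter>\<^bsub>Sub\<^esub> y)) =
          CARD('k) ^ (height Sub x + height Sub y)"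
        unfolding power_add card_mem_Sub[OF c(1)] card_mem_Sub[OF c(2)]
          card_mem_Sub[OF xy(1)] card_mem_Sub[OF xy(2)] .
    qed
    show "\<exists>z\<in>carrier Sub. x \<sqsubseteq>\<^bsub>Sub\<^esub> z \<and> z \<sqsubseteq>\<^bsub>Sub\<^esub> y \<and> height Sub z = height Sub x + 1"
      if "x \<in> carrier Sub" "y \<in> carrier Sub" "x \<sqsubseteq>\<^bsub>Sub\<^esub> y" "x \<noteq> y" for x y
      using cover_Sub[of x y] that unfolding le_Sub by metis
    show "card {x \<in> carrier Sub. a \<sqsubseteq>\<^bsub>Sub\<^esub> x \<and> x \<sqsubseteq>\<^bsub>Sub\<^esub> b \<and> height Sub x = height Sub a + 1} = CARD('k) + 1"
      if "a \<in> carrier Sub" "b \<in> carrier Sub" "a \<sqsubseteq>\<^bsub>Sub\<^esub> b" "height Sub b = height Sub a + 2" for a b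
      using card_diamond_Sub that unfolding le_Sub by simp
  qed
qed

section \<open>Transitivity on antiflags\<close>

definition functional :: "('v \<Rightarrow> 'k) \<Rightarrow> bool" where
  "functional f \<longleftrightarrow> (\<forall>x y. f (x + y) = f x + f y) \<and> (\<forall>c x. f (c *s x) = c * f x)"

lemma functional_add: "functional f \<Longrightarrow> f (x + y) = f x + f y"
  and functional_scale: "functional f \<Longrightarrow> f (c *s x) = c * f x"
  by (simp_all add: functional_def)

lemma functional_diff: "functional f \<Longrightarrow> functional g \<Longrightarrow> functional (\<lambda>x. f x - g x)"
  by (simp add: functional_def algebra_simps)

lemma functional_minus:
  assumes "functional f"
  shows "f (x - y) = f x - f y"
proof -
  have "f ((x - y) + y) = f (x - y) + f y" by (rule functional_add[OF assms])
  then show ?thesis by simp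
qed

text \<open>
  Extend a basis of \<open>S\<close> by \<open>v\<close> and prescribe the values on it.
\<close>

lemma separating_functional:
  assumes S: "subspace S" and v: "v \<notin> S"
  obtains f where "functional f" "\<And>x. x \<in> S \<Longrightarrow> f x = 0" "f v = 1"
proof -
  interpret k: vector_space "(*) :: 'k \<Rightarrow> 'k \<Rightarrow> 'k" by unfold_locales (simp_all add: algebra_simps)
  interpret pair: vector_space_pair "(*s)" "(*) :: 'k \<Rightarrow> 'k \<Rightarrow> 'k" ..
  obtain B where B: "B \<subseteq> S" "independent B" "S \<subseteq> span B" using basis_exists[of S] by metis
  have sp: "span B = S" by (rule span_subspace[OF B(1,3) S])
  have "v \<notin> span B" unfolding sp by (rule v)
  then have "independent (insert v B)" using B(2) by (rule independent_insertI)
  from pair.linear_independent_extend[OF this, of "\<lambda>x. if x = v then 1 else 0"]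
  obtain g where g: "Vector_Spaces.linear (*s) (*) g"
      "\<forall>x\<in>insert v B. g x = (if x = v then 1 else 0)"
    by (elim exE conjE)
  have gB: "g x = 0" if "x \<in> B" for x
  proof -
    have "x \<noteq> v" using that v B(1) by auto
    then show ?thesis using g(2) that by simp
  qed
  have "g x = 0" if "x \<in> S" for x
    using pair.linear_eq_0_on_span[OF g(1) gB, of B x] that unfolding sp by simp
  moreover have "functional g"
    unfolding functional_def using pair.linear_add[OF g(1)] pair.linear_scale[OF g(1)] by simp
  ultimately show thesis using that g(2) by simp
qed

definition transvection :: "('v \<Rightarrow> 'k) \<Rightarrow> 'v \<Rightarrow> 'v \<Rightarrow> 'v" where
  "transvection f u x = x + f x *s u"

text \<open>
  The condition \<open>f u = 0\<close> makes the transvection with \<open>- f\<close> the inverse. A subspace is fixed if \<open>f\<close>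
  vanishes on it, and also if it contains \<open>u\<close>.
\<close>

lemma
  assumes f: "functional f" "f u = 0" and u: "u \<in> V"
  shows order_iso_transvection: "order_iso Sub Sub (image (transvection f u))"
    and transvection_fix_kernel: "\<lbrakk>\<And>x. x \<in> W \<Longrightarrow> f x = 0\<rbrakk> \<Longrightarrow> transvection f u ` W = W"
    and transvection_fix_above: "\<lbrakk>W \<in> carrier Sub; u \<in> W\<rbrakk> \<Longrightarrow> transvection f u ` W = W"
proof -
  have T: "transvection g u (x + y) = transvection g u x + transvection g u y"
    "transvection g u (c *s x) = c *s transvection g u x"
    if "functional g" for g x y c
    using that by (simp_all add: transvection_def functional_def algebra_simps)
  have neg: "functional (\<lambda>x. - f x)" using f by (simp add: functional_def)
  have inv: "transvection f u (transvection (\<lambda>x. - f x) u x) = x"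
    "transvection (\<lambda>x. - f x) u (transvection f u x) = x" for x
    using f functional_minus[OF f(1)]
    by (simp_all add: transvection_def functional_add functional_scale)
  have inj: "inj (transvection f u)" using inv(2) by (metis injI)
  have closed: "transvection g u ` W \<in> carrier Sub"
    if g: "functional g" and W: "W \<in> carrier Sub" for g W
  proof -
    have W': "subspace W" "W \<subseteq> V" using W by (auto simp: mem_Sub)
    have "subspace (transvection g u ` W)"
    proof (rule subspaceI)
      have "transvection g u 0 = 0" using T(2)[OF g, of 0 0] by simp
      then show "0 \<in> transvection g u ` W" using W'(1) subspace_0 by (metis imageI)
      show "x + y \<in> transvection g u ` W"
        if "x \<in> transvection g u ` W" "y \<in> transvection g u ` W" for x y
        using that T(1)[OF g] subspace_add[OF W'(1)] by (auto simp: image_iff) metis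
      show "c *s x \<in> transvection g u ` W" if "x \<in> transvection g u ` W" for c x
        using that T(2)[OF g] subspace_scale[OF W'(1)] by (auto simp: image_iff) metis
    qed
    moreover have "transvection g u x \<in> V" if "x \<in> W" for x
      unfolding transvection_def using that W' u subspace_V by (intro subspace_add subspace_scale) auto
    ultimately show ?thesis by (auto simp: mem_Sub)
  qed
  have "bij_betw (image (transvection f u)) (carrier Sub) (carrier Sub)"
  proof (rule bij_betw_byWitness[where f' = "image (transvection (\<lambda>x. - f x) u)"])
    show "image (transvection f u) ` carrier Sub \<subseteq> carrier Sub"
      "image (transvection (\<lambda>x. - f x) u) ` carrier Sub \<subseteq> carrier Sub"
      using closed f(1) neg by auto
  qed (simp_all add: image_image inv)
  then show "order_iso Sub Sub (image (transvection f u))"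
    using inj by (simp add: order_iso_def le_Sub inj_image_subset_iff)
  show "transvection f u ` W = W" if "\<And>x. x \<in> W \<Longrightarrow> f x = 0"
    using that by (simp add: transvection_def)
  show "transvection f u ` W = W" if "W \<in> carrier Sub" "u \<in> W"
  proof (rule card_subset_eq)
    show "finite W" using that finite_mem_Sub by simp
    show "transvection f u ` W \<subseteq> W"
      using that subspace_add subspace_scale by (auto simp: transvection_def mem_Sub)
    show "card (transvection f u ` W) = card W" using inj by (simp add: card_image inj_on_def)
  qed
qed

text \<open>
  A first transvection, along the difference of two vectors, moves \<open>e\<close> to \<open>e'\<close>. A second one, along a
  vector \<open>w\<close> of \<open>e'\<close>, moves the image of \<open>H\<close> to \<open>H'\<close> and fixes \<open>e'\<close>. Both fix \<open>a\<close>, on which their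
  functionals vanish, and \<open>b\<close>, which contains their directions.
\<close>

lemma antiflag_transitive:
  assumes ab: "a \<in> carrier Sub" "b \<in> carrier Sub" "a \<sqsubseteq>\<^bsub>Sub\<^esub> b"
    and e: "e \<in> q_lattice.atoms_of Sub a b" "e' \<in> q_lattice.atoms_of Sub a b"
    and H: "H \<in> q_lattice.coatoms_of Sub a b" "H' \<in> q_lattice.coatoms_of Sub a b"
    and eH: "\<not> e \<sqsubseteq>\<^bsub>Sub\<^esub> H" "\<not> e' \<sqsubseteq>\<^bsub>Sub\<^esub> H'"
  obtains \<psi> where "order_iso Sub Sub \<psi>" "\<psi> a = a" "\<psi> b = b" "\<psi> e = e'" "\<psi> H = H'"
proof -
  interpret L: q_lattice Sub "CARD('k)" by (rule q_lattice_Sub)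
  have ht: "height Sub (\<psi> x) = height Sub x" if "order_iso Sub Sub \<psi>" "x \<in> carrier Sub" for \<psi> x
    using L.order_iso_height[OF L.partial_order_axioms that] by simp
  have sub: "subspace a" "subspace b" "a \<subseteq> b" "b \<subseteq> V" using ab by (auto simp: mem_Sub le_Sub)
  have atomD: "x \<in> carrier Sub" "subspace x" "a \<subseteq> x" "x \<subseteq> b" "height Sub x = height Sub a + 1"
    if "x \<in> L.atoms_of a b" for x using that by (auto simp: L.atoms_of_def le_Sub mem_Sub)
  have coatomD: "x \<in> carrier Sub" "subspace x" "a \<subseteq> x" "x \<subseteq> b" "height Sub x + 1 = height Sub b"
    if "x \<in> L.coatoms_of a b" for x using that by (auto simp: L.coatoms_of_def le_Sub mem_Sub)
  have eqI: "x = y" if "x \<in> carrier Sub" "y \<in> carrier Sub" "x \<subseteq> y" "height Sub x = height Sub y" for x y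
    using that L.height_eqD[of x y] by (simp add: le_Sub)
  have atom_gen: "x = span (insert v a)" if x: "x \<in> L.atoms_of a b" and v: "v \<in> x" "v \<notin> a" for x v
  proof -
    note xD = atomD[OF x]
    have "v \<in> V" using v xD sub by auto
    note s = span_insert_mem_Sub[OF ab(1) this v(2)]
    have "span (insert v a) \<subseteq> x" using v xD span_minimal[of "insert v a" x] by auto
    then show ?thesis using eqI[OF s(1) xD(1)] s(2) xD(5) by simp
  qed
  have coatom_gen: "b = span (insert v x)" if x: "x \<in> L.coatoms_of a b" and v: "v \<in> b" "v \<notin> x" for x v
  proof -
    note xD = coatomD[OF x]
    have "v \<in> V" using v sub by auto
    note s = span_insert_mem_Sub[OF xD(1) this v(2)]
    have "span (insert v x) \<subseteq> b" using v xD sub span_minimal[of "insert v x" b] by auto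
    then show ?thesis using eqI[OF s(1) ab(2)] s(2) xD(5) by simp
  qed
  have new_vector: "\<exists>v\<in>x. v \<notin> a" if "x \<in> L.atoms_of a b" for x
    using atomD[OF that] by (metis add.right_neutral add_left_cancel subsetI subset_antisym zero_neq_one)
  obtain \<psi>1 where psi1: "order_iso Sub Sub \<psi>1" "\<psi>1 a = a" "\<psi>1 b = b" "\<psi>1 e = e'"
  proof (cases "e = e'")
    case True
    then show thesis using that[of id] by (simp add: order_iso_def)
  next
    case False
    obtain v w where v: "v \<in> e" "v \<notin> a" and w: "w \<in> e'" "w \<notin> a" using new_vector e by metis
    have "v \<notin> e'" using False atom_gen[OF e(1) v] atom_gen[OF e(2) _ v(2)] by blast
    define u where "u = w - v"
    have uV: "u \<in> b" "u \<in> V"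
    proof -
      have "v \<in> b" "w \<in> b" using v w atomD(4)[OF e(1)] atomD(4)[OF e(2)] by auto
      then show "u \<in> b" unfolding u_def using sub(2) subspace_diff by simp
      then show "u \<in> V" using sub(4) by auto
    qed
    \<comment> \<open>otherwise \<open>v\<close> would lie in \<open>e'\<close>, or \<open>w\<close> in \<open>a\<close>; so some functional vanishes on \<open>a\<close> and equals
      one on both \<open>v\<close> and \<open>w\<close>\<close>
    have "v \<notin> span (insert u a)"
    proof
      assume "v \<in> span (insert u a)"
      then obtain c where c: "v - c *s u \<in> a" using span_breakdown_eq[of v u a] span_eq_iff[THEN iffD2, OF sub(1)] by auto
      have "(v - c *s u) + c *s w \<in> e'"
        using c w(1) atomD[OF e(2)] by (intro subspace_add subspace_scale) auto
      then have "(1 + c) *s v \<in> e'" by (simp add: u_def algebra_simps)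
      then have "inverse (1 + c) *s (1 + c) *s v \<in> e'" using atomD(2)[OF e(2)] subspace_scale by blast
      then have "1 + c = 0" using \<open>v \<notin> e'\<close> by (cases "1 + c = 0") auto
      then have "c = - 1" by (simp add: eq_neg_iff_add_eq_0 add.commute)
      then have "w \<in> a" using c by (simp add: u_def)
      then show False using w by simp
    qed
    then obtain f where f: "functional f" "\<And>x. x \<in> span (insert u a) \<Longrightarrow> f x = 0" "f v = 1"
      using separating_functional[OF subspace_span] by metis
    have f0: "f u = 0" "\<And>x. x \<in> a \<Longrightarrow> f x = 0" using f(2) span_base by auto
    note iso = order_iso_transvection[OF f(1) f0(1) uV(2)]
    let ?T = "transvection f u"
    have Ta: "?T ` a = a" using transvection_fix_kernel[OF f(1) f0(1) uV(2)] f0(2) by blast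
    moreover have "?T ` b = b" using transvection_fix_above[OF f(1) f0(1) uV(2) ab(2) uV(1)] .
    moreover have "?T ` e = e'"
    proof -
      have "?T v = w" using f(3) by (simp add: transvection_def u_def)
      then have "w \<in> ?T ` e" using v by blast
      moreover have "a \<subseteq> ?T ` e" using Ta atomD(3)[OF e(1)] by blast
      moreover have Te: "?T ` e \<in> carrier Sub" using order_isoD(1)[OF iso] atomD(1)[OF e(1)] by simp
      ultimately have "span (insert w a) \<subseteq> ?T ` e"
        using span_minimal[of "insert w a" "?T ` e"] by (auto simp: mem_Sub)
      then have "e' \<subseteq> ?T ` e" using atom_gen[OF e(2) w] by simp
      then show ?thesis
        using eqI[OF atomD(1)[OF e(2)] Te] ht[OF iso atomD(1)[OF e(1)]] atomD(5)[OF e(1)] atomD(5)[OF e(2)]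
        by simp
    qed
    ultimately show thesis using that iso by metis
  qed
  define H1 where "H1 = \<psi>1 H"
  have H1: "H1 \<in> L.coatoms_of a b" "\<not> e' \<subseteq> H1"
  proof -
    note le = order_isoD(2)[OF psi1(1)]
    have "a \<subseteq> \<psi>1 H" using le[of a H] coatomD[OF H(1)] ab psi1 by (simp add: le_Sub)
    moreover have "\<psi>1 H \<subseteq> b" using le[of H b] coatomD[OF H(1)] ab psi1 by (simp add: le_Sub)
    ultimately show "H1 \<in> L.coatoms_of a b"
      using coatomD[OF H(1)] ht[OF psi1(1)] order_isoD(1)[OF psi1(1)]
      by (simp add: H1_def L.coatoms_of_def le_Sub)
    show "\<not> e' \<subseteq> H1"
      using le[of e H] atomD[OF e(1)] coatomD[OF H(1)] psi1 eH by (simp add: le_Sub H1_def)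
  qed
  obtain w where w: "w \<in> e'" "w \<notin> a" using new_vector e by metis
  have wb: "w \<in> b" "w \<in> V" using w atomD[OF e(2)] sub by auto
  have wH: "w \<notin> H1" "w \<notin> H'"
  proof -
    have *: "e' \<subseteq> x" if "w \<in> x" "x \<in> L.coatoms_of a b" for x
      using atom_gen[OF e(2) w] span_minimal[of "insert w a" x] coatomD[OF that(2)] that(1) by simp
    show "w \<notin> H1" "w \<notin> H'" using *[of H1] *[of H'] H1 H(2) eH by (auto simp: le_Sub)
  qed
  obtain f where f: "functional f" "\<And>x. x \<in> H1 \<Longrightarrow> f x = 0" "f w = 1"
    using separating_functional[OF coatomD(2)[OF H1(1)] wH(1)] by metis
  obtain g where g: "functional g" "\<And>x. x \<in> H' \<Longrightarrow> g x = 0" "g w = 1"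
    using separating_functional[OF coatomD(2)[OF H(2)] wH(2)] by metis
  \<comment> \<open>on \<open>H1\<close> the transvection along \<open>w\<close> subtracts \<open>g x *s w\<close>, which brings \<open>g\<close> to zero; and the kernel
    of \<open>g\<close> in \<open>b\<close> is \<open>H'\<close>\<close>
  let ?f = "\<lambda>x. f x - g x"
  let ?T = "transvection ?f w"
  have ff: "functional ?f" "?f w = 0" using functional_diff[OF f(1) g(1)] f g by auto
  note iso = order_iso_transvection[OF ff wb(2)]
  have fa: "?f x = 0" if "x \<in> a" for x
  proof -
    have "x \<in> H1" "x \<in> H'" using that coatomD(3)[OF H1(1)] coatomD(3)[OF H(2)] by auto
    then show ?thesis using f(2) g(2) by simp
  qed
  have fix_ab: "?T ` a = a" "?T ` b = b" "?T ` e' = e'"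
    using transvection_fix_kernel[OF ff wb(2), of a] fa
      transvection_fix_above[OF ff wb(2) ab(2) wb(1)]
      transvection_fix_above[OF ff wb(2) atomD(1)[OF e(2)] w(1)] by auto
  have "?T ` H1 \<subseteq> H'"
  proof
    fix y assume "y \<in> ?T ` H1"
    then obtain x where x: "x \<in> H1" "y = ?T x" by auto
    then have yb: "y \<in> b" using fix_ab(2) coatomD(4)[OF H1(1)] by blast
    have gy: "g y = 0" using x f(2)[OF x(1)] g(3) functional_minus[OF g(1)]
      by (simp add: transvection_def functional_scale[OF g(1)])
    obtain c where c: "y - c *s w \<in> H'"
      using yb coatom_gen[OF H(2) wb(1) wH(2)] span_breakdown_eq[of y w H']
        span_eq_iff[THEN iffD2, OF coatomD(2)[OF H(2)]] by auto
    have "g (y - c *s w) = g y - c * g w" 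
      using functional_minus[OF g(1)] functional_scale[OF g(1)] by simp
    then have "c = 0" using g(2)[OF c] gy g(3) by simp
    then show "y \<in> H'" using c by simp
  qed
  moreover have "H1 \<in> carrier Sub" using coatomD[OF H1(1)] by simp
  moreover have "?T ` H1 \<in> carrier Sub" using order_isoD(1)[OF iso] calculation by simp
  ultimately have TH: "?T ` H1 = H'"
    using eqI[of "?T ` H1" H'] ht[OF iso, of H1] coatomD[OF H1(1)] coatomD[OF H(2)] by simp
  show thesis
    using that[OF order_iso_comp[OF psi1(1) iso]] psi1 fix_ab TH by (simp add: H1_def)
qed

end

lemma finite_coord_space: "finite (coord_space n :: (nat \<Rightarrow> 'k::{field,finite}) set)"
proof -
  have "coord_space n \<subseteq> {v. \<forall>i. (i \<in> {..<n} \<longrightarrow> v i \<in> (UNIV :: 'k set)) \<and> (i \<notin> {..<n} \<longrightarrow> v i = 0)}"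
    by (auto simp: coord_space_def)
  then show ?thesis
    using finite_set_of_finite_funs[of "{..<n}" "UNIV :: 'k set" 0] finite_subset by auto
qed

section \<open>The two classes\<close>

lemma decomposable_matroid:
  assumes "M \<in> matroids"
  shows "decomposable_q_matroid M 1"
proof -
  have "Boolean_lattice M" and rank: "rank_function M" using assms by (auto simp: matroids_def)
  then obtain E \<phi> where "finite (E :: nat set)" "lattice_iso M (subset_lattice E) \<phi>"
    by (auto simp: Boolean_lattice_def)
  then have L: "q_lattice M 1" using q_lattice_lattice_iso q_lattice_subset_lattice by blast
  then interpret q_matroid M 1 using rank by (intro q_matroid.intro q_matroid_axioms.intro)
  show ?thesis
    using antiflag_decomposition_Boolean[OF L] by unfold_locales blast
qed

text \<open>
  Within an interval, move the decomposition supplied by the hypothesis to the prescribed pair by an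
  automorphism of the subspace lattice, transported along \<open>\<phi>\<close>.
\<close>

lemma decomposable_linear_q_matroid:
  assumes M: "M \<in> decomposable_q_matroids TYPE('k::{field,finite})"
  shows "decomposable_q_matroid M CARD('k)"
proof -
  let ?scale = "coord_scale :: 'k \<Rightarrow> (nat \<Rightarrow> 'k) \<Rightarrow> nat \<Rightarrow> 'k"
  have lin: "linear_lattice TYPE('k) M" and rank: "rank_function M"
    using M by (auto simp: decomposable_q_matroids_def q_matroids_def)
  obtain n \<phi> where \<phi>: "lattice_iso M (subspace_lattice ?scale (coord_space n)) \<phi>"
    using lin by (auto simp: linear_lattice_def)
  interpret vector_space ?scale by (rule vector_space_coord_scale)
  interpret S: finite_subspace ?scale "coord_space n"
    by unfold_locales (rule subspace_coord_space finite_coord_space)+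
  have L: "q_lattice M CARD('k)" by (rule q_lattice_lattice_iso[OF S.q_lattice_Sub \<phi>])
  then interpret M: q_matroid M "CARD('k)" using rank by (intro q_matroid.intro q_matroid_axioms.intro)
  interpret Q: q_lattice S.Sub "CARD('k)" by (rule S.q_lattice_Sub)
  have iso: "order_iso M S.Sub \<phi>" by (rule lattice_iso_imp_order_iso[OF \<phi>])
  note cl = order_isoD(1)[OF iso] and le = order_isoD(2)[OF iso] and eq = order_isoD(3)[OF iso]
  have ht: "height M x = height S.Sub (\<phi> x)" if "x \<in> carrier M" for x
    using Q.order_iso_height[OF M.partial_order_axioms iso that] .
  define \<chi> where "\<chi> = inv_into (carrier M) \<phi>"
  have \<chi>: "order_iso S.Sub M \<chi>" unfolding \<chi>_def by (rule order_iso_inv[OF iso])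
  have \<chi>\<phi>: "\<chi> (\<phi> x) = x" if "x \<in> carrier M" for x
    unfolding \<chi>_def using iso that by (simp add: order_iso_def bij_betw_def)
  show ?thesis
  proof unfold_locales
    fix a b e H assume ab: "a \<in> carrier M" "b \<in> carrier M" "a \<sqsubseteq>\<^bsub>M\<^esub> b"
      and e: "e \<in> M.atoms_of a b" and H: "H \<in> M.coatoms_of a b" and eH: "\<not> e \<sqsubseteq>\<^bsub>M\<^esub> H"
    have "1 \<le> height M b - height M a"
      using e M.height_mono[of e b] ab by (auto simp: M.atoms_of_def)
    then have "\<exists>e P. proper_interval_decomposition CARD('k) (interval_lattice M a b) e P"
      using M ab unfolding decomposable_q_matroids_def by simp
    then obtain e0 P where "proper_interval_decomposition CARD('k) (interval_lattice M a b) e0 P"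
      by (elim exE)
    then obtain H0 F where F: "e0 \<in> M.atoms_of a b" "H0 \<in> M.coatoms_of a b" "\<not> e0 \<sqsubseteq>\<^bsub>M\<^esub> H0"
      "M.antiflag_decomposition a b e0 H0 F"
      using M.proper_interval_decompositionD[OF ab] by metis
    have at: "x \<in> carrier M" "\<phi> x \<in> Q.atoms_of (\<phi> a) (\<phi> b)" if "x \<in> M.atoms_of a b" for x
      using that cl le ht ab by (auto simp: M.atoms_of_def Q.atoms_of_def)
    have co: "x \<in> carrier M" "\<phi> x \<in> Q.coatoms_of (\<phi> a) (\<phi> b)" if "x \<in> M.coatoms_of a b" for x
      using that cl le ht ab by (auto simp: M.coatoms_of_def Q.coatoms_of_def)
    obtain \<psi> where \<psi>: "order_iso S.Sub S.Sub \<psi>" "\<psi> (\<phi> a) = \<phi> a" "\<psi> (\<phi> b) = \<phi> b"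
      "\<psi> (\<phi> e0) = \<phi> e" "\<psi> (\<phi> H0) = \<phi> H"
    proof (rule S.antiflag_transitive[of "\<phi> a" "\<phi> b" "\<phi> e0" "\<phi> e" "\<phi> H0" "\<phi> H"])
      show "\<phi> a \<in> carrier S.Sub" "\<phi> b \<in> carrier S.Sub" "\<phi> a \<sqsubseteq>\<^bsub>S.Sub\<^esub> \<phi> b"
        using cl le ab by auto
      show "\<phi> e0 \<in> Q.atoms_of (\<phi> a) (\<phi> b)" "\<phi> e \<in> Q.atoms_of (\<phi> a) (\<phi> b)"
        "\<phi> H0 \<in> Q.coatoms_of (\<phi> a) (\<phi> b)" "\<phi> H \<in> Q.coatoms_of (\<phi> a) (\<phi> b)"
        using at co e H F by auto
      show "\<not> \<phi> e0 \<sqsubseteq>\<^bsub>S.Sub\<^esub> \<phi> H0" "\<not> \<phi> e \<sqsubseteq>\<^bsub>S.Sub\<^esub> \<phi> H"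
        using le at co e H F eH by auto
    qed
    have auto_iso: "order_iso M M (\<chi> \<circ> (\<psi> \<circ> \<phi>))"
      by (rule order_iso_comp[OF order_iso_comp[OF iso \<psi>(1)] \<chi>])
    have "M.antiflag_decomposition a b ((\<chi> \<circ> (\<psi> \<circ> \<phi>)) e0) ((\<chi> \<circ> (\<psi> \<circ> \<phi>)) H0)
        (map_prod (\<chi> \<circ> (\<psi> \<circ> \<phi>)) (\<chi> \<circ> (\<psi> \<circ> \<phi>)) ` F)"
      using M.antiflag_decomposition_iso[OF auto_iso ab(1,2) _ _ F(4)] \<psi> \<chi>\<phi> ab at(1)[OF F(1)] co(1)[OF F(2)]
      by simp
    then show "\<exists>F. M.antiflag_decomposition a b e H F"
      using \<psi> \<chi>\<phi> at(1)[OF e] co(1)[OF H] by auto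
  qed
qed

theorem proposition75:
  fixes \<M> :: "'a ranked_lattice set" and q :: nat
  assumes "\<M> = matroids \<and> q = 1 \<or>
           \<M> = decomposable_q_matroids TYPE('k::{field,finite}) \<and> q = CARD('k)"
  shows "q_Tutte_Grothendieck_invariant q \<M> Tutte_polynomial"
proof -
  have dec: "decomposable_q_matroid M q" if "M \<in> \<M>" for M
    using assms that decomposable_matroid decomposable_linear_q_matroid by blast
  then have qm: "q_matroid M q" if "M \<in> \<M>" for M
    using that by (simp add: decomposable_q_matroid_def)
  show ?thesis
    unfolding q_Tutte_Grothendieck_invariant_def
  proof (intro conjI ballI impI allI)
    show "Tutte_polynomial M1 = Tutte_polynomial M2"
      if "M1 \<in> \<M>" "M2 \<in> \<M>" "ranked_iso M1 M2" for M1 M2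
      using decomposable_q_matroid.Tutte_polynomial_iso[OF dec qm] that by blast
    show "Tutte_polynomial M = Tutte_polynomial (restriction M e) * Tutte_polynomial (contraction M e)"
      if "M \<in> \<M>" "prime_free M" "atom M e" for M e
      using q_matroid.Tutte_polynomial_prime_free[OF qm] that by blast
    show "\<exists>P. proper_interval_decomposition q M e P \<and>
        Tutte_polynomial M = (\<Sum>(a, b)\<in>P. Tutte_polynomial (minor M a b))"
      if "M \<in> \<M>" "\<not> prime_free M"
        "atom M e \<and> independent_element M e \<and> (\<forall>x. coloop M x \<longrightarrow> e \<sqsubseteq>\<^bsub>M\<^esub> x)" for M e
      using decomposable_q_matroid.Tutte_polynomial_decomposition[OF dec] that by blast
  qed
qed

end
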